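(* Let $\{x_n\}_{n\ge0}$ be a Markov chain satisfying the geometric ergodicity assumption, and let $\{L_i\}_{i\ge1}$ be the regeneration cycle lengths of the split chain of its $m$-skeleton (both as in the context). Then the cycle lengths $\{L_i\}_{i\ge1}$ are independent, $\{L_i\}_{i\ge2}$ are i.i.d., and there exist constants $b>0$ and $\rho\in(0,1)$ such that $$\mathbb{P}(L_i>\ell)\le b\,\rho^{\ell},\qquad\forall\, i\ge1,\ \ell\ge0.$$
   Context: Geometric ergodicity assumption: the Markov kernel $P$ on a general state space $(\mathcal{X},\mathcal{B})$ is $\psi$-irreducible and aperiodic; there exist a petite set $C_0$, constants $\lambda\in[0,1)$ and $L<\infty$, and a function $V:\mathcal{X}\to[1,\infty)$ such that $PV\le\lambda V+L\mathbf{1}_{C_0}$; moreover the initial distribution of $x_0$ satisfies $\mathbb{E}[V(x_0)]<\infty$. (Terminology of Meyn and Tweedie.) Small set: it is standard that under this assumption there exist an accessible set $\bar C\in\mathcal{B}$ (for every $x$ there is $n\ge 1$ with $P^n(x,\bar C)>0$), a constant $\kappa>1$ with $\sup_{x\in\bar C}\mathbb{E}_x[a^{\sigma_{\bar C}}]<\infty$ for all $a\in(1,\kappa]$, where $\sigma_{\bar C}=\inf\{n\ge1:x_n\in\bar C\}$, and $m\in\mathbb{N}$, $m\ge1$, $\beta\in(0,1)$ and a probability measure $\nu$ with $\nu(\bar C)=1$ such that $P^m(x,\cdot)\ge\beta\mathbf{1}_{\bar C}(x)\nu(\cdot)$ for all $x\in\mathcal{X}$. Fix such $\bar C,\kappa,m,\beta,\nu$.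 Split chain: $\Phi=\{(x_n,y_n)\}_{n\ge0}$ is the Nummelin splitting of the $m$-skeleton, on $\mathcal{X}\times\{0,1\}$, whose first coordinate has the law of the original chain. At each block boundary $km$, given the past and $x_{km}$, $y_{km}$ is Bernoulli with parameter $\beta\mathbf{1}_{\bar C}(x_{km})$. Given $y_{km}=1$, $x_{(k+1)m}\sim\nu$; given $y_{km}=0$ and $x_{km}=x$, $x_{(k+1)m}$ has law $(P^m(x,\cdot)-\beta\mathbf{1}_{\bar C}(x)\nu)/(1-\beta\mathbf{1}_{\bar C}(x))$; the intermediate states $x_{km+1},\dots,x_{(k+1)m-1}$ are drawn from the conditional law under $P$ given the endpoints $x_{km},x_{(k+1)m}$. Thus $(\bar C,1):=\bar C\times\{1\}$ is an atom of $\{(x_{km},y_{km})\}_{k\ge0}$. Cycles: $r_1:=\inf\{k\ge0:(x_{km},y_{km})\in(\bar C,1)\}$, $r_i:=\inf\{k>r_{i-1}:(x_{km},y_{km})\in(\bar C,1)\}$ for $i\ge2$; $\tau_0:=0$, $\tau_i:=r_i+1$ and $L_i:=\tau_i-\tau_{i-1}$ for $i\ge1$. *)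

theory Defs
  imports "HOL-Probability.Probability"
begin

section \<open>Markov kernels and chains\<close>

text \<open>Only the sets of \<open>X\<close> matter: it is the state space with its sigma-algebra.\<close>

definition markov_kernel :: "'a measure \<Rightarrow> ('a \<Rightarrow> 'a measure) \<Rightarrow> bool" where
  "markov_kernel X P \<longleftrightarrow> P \<in> X \<rightarrow>\<^sub>M prob_algebra X"

primrec kernel_pow :: "'a measure \<Rightarrow> ('a \<Rightarrow> 'a measure) \<Rightarrow> nat \<Rightarrow> 'a \<Rightarrow> 'a measure" where
  "kernel_pow X P 0 x = return X x"
| "kernel_pow X P (Suc n) x = kernel_pow X P n x \<bind> P"

text \<open>The law \<open>P\<^sub>x\<close> of the chain started at \<open>x\<close>, on the space of trajectories, by the
  Ionescu-Tulcea theorem.\<close>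

definition chain_step ::
    "'a measure \<Rightarrow> ('a \<Rightarrow> 'a measure) \<Rightarrow> 'a \<Rightarrow> nat \<Rightarrow> (nat \<Rightarrow> 'a) \<Rightarrow> 'a measure" where
  "chain_step X P x n w = (case n of 0 \<Rightarrow> return X x | Suc k \<Rightarrow> P (w k))"

definition path_law :: "'a measure \<Rightarrow> ('a \<Rightarrow> 'a measure) \<Rightarrow> 'a \<Rightarrow> (nat \<Rightarrow> 'a) measure" where
  "path_law X P x =
     projective_family.lim UNIV (Ionescu_Tulcea.CI (chain_step X P x) (\<lambda>_. X)) (\<lambda>_. X)"

lemma Ionescu_Tulcea_chain_step:
  assumes "markov_kernel X P" "x \<in> space X"
  shows "Ionescu_Tulcea (chain_step X P x) (\<lambda>_. X)"
proof (rule Ionescu_Tulcea.intro)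
  have P: "P \<in> X \<rightarrow>\<^sub>M prob_algebra X"
    using assms(1) by (simp add: markov_kernel_def)
  note [measurable] = measurable_prob_algebraD[OF P]
  show "chain_step X P x i \<in> PiM {0..<i} (\<lambda>_. X) \<rightarrow>\<^sub>M subprob_algebra X" for i
  proof (cases i)
    case 0
    have "return X x \<in> space (subprob_algebra X)"
      using measurable_space[OF return_measurable assms(2)] .
    then show ?thesis
      unfolding chain_step_def 0 by simp
  next
    case (Suc k)
    show ?thesis
      unfolding chain_step_def Suc by simp
  qed
  fix i :: nat and w assume that: "w \<in> space (PiM {0..<i} (\<lambda>_. X))"
  show "prob_space (chain_step X P x i w)"
  proof (cases i)
    case 0
    then show ?thesis
      using assms(2) by (simp add: chain_step_def prob_space_return)
  next
    case (Suc k)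
    with that have "w k \<in> space X"
      by (auto simp: space_PiM)
    from measurable_space[OF P this] show ?thesis
      by (simp add: chain_step_def Suc space_prob_algebra)
  qed
qed

lemma prob_space_path_law:
  assumes "markov_kernel X P" "x \<in> space X"
  shows "prob_space (path_law X P x)"
proof -
  interpret Ionescu_Tulcea "chain_step X P x" "\<lambda>_. X"
    by (rule Ionescu_Tulcea_chain_step[OF assms])
  have "prob_space (distr PF.lim (PiM {} (\<lambda>_. X)) (\<lambda>w. restrict w {}))"
    by (subst distr_lim) (auto intro!: PF.prob_space_P)
  then show ?thesis
    unfolding path_law_def
    by (rule prob_space_distrD[rotated]) (auto simp: measurable_cong_sets[OF PF.sets_lim refl])
qed

lemma sets_path_law:
  assumes "markov_kernel X P" "x \<in> space X"
  shows "sets (path_law X P x) = sets (PiM UNIV (\<lambda>_. X))"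
proof -
  interpret Ionescu_Tulcea "chain_step X P x" "\<lambda>_. X"
    by (rule Ionescu_Tulcea_chain_step[OF assms])
  show ?thesis
    unfolding path_law_def by simp
qed

definition cprob :: "'w measure \<Rightarrow> 'w measure \<Rightarrow> 'w set \<Rightarrow> 'w \<Rightarrow> real" where
  "cprob \<Omega> F E = real_cond_exp \<Omega> F (indicator E)"

text \<open>\<open>cond_law \<Omega> F Z S \<kappa>\<close>: given the sigma-algebra \<open>F\<close>, the \<open>S\<close>-valued variable \<open>Z\<close> has the
  (random) conditional law \<open>\<kappa>\<close>, which is given by its values on events.\<close>

definition cond_law ::
    "'w measure \<Rightarrow> 'w measure \<Rightarrow> ('w \<Rightarrow> 'b) \<Rightarrow> 'b measure \<Rightarrow> ('w \<Rightarrow> 'b set \<Rightarrow> real) \<Rightarrow> bool" where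
  "cond_law \<Omega> F Z S \<kappa> \<longleftrightarrow>
     (\<forall>A\<in>sets S. AE \<omega> in \<Omega>. cprob \<Omega> F {\<omega> \<in> space \<Omega>. Z \<omega> \<in> A} \<omega> = \<kappa> \<omega> A)"

definition markov_chain ::
    "'w measure \<Rightarrow> 'a measure \<Rightarrow> ('a \<Rightarrow> 'a measure) \<Rightarrow> (nat \<Rightarrow> 'w \<Rightarrow> 'a) \<Rightarrow> bool" where
  "markov_chain \<Omega> X P x \<longleftrightarrow>
     prob_space \<Omega> \<and> (\<forall>n. x n \<in> \<Omega> \<rightarrow>\<^sub>M X) \<and>
     (\<forall>n. cond_law \<Omega>
            (vimage_algebra (space \<Omega>) (\<lambda>\<omega>. \<lambda>i\<in>{..n}. x i \<omega>) (PiM {..n} (\<lambda>_. X)))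
            (x (Suc n)) X (\<lambda>\<omega> A. measure (P (x n \<omega>)) A))"

section \<open>Irreducibility, aperiodicity, petite sets and return times\<close>

definition return_time :: "'a set \<Rightarrow> (nat \<Rightarrow> 'a) \<Rightarrow> enat" where
  "return_time A w = Inf {enat n | n. 1 \<le> n \<and> w n \<in> A}"

definition irreducibility_measure ::
    "'a measure \<Rightarrow> ('a \<Rightarrow> 'a measure) \<Rightarrow> 'a measure \<Rightarrow> bool" where
  "irreducibility_measure X P \<phi> \<longleftrightarrow>
     sets \<phi> = sets X \<and> sigma_finite_measure \<phi> \<and> emeasure \<phi> (space X) > 0 \<and>
     (\<forall>A\<in>sets X. emeasure \<phi> A > 0 \<longrightarrow>
        (\<forall>x\<in>space X.
           emeasure (path_law X P x) {w \<in> space (path_law X P x). return_time A w < \<infinity>} > 0))"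

text \<open>In the convention of Meyn and Tweedie, \<open>\<psi>\<close>-irreducibility entails that \<open>\<psi>\<close> is a maximal
  irreducibility measure.\<close>

definition psi_irreducible ::
    "'a measure \<Rightarrow> ('a \<Rightarrow> 'a measure) \<Rightarrow> 'a measure \<Rightarrow> bool" where
  "psi_irreducible X P \<psi> \<longleftrightarrow>
     irreducibility_measure X P \<psi> \<and>
     (\<forall>\<phi>. irreducibility_measure X P \<phi> \<longrightarrow> absolutely_continuous \<psi> \<phi>)"

definition is_cycle ::
    "'a measure \<Rightarrow> ('a \<Rightarrow> 'a measure) \<Rightarrow> 'a measure \<Rightarrow> nat \<Rightarrow> (nat \<Rightarrow> 'a set) \<Rightarrow> bool" where
  "is_cycle X P \<psi> d D \<longleftrightarrow>
     d \<ge> 1 \<and> (\<forall>i<d. D i \<in> sets X) \<and> disjoint_family_on D {..<d} \<and>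
     (\<forall>i<d. \<forall>x\<in>D i. emeasure (P x) (D (Suc i mod d)) = 1) \<and>
     emeasure \<psi> (space X - (\<Union>i<d. D i)) = 0"

definition is_period ::
    "'a measure \<Rightarrow> ('a \<Rightarrow> 'a measure) \<Rightarrow> 'a measure \<Rightarrow> nat \<Rightarrow> bool" where
  "is_period X P \<psi> d \<longleftrightarrow>
     (\<exists>D. is_cycle X P \<psi> d D) \<and> (\<forall>d' D'. is_cycle X P \<psi> d' D' \<longrightarrow> d' \<le> d)"

definition aperiodic ::
    "'a measure \<Rightarrow> ('a \<Rightarrow> 'a measure) \<Rightarrow> 'a measure \<Rightarrow> bool" where
  "aperiodic X P \<psi> \<longleftrightarrow> is_period X P \<psi> 1"

definition petite :: "'a measure \<Rightarrow> ('a \<Rightarrow> 'a measure) \<Rightarrow> 'a set \<Rightarrow> bool" where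
  "petite X P C \<longleftrightarrow>
     C \<in> sets X \<and>
     (\<exists>(a :: nat pmf) \<nu>. sets \<nu> = sets X \<and> emeasure \<nu> (space X) > 0 \<and>
        (\<forall>x\<in>C. \<forall>B\<in>sets X.
           emeasure \<nu> B \<le> (\<Sum>n. ennreal (pmf a n) * emeasure (kernel_pow X P n x) B)))"

definition drift_condition ::
    "'a measure \<Rightarrow> ('a \<Rightarrow> 'a measure) \<Rightarrow> ('a \<Rightarrow> real) \<Rightarrow> real \<Rightarrow> real \<Rightarrow> 'a set \<Rightarrow> bool" where
  "drift_condition X P V lam b C \<longleftrightarrow>
     V \<in> borel_measurable X \<and> (\<forall>x\<in>space X. 1 \<le> V x) \<and>
     (\<forall>x\<in>space X. (\<integral>\<^sup>+z. ennreal (V z) \<partial>P x) \<le> ennreal (lam * V x + b * indicator C x))"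

definition accessible :: "'a measure \<Rightarrow> ('a \<Rightarrow> 'a measure) \<Rightarrow> 'a set \<Rightarrow> bool" where
  "accessible X P C \<longleftrightarrow>
     C \<in> sets X \<and> (\<forall>x\<in>space X. \<exists>n\<ge>1. emeasure (kernel_pow X P n x) C > 0)"

text \<open>\<open>E\<^sub>x[a^\<sigma>]\<close> for the return time \<open>\<sigma>\<close> to \<open>C\<close>, where \<open>a^\<infinity> = \<infinity>\<close> (it is used for \<open>a > 1\<close>).\<close>

definition return_moment ::
    "'a measure \<Rightarrow> ('a \<Rightarrow> 'a measure) \<Rightarrow> 'a set \<Rightarrow> real \<Rightarrow> 'a \<Rightarrow> ennreal" where
  "return_moment X P C a x =
     (\<integral>\<^sup>+w. (case return_time C w of enat n \<Rightarrow> ennreal (a ^ n) | \<infinity> \<Rightarrow> \<infinity>) \<partial>path_law X P x)"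

definition minorization ::
    "'a measure \<Rightarrow> ('a \<Rightarrow> 'a measure) \<Rightarrow> 'a set \<Rightarrow> nat \<Rightarrow> real \<Rightarrow> 'a measure \<Rightarrow> bool" where
  "minorization X P C m \<beta> \<nu> \<longleftrightarrow>
     m \<ge> 1 \<and> 0 < \<beta> \<and> \<beta> < 1 \<and> prob_space \<nu> \<and> sets \<nu> = sets X \<and> emeasure \<nu> C = 1 \<and>
     (\<forall>x\<in>space X. \<forall>A\<in>sets X. measure (kernel_pow X P m x) A \<ge> \<beta> * indicator C x * measure \<nu> A)"

section \<open>The split chain of the \<open>m\<close>-skeleton\<close>

text \<open>The sigma-algebra generated by \<open>x\<^sub>i\<close>, \<open>i \<in> I\<close>, and \<open>y\<^sub>j\<close>, \<open>j \<in> J\<close>.\<close>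

definition history ::
    "'w measure \<Rightarrow> 'a measure \<Rightarrow> (nat \<Rightarrow> 'w \<Rightarrow> 'a) \<Rightarrow> (nat \<Rightarrow> 'w \<Rightarrow> bool) \<Rightarrow>
     nat set \<Rightarrow> nat set \<Rightarrow> 'w measure" where
  "history \<Omega> X x y I J =
     vimage_algebra (space \<Omega>) (\<lambda>\<omega>. (\<lambda>i\<in>I. x i \<omega>, \<lambda>j\<in>J. y j \<omega>))
       (PiM I (\<lambda>_. X) \<Otimes>\<^sub>M PiM J (\<lambda>_. count_space UNIV))"

text \<open>\<open>q\<close> is a version of the conditional probability, under the law of the chain started at \<open>u\<close>,
  that the states at times \<open>1, \<dots>, m - 1\<close> form a path in \<open>A\<close>, given that the state at time \<open>m\<close>
  is \<open>z\<close>.  Working with one event \<open>A\<close> at a time avoids assuming that regular versions exist,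
  which can fail on a general state space.\<close>

definition bridge_prob ::
    "'a measure \<Rightarrow> ('a \<Rightarrow> 'a measure) \<Rightarrow> nat \<Rightarrow> (nat \<Rightarrow> 'a) set \<Rightarrow> ('a \<times> 'a \<Rightarrow> real) \<Rightarrow> bool" where
  "bridge_prob X P m A q \<longleftrightarrow>
     q \<in> borel_measurable (X \<Otimes>\<^sub>M X) \<and>
     (\<forall>u\<in>space X. AE w in path_law X P u.
        cprob (path_law X P u) (vimage_algebra (space (path_law X P u)) (\<lambda>w. w m) X)
          {w \<in> space (path_law X P u). (\<lambda>i\<in>{1..<m}. w i) \<in> A} w
        = q (u, w m))"

text \<open>The value \<open>y = 1\<close> is represented by \<^const>\<open>True\<close>.  Only the variables \<open>y\<close> at multiples of \<open>m\<close>
  are constrained (apart from measurability).\<close>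

definition nummelin_splitting ::
    "'w measure \<Rightarrow> 'a measure \<Rightarrow> ('a \<Rightarrow> 'a measure) \<Rightarrow> 'a set \<Rightarrow> nat \<Rightarrow> real \<Rightarrow> 'a measure \<Rightarrow>
     (nat \<Rightarrow> 'w \<Rightarrow> 'a) \<Rightarrow> (nat \<Rightarrow> 'w \<Rightarrow> bool) \<Rightarrow> bool" where
  "nummelin_splitting \<Omega> X P C m \<beta> \<nu> x y \<longleftrightarrow>
     prob_space \<Omega> \<and> (\<forall>n. x n \<in> \<Omega> \<rightarrow>\<^sub>M X) \<and> (\<forall>n. y n \<in> \<Omega> \<rightarrow>\<^sub>M count_space UNIV) \<and>
     (\<forall>k. cond_law \<Omega> (history \<Omega> X x y {..k * m} {j * m | j. j < k})
            (y (k * m)) (count_space UNIV)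
            (\<lambda>\<omega> B. measure (measure_pmf (bernoulli_pmf (\<beta> * indicator C (x (k * m) \<omega>)))) B)) \<and>
     (\<forall>k. cond_law \<Omega> (history \<Omega> X x y {..k * m} {j * m | j. j \<le> k})
            (x (Suc k * m)) X
            (\<lambda>\<omega> A. if y (k * m) \<omega> then measure \<nu> A
              else (measure (kernel_pow X P m (x (k * m) \<omega>)) A
                      - \<beta> * indicator C (x (k * m) \<omega>) * measure \<nu> A)
                   / (1 - \<beta> * indicator C (x (k * m) \<omega>)))) \<and>
     (\<forall>A\<in>sets (PiM {1..<m} (\<lambda>_. X)). \<exists>q. bridge_prob X P m A q \<and>
        (\<forall>k. AE \<omega> in \<Omega>.
           cprob \<Omega> (history \<Omega> X x y (insert (Suc k * m) {..k * m}) {j * m | j. j \<le> k})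
             {\<omega> \<in> space \<Omega>. (\<lambda>i\<in>{1..<m}. x (k * m + i) \<omega>) \<in> A} \<omega>
           = q (x (k * m) \<omega>, x (Suc k * m) \<omega>)))"

section \<open>Regeneration cycles along a trajectory\<close>

text \<open>An infimum over the empty set is \<open>\<infinity>\<close>, so a time that does not occur is \<open>\<infinity>\<close>.
  The index \<open>0\<close> of \<open>regen_time\<close> is a dummy.\<close>

fun regen_time :: "'a set \<Rightarrow> nat \<Rightarrow> (nat \<Rightarrow> 'a) \<Rightarrow> (nat \<Rightarrow> bool) \<Rightarrow> nat \<Rightarrow> enat" where
  "regen_time C m x y 0 = 0"
| "regen_time C m x y (Suc 0) = Inf {enat k | k. (x (k * m), y (k * m)) \<in> C \<times> {True}}"
| "regen_time C m x y (Suc (Suc i)) =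
     Inf {enat k | k. enat k > regen_time C m x y (Suc i) \<and> (x (k * m), y (k * m)) \<in> C \<times> {True}}"

definition cycle_end :: "'a set \<Rightarrow> nat \<Rightarrow> (nat \<Rightarrow> 'a) \<Rightarrow> (nat \<Rightarrow> bool) \<Rightarrow> nat \<Rightarrow> enat" where
  "cycle_end C m x y i = (if i = 0 then 0 else regen_time C m x y i + 1)"

text \<open>Since \<open>\<infinity> - t = \<infinity>\<close> for all \<open>t\<close> in \<^typ>\<open>enat\<close>, including \<open>t = \<infinity>\<close>, the length of a cycle that
  does not end is \<open>\<infinity>\<close>.\<close>

definition cycle_length ::
    "'a set \<Rightarrow> nat \<Rightarrow> (nat \<Rightarrow> 'w \<Rightarrow> 'a) \<Rightarrow> (nat \<Rightarrow> 'w \<Rightarrow> bool) \<Rightarrow> nat \<Rightarrow> 'w \<Rightarrow> enat" where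
  "cycle_length C m x y i \<omega> =
     cycle_end C m (\<lambda>n. x n \<omega>) (\<lambda>n. y n \<omega>) i - cycle_end C m (\<lambda>n. x n \<omega>) (\<lambda>n. y n \<omega>) (i - 1)"

end

theory Submission
  imports Defs
begin

text \<open>
  Killing the split \<open>m\<close>-skeleton at the atom leaves the sub-Markov kernel \<open>Q = P^m - \<beta> 1\<^sub>C \<otimes> \<nu>\<close>, so that
  \<open>P(L\<^sub>1 > l) = \<mu> Q^l 1\<close> for the initial law \<open>\<mu>\<close>.  From the drift condition, petiteness of \<open>C\<^sub>0\<close> and
  accessibility of \<open>C\<close>, the set \<open>C\<close> is reached from a sublevel set of \<open>V\<close> in bounded time with probability
  bounded below; by aperiodicity the minorization can be used to correct the hitting time modulo \<open>m\<close>.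
  Hence \<open>Q\<close> loses a fixed fraction of the mass on \<open>{V \<le> r}\<close> within \<open>N\<close> steps, while the drift
  controls the mass outside, and \<open>Q^N\<close> contracts \<open>V + A\<close> for a large constant \<open>A\<close>.
  The law \<open>\<nu>\<close> after a visit to the atom satisfies \<open>\<nu> V < \<infinity>\<close> by the minorization, so the same
  bound applies to the later cycles.

  After a visit to the atom at time \<open>k m\<close> the chain restarts from \<open>\<nu>\<close> independently of its past, and the
  renewal equation for the killed laws shows that the probabilities of the possible cycle lengths do not
  depend on that past.  Summing over the time of the \<open>n\<close>-th visit gives independence and equality in law.
\<close>

text \<open>The obstacle is that hitting and killing concern different processes. Drift, petiteness
  and aperiodicity bound P^(mj)(u, C) for the unkilled skeleton, whereas mass is lost only through
  the mass that the killed laws put on C. Decomposing an unkilled hit at the first regeneration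
  settles this: the hit either happens before any killing or follows a killed visit. At each of the
  times up to J, the hits are therefore bounded by 1 + \<beta> times the total killed mass on C up
  to J, and \<beta> times this total is exactly the mass that is lost. No lower bound for hits under
  Q itself is needed.

  The same renewal identity is used a second time. It is triangular in time, so it computes the
  killed masses on C from the starting law alone, and two starts from multiples of \<nu> give
  proportional masses.

  All laws are kept unnormalized: a flow carries the mass of the event on which it lives. Null
  events then need no conditioning, and the initial law and every restart after a regeneration are
  instances of one notion.\<close>

section \<open>Arithmetic and analytic preliminaries\<close>

lemma add_closed_mult:
  fixes F :: "nat set"
  assumes "\<And>a b. a \<in> F \<Longrightarrow> b \<in> F \<Longrightarrow> a + b \<in> F" "c \<in> F" "k \<ge> 1"
  shows "k * c \<in> F"
  using assms(3) by (induction k rule: dec_induct) (auto simp: assms)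

text \<open>Euclidean division by the least positive difference d. With q = a div d, both a + q (c +
  d) and 2 a + q c lie in F and differ by a mod d, so a nonzero remainder would be a smaller
  difference. The pair c, c + d is returned because d = 1 then gives two consecutive
  elements.\<close>

lemma add_closed_least_difference:
  fixes F :: "nat set"
  assumes add: "\<And>a b. a \<in> F \<Longrightarrow> b \<in> F \<Longrightarrow> a + b \<in> F" and m: "m \<in> F" "m \<ge> 1"
  obtains d c where "d \<ge> 1" "c \<in> F" "c + d \<in> F" "\<And>a. a \<in> F \<Longrightarrow> d dvd a"
proof -
  define Q where "Q d \<longleftrightarrow> d \<ge> 1 \<and> (\<exists>c\<in>F. c + d \<in> F)" for d
  have "Q m"
    using m add unfolding Q_def by blast
  define d where "d = (LEAST d. Q d)"
  have "Q d"
    unfolding d_def by (rule LeastI[of Q, OF \<open>Q m\<close>])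
  then obtain c where d: "d \<ge> 1" and c: "c \<in> F" "c + d \<in> F"
    unfolding Q_def by blast
  have "d dvd a" if a: "a \<in> F" for a
  proof (rule ccontr)
    assume "\<not> d dvd a"
    then have r: "0 < a mod d" by (simp add: mod_greater_zero_iff_not_dvd)
    have e: "a + a div d * (c + d) \<in> F"
      using a c add add_closed_mult[OF add c(2), of "a div d"] by (cases "a div d = 0") auto
    have "a + a + a div d * c \<in> F"
      using a c add add_closed_mult[OF add c(1), of "a div d"] by (cases "a div d = 0") auto
    also have "a + a + a div d * c = (a + a div d * (c + d)) + a mod d"
      using div_mult_mod_eq[of a d] by (simp add: algebra_simps)
    finally have "Q (a mod d)"
      using e r unfolding Q_def by (intro conjI bexI[of _ "a + a div d * (c + d)"]) auto
    moreover have "a mod d < d" using d by simp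
    ultimately show False
      using not_less_Least[of "a mod d" Q] unfolding d_def by simp
  qed
  with d c show thesis by (rule that)
qed

text \<open>A sum of m terms, j of them c + 1 and the others c, equals m c + j. Residue 0 is treated
  apart because \<open>add_closed_mult\<close> does not allow zero copies; there m itself is the
  witness.\<close>

lemma add_closed_all_residues:
  fixes F :: "nat set"
  assumes add: "\<And>a b. a \<in> F \<Longrightarrow> b \<in> F \<Longrightarrow> a + b \<in> F" and m: "m \<in> F" "m \<ge> 1"
    and c: "c \<in> F" "c + 1 \<in> F"
  shows "\<exists>n\<in>F. n mod m = s mod m"
proof (cases "s mod m = 0")
  case True
  with m show ?thesis by (intro bexI[of _ m]) auto
next
  case False
  define j where "j = s mod m"
  have "s mod m < m" using m by simp
  with False have j: "1 \<le> j" "1 \<le> m - j"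
    unfolding j_def by auto
  have "(m - j) * c + j * (c + 1) \<in> F"
    using j by (intro add add_closed_mult[OF add] c)
  also have "(m - j) * c + j * (c + 1) = ((m - j) + j) * c + j"
    by (simp only: add_mult_distrib) simp
  also have "\<dots> = m * c + j"
    using j by simp
  finally show ?thesis
    by (intro bexI[of _ "m * c + j"]) (simp_all add: j_def)
qed

lemma dvd_add_imp_mod_eq:
  fixes a b d s :: nat
  assumes "d dvd s + a" "d dvd s + b"
  shows "a mod d = b mod d"
proof -
  have "int d dvd int s + int a" "int d dvd int s + int b"
    using assms by (metis of_nat_add of_nat_dvd_iff)+
  from dvd_diff[OF this] have "int a mod int d = int b mod int d"
    by (simp add: mod_eq_dvd_iff)
  then show ?thesis
    by (metis of_nat_mod of_nat_eq_iff)
qed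

lemma mod_complement_eq:
  fixes i j n n' d :: nat
  assumes "(n + i) mod d = 0" "(n' + j) mod d = 0" "i < d" "j < d" "n mod d = n' mod d"
  shows "i = j"
proof -
  have "int d dvd int n + int i" "int d dvd int n' + int j"
    using assms(1,2) by (metis dvd_eq_mod_eq_0 of_nat_add of_nat_dvd_iff)+
  from dvd_diff[OF this] have 1: "int d dvd (int n - int n') + (int i - int j)"
    by (simp add: algebra_simps)
  have "int n mod int d = int n' mod int d"
    using assms(5) by (metis of_nat_mod)
  then have "int d dvd int n - int n'"
    by (simp add: mod_eq_dvd_iff)
  with 1 have "int d dvd int i - int j"
    using dvd_add_right_iff by blast
  then have "int i mod int d = int j mod int d"
    by (simp add: mod_eq_dvd_iff)
  with assms(3,4) show ?thesis by simp
qed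

text \<open>The proof shows that \<open>v + A M\<close> contracts over \<open>N\<close> steps for a large constant \<open>A\<close>.  The level \<open>r\<close> has to
  be fixed before \<open>N\<close> and \<open>\<delta>\<close>, which in the application depend on it.\<close>

lemma contraction_decay:
  fixes v M h :: "nat \<Rightarrow> real" and \<gamma> K \<delta> r :: real
  assumes \<gamma>: "0 \<le> \<gamma>" "\<gamma> < 1" and K: "0 \<le> K" and \<delta>: "0 < \<delta>" and N: "1 \<le> N"
    and r: "r = 4 * (K / (1 - \<gamma>) + 1) / (1 - \<gamma>)"
    and nonneg: "\<And>k. 0 \<le> v k" "\<And>k. 0 \<le> M k"
    and v_step: "\<And>k. v (Suc k) \<le> \<gamma> * v k + K * M k"
    and M_step: "\<And>k. M (Suc k) \<le> M k"
    and M_drop: "\<And>k. M (k + N) + \<delta> * h k \<le> M k"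
    and markov: "\<And>k. M k \<le> h k + v k / r"
  shows "\<exists>b>0. \<exists>\<rho>. 0 < \<rho> \<and> \<rho> < 1 \<and> (\<forall>k. M k \<le> b * \<rho> ^ k)"
proof -
  \<comment> \<open>K / (1 - \<gamma>) is the geometric sum of the drift errors; adding 1 keeps K'
    positive when K = 0.\<close>
  define K' where "K' = K / (1 - \<gamma>) + 1"
  have K': "K' > 0" using \<gamma> K by (simp add: K'_def add_nonneg_pos)
  have r_pos: "r > 0" using K' \<gamma> by (simp add: r K'_def[symmetric])
  have M_mono: "M (k + n) \<le> M k" for k n
    by (induction n) (auto intro: order_trans[OF M_step])
  have v_iter: "v (k + n) \<le> \<gamma> ^ n * v k + K / (1 - \<gamma>) * M k" for k n
  proof (induction n)
    case 0
    show ?case using \<gamma> K nonneg(2)[of k] by simp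
  next
    case (Suc n)
    have "v (k + Suc n) \<le> \<gamma> * v (k + n) + K * M (k + n)"
      using v_step[of "k + n"] by simp
    also have "\<dots> \<le> \<gamma> * (\<gamma> ^ n * v k + K / (1 - \<gamma>) * M k) + K * M k"
      using \<gamma> K by (intro add_mono mult_left_mono Suc M_mono) auto
    also have "\<dots> = \<gamma> ^ Suc n * v k + (\<gamma> * (K / (1 - \<gamma>)) + K) * M k"
      by (simp add: algebra_simps)
    also have "\<gamma> * (K / (1 - \<gamma>)) + K = K / (1 - \<gamma>)"
      using \<gamma> by (simp add: field_simps)
    finally show ?case .
  qed
  \<comment> \<open>Chosen so that A \<delta> = 2 K'. The drop then removes 2 K' h k, which by
    \<open>markov\<close> and the value of r is at least 2 K' M k - (1 - \<gamma>) / 2 * v k. This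
    outweighs the gain K' M k of the drift and spends only half of the margin 1 - \<gamma> in
    v.\<close>
  define A where "A = 2 * K' / \<delta>"
  have A: "A > 0" using K' \<delta> by (simp add: A_def)
  define w where "w k = v k + A * M k" for k
  \<comment> \<open>The contraction factors of the two summands of w. The second may be negative;
    the first keeps the maximum positive.\<close>
  define \<rho>' where "\<rho>' = max ((1 + \<gamma>) / 2) (1 - \<delta> / 2)"
  have \<rho>': "0 < \<rho>'" "\<rho>' < 1" using \<gamma> \<delta> by (auto simp: \<rho>'_def less_max_iff_disj)
  have w_nonneg: "0 \<le> w k" for k
    using nonneg A by (simp add: w_def)
  have w_step: "w (k + N) \<le> \<rho>' * w k" for k
  proof -
    have "\<gamma> ^ N \<le> \<gamma>"
      using power_decreasing[of 1 N \<gamma>] N \<gamma> by simp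
    then have "\<gamma> ^ N * v k \<le> \<gamma> * v k"
      using nonneg(1) by (rule mult_right_mono)
    then have f1: "v (k + N) \<le> \<gamma> * v k + K' * M k"
      using v_iter[of k N] nonneg(2)[of k] by (simp add: K'_def algebra_simps)
    have "A * M (k + N) \<le> A * (M k - \<delta> * h k)"
      using M_drop[of k] A by (intro mult_left_mono) auto
    also have "\<dots> = A * M k - 2 * (K' * h k)"
      using \<delta> by (simp add: A_def field_simps)
    finally have f2: "A * M (k + N) \<le> A * M k - 2 * (K' * h k)" .
    have "2 * K' * (M k - v k / r) \<le> 2 * K' * h k"
      using markov[of k] K' by (intro mult_left_mono) auto
    moreover have "2 * K' * (M k - v k / r) = 2 * (K' * M k) - (1 - \<gamma>) / 2 * v k"
      using K' \<gamma> unfolding r K'_def[symmetric] by (simp add: field_simps)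
    ultimately have f3: "2 * (K' * M k) - (1 - \<gamma>) / 2 * v k \<le> 2 * (K' * h k)"
      by simp
    have e: "(1 - \<gamma>) / 2 * v k = v k / 2 - \<gamma> * v k / 2" "(1 + \<gamma>) / 2 * v k = v k / 2 + \<gamma> * v k / 2"
      "(A - K') * M k = A * M k - K' * M k"
      by (simp_all add: field_simps)
    have "w (k + N) \<le> (1 + \<gamma>) / 2 * v k + (A - K') * M k"
      using f1 f2 f3 unfolding w_def e by linarith
    also have "A - K' = (1 - \<delta> / 2) * A"
      using \<delta> by (simp add: A_def field_simps)
    also have "(1 + \<gamma>) / 2 * v k + (1 - \<delta> / 2) * A * M k \<le> \<rho>' * v k + \<rho>' * A * M k"
      using nonneg A by (intro add_mono mult_right_mono) (auto simp: \<rho>'_def)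
    finally show ?thesis by (simp add: w_def algebra_simps)
  qed
  have w_iter: "w (q * N) \<le> \<rho>' ^ q * w 0" for q
  proof (induction q)
    case (Suc q)
    have "w (Suc q * N) \<le> \<rho>' * w (q * N)"
      using w_step[of "q * N"] by (simp add: add.commute)
    also have "\<dots> \<le> \<rho>' * (\<rho>' ^ q * w 0)"
      using \<rho>' by (intro mult_left_mono Suc) simp
    finally show ?case by simp
  qed simp
  define \<rho> where "\<rho> = root N \<rho>'"
  have \<rho>: "0 < \<rho>" "\<rho> < 1" "\<rho> ^ N = \<rho>'"
    using \<rho>' N by (auto simp: \<rho>_def)
  have "M k \<le> (w 0 / (A * \<rho>') + 1) * \<rho> ^ k" for k
  proof -
    have "k = k div N * N + k mod N" by simp
    then have "M k \<le> M (k div N * N)"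
      using M_mono by metis
    also have "A * M (k div N * N) \<le> w (k div N * N)"
      using nonneg(1) by (simp add: w_def)
    then have "M (k div N * N) \<le> w (k div N * N) / A"
      using A by (simp add: field_simps)
    also have "\<dots> \<le> \<rho>' ^ (k div N) * w 0 / A"
      using w_iter A by (intro divide_right_mono) auto
    \<comment> \<open>Rounding k down to a multiple of N costs at most one factor \<rho>^N =
      \<rho>'.\<close>
    also have "\<rho>' ^ (k div N) \<le> \<rho> ^ k / \<rho>'"
    proof -
      have "\<rho> ^ N \<le> \<rho> ^ (k mod N)"
        using \<rho> N by (intro power_decreasing) (auto intro: less_imp_le)
      then have "\<rho>' ^ (k div N) * \<rho>' \<le> \<rho>' ^ (k div N) * \<rho> ^ (k mod N)"
        using \<rho>' \<rho> by (intro mult_left_mono) auto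
      also have "\<dots> = \<rho> ^ (N * (k div N) + k mod N)"
        by (simp only: power_add power_mult \<rho>)
      finally show ?thesis using \<rho>' by (simp add: field_simps)
    qed
    then have "\<rho>' ^ (k div N) * w 0 / A \<le> \<rho> ^ k / \<rho>' * w 0 / A"
      using w_nonneg A by (intro divide_right_mono mult_right_mono) auto
    also have "\<dots> \<le> (w 0 / (A * \<rho>') + 1) * \<rho> ^ k"
      using \<rho> by (simp add: field_simps)
    finally show ?thesis .
  qed
  moreover have "w 0 / (A * \<rho>') + 1 > 0"
    using w_nonneg[of 0] A \<rho>' by (simp add: add_nonneg_pos)
  ultimately show ?thesis using \<rho> by blast
qed

lemma sum_ge_imp_ex_ge:
  fixes f :: "nat \<Rightarrow> real"
  assumes "c \<le> (\<Sum>j<n. f j)" "0 < n"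
  shows "\<exists>j<n. c / n \<le> f j"
proof (rule ccontr)
  assume "\<not> ?thesis"
  then have "(\<Sum>j<n. f j) < (\<Sum>j<n. c / n)"
    using assms(2) by (intro sum_strict_mono) auto
  with assms show False by simp
qed

section \<open>Markov kernels\<close>

locale markov_kernel_on =
  fixes X :: "'a measure" and P :: "'a \<Rightarrow> 'a measure"
  assumes kernel: "markov_kernel X P"
begin

section \<open>Kernel powers and the Chapman-Kolmogorov equation\<close>

abbreviation kp :: "nat \<Rightarrow> 'a \<Rightarrow> 'a measure" where
  "kp \<equiv> kernel_pow X P"

lemma P_prob[measurable]: "P \<in> X \<rightarrow>\<^sub>M prob_algebra X"
  using kernel by (simp add: markov_kernel_def)

lemma P_subprob[measurable]: "P \<in> X \<rightarrow>\<^sub>M subprob_algebra X"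
  by (rule measurable_prob_algebraD[OF P_prob])

lemma kp_prob[measurable]: "kp n \<in> X \<rightarrow>\<^sub>M prob_algebra X"
proof (induction n)
  case 0
  have "return X \<in> X \<rightarrow>\<^sub>M prob_algebra X" by measurable
  then show ?case by (simp cong: measurable_cong)
next
  case (Suc n)
  have "(\<lambda>x. kp n x \<bind> P) \<in> X \<rightarrow>\<^sub>M prob_algebra X"
    by (rule measurable_bind_prob_space[OF Suc P_prob])
  then show ?case by simp
qed

lemma kp_subprob[measurable]: "kp n \<in> X \<rightarrow>\<^sub>M subprob_algebra X"
  by (rule measurable_prob_algebraD[OF kp_prob])

lemma kp_space: "u \<in> space X \<Longrightarrow> prob_space (kp n u)"
  and sets_kp: "u \<in> space X \<Longrightarrow> sets (kp n u) = sets X"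
  using measurable_space[OF kp_prob, of u n] by (auto simp: space_prob_algebra)

lemma space_kp: "u \<in> space X \<Longrightarrow> space (kp n u) = space X"
  by (rule sets_eq_imp_space_eq[OF sets_kp])

lemma nn_integral_kp_Suc:
  assumes "u \<in> space X" and f: "f \<in> borel_measurable X"
  shows "(\<integral>\<^sup>+z. f z \<partial>kp (Suc n) u) = (\<integral>\<^sup>+z. (\<integral>\<^sup>+w. f w \<partial>P z) \<partial>kp n u)"
proof -
  have "P \<in> kp n u \<rightarrow>\<^sub>M subprob_algebra X"
    using P_subprob by (simp add: measurable_cong_sets[OF sets_kp[OF assms(1)]])
  then show ?thesis
    by (simp add: nn_integral_bind[OF f])
qed

lemma nn_integral_P_measurable[measurable]:
  assumes "f \<in> borel_measurable X"
  shows "(\<lambda>z. \<integral>\<^sup>+w. f w \<partial>P z) \<in> borel_measurable X"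
  by (rule measurable_compose[OF P_subprob nn_integral_measurable_subprob_algebra[OF assms]])

lemma emeasure_kp_measurable[measurable]:
  "A \<in> sets X \<Longrightarrow> (\<lambda>z. emeasure (kp n z) A) \<in> borel_measurable X"
  by (rule measurable_compose[OF kp_subprob measurable_emeasure_subprob_algebra])

lemma measure_kp_measurable[measurable]:
  "A \<in> sets X \<Longrightarrow> (\<lambda>z. measure (kp n z) A) \<in> borel_measurable X"
  by (rule measurable_compose[OF kp_subprob measurable_measure_subprob_algebra])

lemma nn_integral_kp_add:
  assumes u: "u \<in> space X" and f: "f \<in> borel_measurable X"
  shows "(\<integral>\<^sup>+z. f z \<partial>kp (a + b) u) = (\<integral>\<^sup>+z. (\<integral>\<^sup>+w. f w \<partial>kp b z) \<partial>kp a u)"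
  using f
proof (induction b arbitrary: f)
  case 0
  then show ?case
    using u by (auto intro!: nn_integral_cong simp: space_kp nn_integral_return)
next
  case (Suc b)
  have "(\<integral>\<^sup>+z. f z \<partial>kp (a + Suc b) u) = (\<integral>\<^sup>+z. (\<integral>\<^sup>+w. f w \<partial>P z) \<partial>kp (a + b) u)"
    using nn_integral_kp_Suc[OF u Suc.prems, of "a + b"] by simp
  also have "\<dots> = (\<integral>\<^sup>+z. (\<integral>\<^sup>+w. (\<integral>\<^sup>+t. f t \<partial>P w) \<partial>kp b z) \<partial>kp a u)"
    by (rule Suc.IH) (use Suc.prems in measurable)
  also have "\<dots> = (\<integral>\<^sup>+z. (\<integral>\<^sup>+w. f w \<partial>kp (Suc b) z) \<partial>kp a u)"
    by (intro nn_integral_cong) (simp only: space_kp[OF u] nn_integral_kp_Suc[OF _ Suc.prems])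
  finally show ?case .
qed

lemma emeasure_kp_add:
  assumes u: "u \<in> space X" and A: "A \<in> sets X"
  shows "emeasure (kp (a + b) u) A = (\<integral>\<^sup>+z. emeasure (kp b z) A \<partial>kp a u)"
proof -
  have "emeasure (kp (a + b) u) A = (\<integral>\<^sup>+z. indicator A z \<partial>kp (a + b) u)"
    using A u by (simp add: sets_kp)
  also have "\<dots> = (\<integral>\<^sup>+z. (\<integral>\<^sup>+w. indicator A w \<partial>kp b z) \<partial>kp a u)"
    using A by (intro nn_integral_kp_add[OF u]) simp
  also have "\<dots> = (\<integral>\<^sup>+z. emeasure (kp b z) A \<partial>kp a u)"
    by (intro nn_integral_cong nn_integral_indicator) (simp add: space_kp[OF u] sets_kp A)
  finally show ?thesis .
qed

lemma kp_1:
  assumes "u \<in> space X" shows "kp 1 u = P u"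
  using bind_return[OF P_subprob assms] by simp

text \<open>If the integral of \<open>kp b z\<close> A over \<open>kp a u\<close> vanished, its
  integrand would vanish almost everywhere, yet it is positive on S, which has positive
  mass.\<close>

lemma kp_add_pos:
  assumes u: "u \<in> space X" and A: "A \<in> sets X" and S: "S \<in> sets X"
    and pos: "emeasure (kp a u) S > 0"
    and step: "\<And>z. z \<in> S \<Longrightarrow> emeasure (kp b z) A > 0"
  shows "emeasure (kp (a + b) u) A > 0"
proof (rule ccontr)
  assume "\<not> ?thesis"
  then have "(\<integral>\<^sup>+z. emeasure (kp b z) A \<partial>kp a u) = 0"
    using emeasure_kp_add[OF u A, of a b] by simp
  then have "AE z in kp a u. emeasure (kp b z) A = 0"
    using A by (subst (asm) nn_integral_0_iff_AE) (simp_all add: measurable_cong_sets[OF sets_kp[OF u]])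
  then have "AE z in kp a u. z \<notin> S"
    by (rule eventually_mono) (auto dest!: step)
  then have "emeasure (kp a u) S = 0"
    using S u by (subst (asm) AE_iff_measurable[where N=S]) (auto simp: sets_kp space_kp dest: sets.sets_into_space)
  with pos show False by simp
qed

text \<open>Irreducibility is phrased with trajectories, the minorization and petiteness with kernel
  powers; this links the two. The finite stage \<open>IT.C 0 (Suc k)\<close> is the joint law of the
  coordinates 0 to k, whose last coordinate is followed by induction on k.\<close>

lemma nn_integral_path_law:
  assumes u: "u \<in> space X" and f[measurable]: "f \<in> borel_measurable X"
  shows "(\<integral>\<^sup>+w. f (w n) \<partial>path_law X P u) = (\<integral>\<^sup>+z. f z \<partial>kp n u)"
proof -
  interpret IT: Ionescu_Tulcea "chain_step X P u" "\<lambda>_. X"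
    by (rule Ionescu_Tulcea_chain_step[OF kernel u])
  have meas: "(\<lambda>w. g (w k)) \<in> borel_measurable (PiM J (\<lambda>_. X))"
    if "g \<in> borel_measurable X" "k \<in> J" for g :: "'a \<Rightarrow> ennreal" and k and J :: "nat set"
    by (rule measurable_compose[OF measurable_component_singleton[OF that(2)] that(1)])
  have marginal: "(\<integral>\<^sup>+w. g (w k) \<partial>IT.C 0 (Suc k) (\<lambda>_. undefined)) = (\<integral>\<^sup>+z. g z \<partial>kp k u)"
    if "g \<in> borel_measurable X" for g k
    using that
  proof (induction k arbitrary: g)
    case 0
    let ?e = "(\<lambda>_. undefined) :: nat \<Rightarrow> 'a"
    have e: "?e \<in> space (PiM {0..<0} (\<lambda>_. X))"
      by (simp add: space_PiM)
    have "(\<integral>\<^sup>+w. g (w 0) \<partial>IT.C 0 (Suc 0) ?e) = (\<integral>\<^sup>+w. g (w 0) \<partial>IT.eP 0 ?e)"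
      using bind_return[OF IT.measurable_eP e] by simp
    also have "\<dots> = (\<integral>\<^sup>+z. g z \<partial>chain_step X P u 0 ?e)"
      by (subst IT.nn_integral_eP[OF e]) (auto intro!: meas 0)
    also have "\<dots> = (\<integral>\<^sup>+z. g z \<partial>kp 0 u)"
      by (simp add: chain_step_def)
    finally show ?case .
  next
    case (Suc k)
    let ?e = "(\<lambda>_. undefined) :: nat \<Rightarrow> 'a"
    have e: "?e \<in> space (PiM {0..<0} (\<lambda>_. X))"
      by (simp add: space_PiM)
    have space: "space (IT.C 0 (Suc k) ?e) = space (PiM {0..<Suc k} (\<lambda>_. X))"
      using IT.space_C[OF e, of "Suc k"] by simp
    have sets: "sets (IT.C 0 (Suc k) ?e) = sets (PiM {0..<Suc k} (\<lambda>_. X))"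
      using IT.sets_C[OF e, of "Suc k"] by simp
    have eP: "IT.eP (Suc k) \<in> IT.C 0 (Suc k) ?e \<rightarrow>\<^sub>M subprob_algebra (PiM {0..<Suc (Suc k)} (\<lambda>_. X))"
      using IT.measurable_eP[of "Suc k"] by (simp only: measurable_cong_sets[OF sets refl])
    have "(\<integral>\<^sup>+w. g (w (Suc k)) \<partial>IT.C 0 (Suc (Suc k)) ?e)
        = (\<integral>\<^sup>+w. (\<integral>\<^sup>+w'. g (w' (Suc k)) \<partial>IT.eP (Suc k) w) \<partial>IT.C 0 (Suc k) ?e)"
      unfolding IT.C.simps(2)[of 0 "Suc k"] add_0
      by (rule nn_integral_bind[OF _ eP]) (auto intro!: meas Suc.prems)
    also have "\<dots> = (\<integral>\<^sup>+w. (\<integral>\<^sup>+z. g z \<partial>P (w k)) \<partial>IT.C 0 (Suc k) ?e)"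
      by (intro nn_integral_cong, subst IT.nn_integral_eP)
         (auto intro!: meas Suc.prems simp: space chain_step_def simp del: IT.C.simps)
    also have "\<dots> = (\<integral>\<^sup>+z. (\<integral>\<^sup>+z'. g z' \<partial>P z) \<partial>kp k u)"
      by (rule Suc.IH) (use Suc.prems in measurable)
    also have "\<dots> = (\<integral>\<^sup>+z. g z \<partial>kp (Suc k) u)"
      by (rule nn_integral_kp_Suc[OF u Suc.prems, symmetric])
    finally show ?case .
  qed
  \<comment> \<open>The marginal at coordinate n is computed from the first n + 1 stages, since
    stage 0 produces coordinate 0.\<close>
  have up: "IT.up_to {n} = Suc n"
    by (rule antisym) (simp_all add: IT.up_to_iff Suc_le_eq IT.up_to_less)
  have restr: "(\<lambda>w. restrict w {n}) \<in> IT.PF.lim \<rightarrow>\<^sub>M PiM {n} (\<lambda>_. X)"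
    unfolding measurable_cong_sets[OF IT.PF.sets_lim refl]
    by (intro measurable_restrict_subset) simp
  have setsC: "sets (IT.C 0 (Suc n) (\<lambda>_. undefined)) = sets (PiM {0..<Suc n} (\<lambda>_. X))"
    using IT.sets_C[of "\<lambda>_. undefined" 0 "Suc n"] by (simp add: space_PiM)
  have restrC: "(\<lambda>w. restrict w {n}) \<in> IT.C 0 (Suc n) (\<lambda>_. undefined) \<rightarrow>\<^sub>M PiM {n} (\<lambda>_. X)"
    unfolding measurable_cong_sets[OF setsC refl]
    by (intro measurable_restrict_subset) simp
  have "(\<integral>\<^sup>+w. f (w n) \<partial>path_law X P u)
      = (\<integral>\<^sup>+w. f (w n) \<partial>distr IT.PF.lim (PiM {n} (\<lambda>_. X)) (\<lambda>w. restrict w {n}))"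
    unfolding path_law_def by (subst nn_integral_distr[OF restr]) (auto intro!: meas)
  also have "\<dots> = (\<integral>\<^sup>+w. f (w n) \<partial>IT.C 0 (Suc n) (\<lambda>_. undefined))"
    by (simp only: IT.distr_lim finite.intros IT.CI_def up)
       (subst nn_integral_distr[OF restrC], auto intro!: meas)
  finally show ?thesis
    by (simp add: marginal del: IT.C.simps)
qed

lemma emeasure_path_law:
  assumes u: "u \<in> space X" and A[measurable]: "A \<in> sets X"
  shows "emeasure (path_law X P u) {w \<in> space (path_law X P u). w n \<in> A} = emeasure (kp n u) A"
proof -
  have [measurable]: "(\<lambda>w. w n) \<in> path_law X P u \<rightarrow>\<^sub>M X"
    unfolding measurable_cong_sets[OF sets_path_law[OF kernel u] refl] by measurable
  have "emeasure (path_law X P u) {w \<in> space (path_law X P u). w n \<in> A}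
      = (\<integral>\<^sup>+w. indicator {w \<in> space (path_law X P u). w n \<in> A} w \<partial>path_law X P u)"
    by simp
  also have "\<dots> = (\<integral>\<^sup>+w. indicator A (w n) \<partial>path_law X P u)"
    by (intro nn_integral_cong) (simp split: split_indicator)
  also have "\<dots> = emeasure (kp n u) A"
    using u by (subst nn_integral_path_law) (auto simp: sets_kp)
  finally show ?thesis .
qed

text \<open>A finite return time is a countable union of events \<open>w n \<in> A\<close>; if all
  of them were null, so would be the union.\<close>

lemma return_time_finite_imp_kp_pos:
  assumes u: "u \<in> space X" and A[measurable]: "A \<in> sets X"
    and pos: "emeasure (path_law X P u) {w \<in> space (path_law X P u). return_time A w < \<infinity>} > 0"
  shows "\<exists>n. emeasure (kp n u) A > 0"
proof (rule ccontr)
  assume "\<not> ?thesis"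
  then have null: "emeasure (path_law X P u) {w \<in> space (path_law X P u). w n \<in> A} = 0" for n
    using emeasure_path_law[OF u A, of n] by simp
  have [measurable]: "(\<lambda>w. w n) \<in> path_law X P u \<rightarrow>\<^sub>M X" for n
    unfolding measurable_cong_sets[OF sets_path_law[OF kernel u] refl] by measurable
  have "\<exists>n. w n \<in> A" if "return_time A w < \<infinity>" for w
    using that by (simp only: return_time_def Inf_less_iff) auto
  then have "{w \<in> space (path_law X P u). return_time A w < \<infinity>}
      \<subseteq> (\<Union>n. {w \<in> space (path_law X P u). w n \<in> A})"
    by auto
  then have "emeasure (path_law X P u) {w \<in> space (path_law X P u). return_time A w < \<infinity>}
      \<le> emeasure (path_law X P u) (\<Union>n. {w \<in> space (path_law X P u). w n \<in> A})"
    by (rule emeasure_mono) measurable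
  also have "\<dots> = 0"
    by (rule emeasure_UN_eq_0[OF null]) (intro image_subsetI, measurable)
  finally show False using pos by simp
qed

text \<open>The quantitative counterpart of \<open>kp_add_pos\<close>: only the paths that are in S
  at time a are counted.\<close>

lemma measure_kp_add_ge:
  assumes u: "u \<in> space X" and A[measurable]: "A \<in> sets X" and S[measurable]: "S \<in> sets X"
    and c: "0 \<le> c" "c \<le> measure (kp a u) S" and d: "0 \<le> d" "\<And>z. z \<in> S \<Longrightarrow> d \<le> measure (kp b z) A"
  shows "c * d \<le> measure (kp (a + b) u) A"
proof -
  interpret a: prob_space "kp a u" by (rule kp_space[OF u])
  interpret ab: prob_space "kp (a + b) u" by (rule kp_space[OF u])
  have "ennreal (c * d) \<le> ennreal d * emeasure (kp a u) S"
    using mult_right_mono[OF c(2) d(1)] c d(1)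
    by (simp add: a.emeasure_eq_measure mult.commute[of d] ennreal_leI flip: ennreal_mult)
  also have "\<dots> = (\<integral>\<^sup>+z. ennreal d * indicator S z \<partial>kp a u)"
    using u by (simp add: nn_integral_cmult_indicator sets_kp)
  also have "\<dots> \<le> (\<integral>\<^sup>+z. emeasure (kp b z) A \<partial>kp a u)"
  proof (rule nn_integral_mono)
    fix z assume z: "z \<in> space (kp a u)"
    then interpret b: prob_space "kp b z" using kp_space[of z] by (simp add: space_kp[OF u])
    show "ennreal d * indicator S z \<le> emeasure (kp b z) A"
      using d(2)[of z] by (auto simp: b.emeasure_eq_measure intro!: ennreal_leI split: split_indicator)
  qed
  also have "\<dots> = ennreal (measure (kp (a + b) u) A)"
    by (simp add: ab.emeasure_eq_measure flip: emeasure_kp_add[OF u A])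
  finally show ?thesis by simp
qed

end

section \<open>Minorized kernels and killed flows\<close>

locale minorized_kernel = markov_kernel_on X P for X :: "'a measure" and P :: "'a \<Rightarrow> 'a measure" +
  fixes C :: "'a set" and m :: nat and \<beta> :: real and \<nu> :: "'a measure"
  assumes minor: "minorization X P C m \<beta> \<nu>"
    and acc: "accessible X P C"
begin

section \<open>The minorization for measures and for functions\<close>

lemma C_sets[measurable]: "C \<in> sets X"
  and accessibleD: "u \<in> space X \<Longrightarrow> \<exists>n\<ge>1. emeasure (kp n u) C > 0"
  using acc by (auto simp: accessible_def)

lemma m_ge_1: "1 \<le> m" and \<beta>_pos: "0 < \<beta>" and \<beta>_less_1: "\<beta> < 1"
  and prob_\<nu>: "prob_space \<nu>" and sets_\<nu>[measurable_cong]: "sets \<nu> = sets X" and \<nu>_C: "emeasure \<nu> C = 1"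
  using minor by (auto simp: minorization_def)

lemma space_\<nu>: "space \<nu> = space X"
  by (rule sets_eq_imp_space_eq[OF sets_\<nu>])

sublocale \<nu>: prob_space \<nu> by (rule prob_\<nu>)

lemma C_not_empty: obtains u where "u \<in> C" "u \<in> space X"
proof -
  have "C \<noteq> {}" using \<nu>_C by auto
  with that sets.sets_into_space[OF C_sets] show thesis by auto
qed

lemma minor_measure_le:
  assumes u: "u \<in> space X" and A: "A \<in> sets X"
  shows "ennreal \<beta> * indicator C u * emeasure \<nu> A \<le> emeasure (kp m u) A"
proof -
  interpret K: prob_space "kp m u" by (rule kp_space[OF u])
  have "ennreal (\<beta> * indicator C u * measure \<nu> A) \<le> ennreal (measure (kp m u) A)"
    using minor u A by (intro ennreal_leI) (auto simp: minorization_def)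
  then show ?thesis
    using \<beta>_pos by (simp add: K.emeasure_eq_measure \<nu>.emeasure_eq_measure ennreal_mult' ennreal_indicator)
qed

lemma minor_le:
  assumes u: "u \<in> C" and f: "f \<in> borel_measurable X"
  shows "ennreal \<beta> * (\<integral>\<^sup>+z. f z \<partial>\<nu>) \<le> (\<integral>\<^sup>+z. f z \<partial>kp m u)"
proof -
  have uX: "u \<in> space X"
    using u sets.sets_into_space[OF C_sets] by auto
  have "scale_measure (ennreal \<beta>) \<nu> \<le> kp m u"
  proof (subst le_measure)
    show "\<forall>A\<in>sets (scale_measure (ennreal \<beta>) \<nu>).
        emeasure (scale_measure (ennreal \<beta>) \<nu>) A \<le> emeasure (kp m u) A"
      using minor_measure_le[OF uX] u by (simp add: sets_\<nu>)
  qed (simp add: sets_\<nu> sets_kp[OF uX])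
  then have "(\<integral>\<^sup>+z. f z \<partial>scale_measure (ennreal \<beta>) \<nu>) \<le> (\<integral>\<^sup>+z. f z \<partial>kp m u)"
    by (rule nn_integral_mono_measure[rotated]) (simp add: sets_\<nu> sets_kp[OF uX])
  then show ?thesis
    using f by (subst (asm) nn_integral_scale_measure) simp_all
qed

section \<open>Sets charged by the law \<nu> P^n\<close>

definition nu_pos :: "nat \<Rightarrow> 'a set \<Rightarrow> bool" where
  "nu_pos n A \<longleftrightarrow> \<not> (AE z in \<nu>. emeasure (kp n z) A = 0)"

lemma nu_pos_add:
  assumes S[measurable]: "S \<in> sets X" and A[measurable]: "A \<in> sets X"
    and pos: "nu_pos a S" and step: "\<And>z. z \<in> S \<Longrightarrow> emeasure (kp b z) A > 0"
  shows "nu_pos (a + b) A"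
proof -
  have null: "emeasure (kp a z) S = 0" if "emeasure (kp (a + b) z) A = 0" "z \<in> space X" for z
    using kp_add_pos[OF that(2) A S _ step, of a] that(1) by (auto simp: zero_less_iff_neq_zero)
  have "AE z in \<nu>. emeasure (kp a z) S = 0" if "AE z in \<nu>. emeasure (kp (a + b) z) A = 0"
    using that by (rule AE_mp[OF _ AE_I2]) (simp add: space_\<nu> null)
  with pos show ?thesis
    unfolding nu_pos_def by blast
qed

text \<open>Stating \<open>nu_pos\<close> through null sets makes this a matter of countable unions,
  first under \<nu> and then under \<open>kp n z\<close>.\<close>

lemma nu_pos_UN:
  fixes S :: "'i :: countable \<Rightarrow> 'a set"
  assumes S: "\<And>i. S i \<in> sets X" and pos: "nu_pos n (\<Union>i. S i)"
  shows "\<exists>i. nu_pos n (S i)"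
proof (rule ccontr)
  assume "\<not> ?thesis"
  then have ae: "AE z in \<nu>. \<forall>i. emeasure (kp n z) (S i) = 0"
    unfolding nu_pos_def by (simp add: AE_all_countable)
  have null: "emeasure (kp n z) (\<Union>i. S i) = 0"
    if "\<forall>i. emeasure (kp n z) (S i) = 0" "z \<in> space X" for z
  proof -
    have "(\<Union>i. S i) \<in> null_sets (kp n z)"
      using that S by (intro null_sets_UN') (auto simp: null_sets_def sets_kp)
    then show ?thesis by (rule null_setsD1)
  qed
  have "AE z in \<nu>. emeasure (kp n z) (\<Union>i. S i) = 0"
    using ae by (rule AE_mp[OF _ AE_I2]) (simp add: space_\<nu> null)
  with pos show False unfolding nu_pos_def by simp
qed

text \<open>The minorization makes positivity uniform: from every point of C, a part \<beta> of the
  mass is distributed as \<nu> after m steps, so the (\<nu> P^n)-mass of A times \<beta> is a common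
  lower bound.\<close>

lemma nu_pos_bound:
  assumes A[measurable]: "A \<in> sets X" and pos: "nu_pos n A"
  obtains \<epsilon> :: real where "\<epsilon> > 0" "\<And>u. u \<in> C \<Longrightarrow> ennreal \<epsilon> \<le> emeasure (kp (m + n) u) A"
proof -
  define I where "I = (\<integral>\<^sup>+z. emeasure (kp n z) A \<partial>\<nu>)"
  have "I \<noteq> 0"
    using pos unfolding I_def nu_pos_def by (subst nn_integral_0_iff_AE) auto
  moreover have "I \<le> 1"
  proof -
    have "I \<le> (\<integral>\<^sup>+z. 1 \<partial>\<nu>)"
      unfolding I_def using kp_space by (intro nn_integral_mono) (auto simp: space_\<nu> prob_space.emeasure_le_1)
    then show ?thesis by (simp add: \<nu>.emeasure_space_1)
  qed
  ultimately obtain r where r: "I = ennreal r" "r > 0"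
    by (cases I) (auto simp: less_le top_unique)
  show thesis
  proof (rule that[of "\<beta> * r"])
    show "0 < \<beta> * r" using r \<beta>_pos by simp
    fix u assume u: "u \<in> C"
    then have uX: "u \<in> space X"
      using sets.sets_into_space[OF C_sets] by auto
    have "ennreal (\<beta> * r) = ennreal \<beta> * I"
      using r \<beta>_pos by (simp add: ennreal_mult)
    also have "\<dots> \<le> (\<integral>\<^sup>+z. emeasure (kp n z) A \<partial>kp m u)"
      unfolding I_def by (rule minor_le[OF u]) measurable
    also have "\<dots> = emeasure (kp (m + n) u) A"
      by (rule emeasure_kp_add[OF uX A, symmetric])
    finally show "ennreal (\<beta> * r) \<le> emeasure (kp (m + n) u) A" .
  qed
qed

text \<open>The shift by \<open>m\<close> makes this set closed under addition: one minorized block leads from \<open>C\<close> back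
  to \<open>\<nu>\<close>.\<close>

definition return_set :: "nat set" where
  "return_set = {n. m \<le> n \<and> nu_pos (n - m) C}"

lemma m_return_set: "m \<in> return_set"
proof -
  have "\<not> (AE z in \<nu>. z \<notin> C)"
    using \<nu>_C by (subst AE_iff_measurable[where N=C])
      (auto simp: sets_\<nu> space_\<nu> dest: sets.sets_into_space[OF C_sets, THEN subsetD])
  moreover have "z \<notin> C" if "emeasure (kp 0 z) C = 0" for z
    using that by (simp split: split_indicator_asm)
  ultimately have "nu_pos 0 C"
    unfolding nu_pos_def by (metis (mono_tags, lifting) eventually_mono)
  then show ?thesis by (simp add: return_set_def)
qed

lemma return_set_add:
  assumes "a \<in> return_set" "b \<in> return_set" shows "a + b \<in> return_set"
proof -
  have ab: "m \<le> a" "nu_pos (a - m) C" "m \<le> b" "nu_pos (b - m) C"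
    using assms by (auto simp: return_set_def)
  obtain \<epsilon> where \<epsilon>: "\<epsilon> > 0" "\<And>u. u \<in> C \<Longrightarrow> ennreal \<epsilon> \<le> emeasure (kp (m + (b - m)) u) C"
    using nu_pos_bound[OF C_sets ab(4)] by blast
  have "nu_pos (a - m + (m + (b - m))) C"
    using \<epsilon> by (intro nu_pos_add[OF C_sets C_sets ab(2)]) (auto intro: less_le_trans[of 0 "ennreal \<epsilon>"])
  then show ?thesis using ab by (simp add: return_set_def)
qed

text \<open>This is where aperiodicity enters.  With \<open>d\<close> the least positive difference of two elements of
  \<^const>\<open>return_set\<close>, the states from which \<open>C\<close> can be hit at times \<open>\<equiv> -i (mod d)\<close>, \<open>i < d\<close>, form a
  \<open>d\<close>-cycle once the states that can reach an overlap of two such classes are removed; these are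
  \<open>\<psi>\<close>-null, since otherwise two elements of \<^const>\<open>return_set\<close> would differ by a non-multiple of
  \<open>d\<close>.\<close>

lemma nu_pos_every_residue:
  assumes psi: "psi_irreducible X P \<psi>" and aper: "aperiodic X P \<psi>"
  shows "\<exists>n. n mod m = s mod m \<and> nu_pos n C"
proof -
  obtain d c where d: "d \<ge> 1" and c: "c \<in> return_set" "c + d \<in> return_set"
    and dvd: "\<And>a. a \<in> return_set \<Longrightarrow> d dvd a"
    using add_closed_least_difference[OF return_set_add m_return_set m_ge_1] by blast
  define Hit where "Hit n = {z \<in> space X. emeasure (kp n z) C > 0}" for n
  \<comment> \<open>Indexing the overlaps by all pairs of naturals, with the empty set off
    \<open>pairs\<close>, presents B as a countable union to which \<open>nu_pos_UN\<close>
    applies.\<close>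
  define pairs where "pairs = {p :: nat \<times> nat. fst p mod d \<noteq> snd p mod d}"
  define B where "B = (\<Union>p. if p \<in> pairs then Hit (fst p) \<inter> Hit (snd p) else {})"
  define Bbar where "Bbar = (\<Union>n. {z \<in> space X. emeasure (kp n z) B > 0})"
  define D where "D i = (\<Union>n. if (n + i) mod d = 0 then Hit n else {}) - Bbar" for i
  have Hit[measurable]: "Hit n \<in> sets X" for n
    unfolding Hit_def by measurable
  have B_sets[measurable]: "B \<in> sets X"
    unfolding B_def by (intro sets.countable_UN) auto
  have Bbar_sets[measurable]: "Bbar \<in> sets X"
    unfolding Bbar_def by measurable
  have D_sets[measurable]: "D i \<in> sets X" for i
    unfolding D_def by (intro sets.Diff sets.countable_UN) auto
  have BI: "z \<in> B" if "z \<in> Hit a" "z \<in> Hit b" "a mod d \<noteq> b mod d" for z a b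
    using that unfolding B_def pairs_def by (intro UN_I[of "(a, b)"]) auto
  have B_Bbar: "z \<in> Bbar" if "z \<in> B" for z
  proof -
    have "z \<in> space X" using that sets.sets_into_space[OF B_sets] by auto
    with that show ?thesis
      unfolding Bbar_def by (intro UN_I[of 0]) auto
  qed
  have DI: "z \<in> D i" if "z \<in> Hit n" "(n + i) mod d = 0" "z \<notin> Bbar" for z n i
    using that unfolding D_def by (auto intro!: exI[of _ n])
  have DE: "\<exists>n. z \<in> Hit n \<and> (n + i) mod d = 0" if "z \<in> D i" for z i
    using that unfolding D_def by (auto split: if_split_asm)
  have D_Bbar: "z \<notin> Bbar" if "z \<in> D i" for z i
    using that unfolding D_def by auto
  have D_space: "z \<in> space X" if "z \<in> D i" for z i
    using that sets.sets_into_space[OF D_sets] by auto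
  have some_index: "\<exists>i<d. (n + i) mod d = 0" for n
  proof -
    have "(n + (d - 1) * n) mod d = 0"
      using d by (simp add: algebra_simps)
    then have "(n + ((d - 1) * n) mod d) mod d = 0"
      by (simp add: mod_add_right_eq)
    then show ?thesis
      using d by (intro exI[of _ "((d - 1) * n) mod d"]) simp
  qed
  have one_step: "emeasure (P u) A = emeasure (kp 1 u) A" if "u \<in> space X" for u A
    by (simp only: kp_1[OF that])
  \<comment> \<open>Almost surely, one step from D i avoids \<open>Bbar\<close>, since otherwise u
    could reach B. It also avoids every \<open>Hit k\<close> of the wrong residue, since otherwise u
    could hit C at times n and k + 1 that differ modulo d and would lie in B. By accessibility some
    \<open>Hit k\<close> contains the new state, and its residue is then the right one.\<close>
  have cyc: "emeasure (P u) (D (Suc i mod d)) = 1" if i: "i < d" and u: "u \<in> D i" for u i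
  proof -
    have uX: "u \<in> space X" by (rule D_space[OF u])
    have sP: "sets (P u) = sets X"
      using sets_kp[OF uX, of 1] by (simp only: kp_1[OF uX])
    have Pu: "prob_space (P u)"
      using kp_space[OF uX, of 1] by (simp only: kp_1[OF uX])
    obtain n where n: "u \<in> Hit n" "(n + i) mod d = 0"
      using DE[OF u] by (elim exE conjE)
    have "emeasure (P u) {z \<in> space X. emeasure (kp k z) B > 0} = 0" for k
    proof (rule ccontr)
      assume "\<not> ?thesis"
      then have "emeasure (kp (1 + k) u) B > 0"
        by (intro kp_add_pos[OF uX B_sets, of "{z \<in> space X. emeasure (kp k z) B > 0}"])
           (simp_all only: zero_less_iff_neq_zero flip: one_step[OF uX], simp_all)
      then have "u \<in> Bbar"
        unfolding Bbar_def using uX by blast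
      with D_Bbar[OF u] show False ..
    qed
    then have "AE z in P u. \<not> emeasure (kp k z) B > 0" for k
      using sets_eq_imp_space_eq[OF sP]
      by (subst AE_iff_measurable[where N="{z \<in> space X. emeasure (kp k z) B > 0}"])
         (auto simp: sP zero_less_iff_neq_zero)
    then have "AE z in P u. \<forall>k. \<not> emeasure (kp k z) B > 0"
      by (simp add: AE_all_countable)
    moreover have "emeasure (P u) (Hit k) = 0" if k: "(k + Suc i) mod d \<noteq> 0" for k
    proof (rule ccontr)
      assume "\<not> ?thesis"
      then have "emeasure (kp (1 + k) u) C > 0"
        by (intro kp_add_pos[OF uX C_sets Hit, of 1 k k],
            simp only: zero_less_iff_neq_zero flip: one_step[OF uX], simp add: Hit_def)
      then have "u \<in> Hit (Suc k)"
        using uX by (simp add: Hit_def)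
      moreover have "n mod d \<noteq> Suc k mod d"
      proof
        assume "n mod d = Suc k mod d"
        then have "(n + i) mod d = (Suc k + i) mod d"
          by (rule mod_add_cong) simp
        with n k show False by simp
      qed
      ultimately have "u \<in> B" by (rule BI[OF n(1)])
      with B_Bbar D_Bbar[OF u] show False by blast
    qed
    then have "AE z in P u. (k + Suc i) mod d \<noteq> 0 \<longrightarrow> z \<notin> Hit k" for k
      using sets_eq_imp_space_eq[OF sP] sets.sets_into_space[OF Hit]
      by (cases "(k + Suc i) mod d = 0")
         (auto simp: sP intro!: AE_not_in)
    then have "AE z in P u. \<forall>k. (k + Suc i) mod d \<noteq> 0 \<longrightarrow> z \<notin> Hit k"
      by (simp add: AE_all_countable)
    moreover have "AE z in P u. z \<in> space X"
      using sets_eq_imp_space_eq[OF sP] by (intro AE_I2) simp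
    ultimately have "AE z in P u. z \<in> D (Suc i mod d)"
    proof eventually_elim
      case (elim z)
      obtain k where "z \<in> Hit k"
        using accessibleD[OF elim(3)] elim(3) unfolding Hit_def by blast
      moreover have "(k + Suc i mod d) mod d = 0"
        using elim(2) \<open>z \<in> Hit k\<close> by (metis mod_add_right_eq)
      moreover have "z \<notin> Bbar"
        using elim(1) unfolding Bbar_def by blast
      ultimately show ?case by (rule DI)
    qed
    then show ?thesis
      by (intro prob_space.emeasure_eq_1_AE[OF Pu]) (simp_all add: sP)
  qed
  \<comment> \<open>Otherwise irreducibility lets every state reach \<open>Bbar\<close>, so the
    chain started from \<nu> charges some overlap of \<open>Hit a\<close> and \<open>Hit b\<close>
    with a and b different modulo d. Continuing to C in a or in b steps gives two elements of
    \<open>return_set\<close> that are both divisible by d, a contradiction.\<close>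
  have null: "emeasure \<psi> Bbar = 0"
  proof (rule ccontr)
    assume "\<not> ?thesis"
    then have "emeasure (path_law X P u) {w \<in> space (path_law X P u). return_time Bbar w < \<infinity>} > 0"
      if "u \<in> space X" for u
      using psi that unfolding psi_irreducible_def irreducibility_measure_def
      by (auto simp: zero_less_iff_neq_zero)
    then have reach: "\<exists>n. emeasure (kp n u) Bbar > 0" if "u \<in> space X" for u
      using return_time_finite_imp_kp_pos[OF that Bbar_sets] that by blast
    have "\<exists>n. nu_pos n Bbar"
    proof (rule ccontr)
      assume "\<nexists>n. nu_pos n Bbar"
      then have "AE z in \<nu>. \<forall>n. emeasure (kp n z) Bbar = 0"
        by (simp add: AE_all_countable nu_pos_def)
      moreover have "AE z in \<nu>. z \<in> space X"
        by (rule AE_I2) (simp add: space_\<nu>)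
      ultimately have "AE z in \<nu>. False"
        by eventually_elim (use reach in force)
      then show False by simp
    qed
    then obtain n where "nu_pos n Bbar" ..
    then obtain k where "nu_pos n {z \<in> space X. emeasure (kp k z) B > 0}"
      unfolding Bbar_def using nu_pos_UN[of "\<lambda>k. {z \<in> space X. emeasure (kp k z) B > 0}" n] by auto
    then have "nu_pos (n + k) B"
      by (rule nu_pos_add[rotated 2]) auto
    then have "\<exists>p. nu_pos (n + k) (if p \<in> pairs then Hit (fst p) \<inter> Hit (snd p) else {})"
      unfolding B_def by (rule nu_pos_UN[rotated]) simp
    then obtain p where "nu_pos (n + k) (if p \<in> pairs then Hit (fst p) \<inter> Hit (snd p) else {})" ..
    moreover have "\<not> nu_pos (n + k) {}"
      by (simp add: nu_pos_def)
    ultimately obtain a b where ab: "a mod d \<noteq> b mod d" "nu_pos (n + k) (Hit a \<inter> Hit b)"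
      by (cases p) (auto simp: pairs_def split: if_splits)
    have "nu_pos (n + k + a) C"
      by (rule nu_pos_add[OF sets.Int[OF Hit Hit] C_sets ab(2)]) (simp add: Hit_def)
    moreover have "nu_pos (n + k + b) C"
      by (rule nu_pos_add[OF sets.Int[OF Hit Hit] C_sets ab(2)]) (simp add: Hit_def)
    ultimately have "d dvd (m + n + k) + a" "d dvd (m + n + k) + b"
      by (auto intro!: dvd simp: return_set_def ac_simps)
    then have "a mod d = b mod d"
      by (rule dvd_add_imp_mod_eq)
    with ab(1) show False ..
  qed
  have "is_cycle X P \<psi> d D"
    unfolding is_cycle_def
  proof (intro conjI allI impI ballI)
    show "disjoint_family_on D {..<d}"
      unfolding disjoint_family_on_def
    proof (intro ballI impI, rule ccontr)
      fix i j assume ij: "i \<in> {..<d}" "j \<in> {..<d}" "i \<noteq> j" "D i \<inter> D j \<noteq> {}"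
      then obtain z where z: "z \<in> D i" "z \<in> D j" by auto
      from DE[OF z(1)] obtain n where n: "z \<in> Hit n" "(n + i) mod d = 0"
        by (elim exE conjE)
      from DE[OF z(2)] obtain n' where n': "z \<in> Hit n'" "(n' + j) mod d = 0"
        by (elim exE conjE)
      from n n' have "z \<in> B"
        using mod_complement_eq[of n i d n' j] ij by (intro BI[of z n n']) auto
      with B_Bbar D_Bbar[OF z(1)] show False by blast
    qed
    have "space X - (\<Union>i<d. D i) \<subseteq> Bbar"
    proof
      fix z assume z: "z \<in> space X - (\<Union>i<d. D i)"
      then obtain n where "z \<in> Hit n"
        using accessibleD[of z] unfolding Hit_def by blast
      moreover from some_index[of n] obtain i where "i < d" "(n + i) mod d = 0"
        by (elim exE conjE)
      ultimately show "z \<in> Bbar"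
        using z DI[of z n i] by auto
    qed
    then have "emeasure \<psi> (space X - (\<Union>i<d. D i)) \<le> emeasure \<psi> Bbar"
      using psi by (intro emeasure_mono) (auto simp: psi_irreducible_def irreducibility_measure_def)
    then show "emeasure \<psi> (space X - (\<Union>i<d. D i)) = 0"
      by (simp add: null)
  qed (use d cyc in auto)
  \<comment> \<open>Aperiodicity allows no cycle with more than one class. So
    \<open>return_set\<close> contains consecutive elements and meets every residue class modulo m;
    undoing its shift by m keeps the residue.\<close>
  then have "d \<le> 1"
    using aper unfolding aperiodic_def is_period_def by blast
  with d c(2) have "c + 1 \<in> return_set" by simp
  then obtain n where n: "n \<in> return_set" "n mod m = s mod m"
    using add_closed_all_residues[OF return_set_add m_return_set m_ge_1 c(1)] by blast
  then have "(n - m) mod m = s mod m" "nu_pos (n - m) C"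
    by (auto simp: return_set_def le_mod_geq)
  then show ?thesis by blast
qed

text \<open>The laws of the skeleton killed at the atom: \<open>\<mu> (k + 1) = \<mu> k (P^m - \<beta> 1\<^sub>C \<otimes> \<nu>)\<close>, written without
  subtraction.\<close>

definition killed_flow :: "(nat \<Rightarrow> 'a measure) \<Rightarrow> bool" where
  "killed_flow \<mu> \<longleftrightarrow> (\<forall>k. sets (\<mu> k) = sets X \<and> finite_measure (\<mu> k)) \<and>
    (\<forall>k. \<forall>f :: 'a \<Rightarrow> ennreal. f \<in> borel_measurable X \<longrightarrow>
      (\<integral>\<^sup>+z. f z \<partial>\<mu> (Suc k)) + ennreal \<beta> * emeasure (\<mu> k) C * (\<integral>\<^sup>+z. f z \<partial>\<nu>)
        = (\<integral>\<^sup>+u. (\<integral>\<^sup>+z. f z \<partial>kp m u) \<partial>\<mu> k))"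

text \<open>The occupation probability of C for the unkilled skeleton, n blocks after a start from
  \<nu>. It is the coefficient of the renewal equation and is common to all flows.\<close>

definition return_prob :: "nat \<Rightarrow> ennreal" where
  "return_prob n = (\<integral>\<^sup>+z. emeasure (kp (m * n) z) C \<partial>\<nu>)"

lemma return_prob_le_1: "return_prob n \<le> 1"
proof -
  have "return_prob n \<le> (\<integral>\<^sup>+z. 1 \<partial>\<nu>)"
    unfolding return_prob_def
    by (intro nn_integral_mono) (simp add: space_\<nu> prob_space.emeasure_le_1[OF kp_space])
  then show ?thesis by (simp add: \<nu>.emeasure_space_1)
qed

section \<open>The renewal equation of a killed flow\<close>

context
  fixes \<mu> assumes flow: "killed_flow \<mu>"
begin

lemma sets_flow: "sets (\<mu> k) = sets X" and finite_flow: "finite_measure (\<mu> k)"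
  and flow_step: "f \<in> borel_measurable X \<Longrightarrow>
      (\<integral>\<^sup>+z. f z \<partial>\<mu> (Suc k)) + ennreal \<beta> * emeasure (\<mu> k) C * (\<integral>\<^sup>+z. f z \<partial>\<nu>)
        = (\<integral>\<^sup>+u. (\<integral>\<^sup>+z. f z \<partial>kp m u) \<partial>\<mu> k)"
  using flow unfolding killed_flow_def by blast+

lemma space_flow: "space (\<mu> k) = space X"
  by (rule sets_eq_imp_space_eq[OF sets_flow])

lemma flow_mass:
  "emeasure (\<mu> (Suc k)) (space X) + ennreal \<beta> * emeasure (\<mu> k) C = emeasure (\<mu> k) (space X)"
proof -
  have "(\<integral>\<^sup>+u. (\<integral>\<^sup>+z. 1 \<partial>kp m u) \<partial>\<mu> k) = (\<integral>\<^sup>+u. 1 \<partial>\<mu> k)"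
    by (intro nn_integral_cong) (simp add: space_flow prob_space.emeasure_space_1[OF kp_space])
  then show ?thesis
    using flow_step[of "\<lambda>_. 1" k] by (simp add: space_flow \<nu>.emeasure_space_1)
qed

text \<open>Decomposition at the first regeneration: the unkilled skeleton is in C after j blocks
  either without having been killed, or after being killed at block k + i, restarted from \<nu> one
  block later, and with j - i - 1 blocks still to go. The induction peels off the first block, which
  is why k is arbitrary.\<close>

lemma flow_renewal:
  "(\<integral>\<^sup>+u. emeasure (kp (m * j) u) C \<partial>\<mu> k)
    = emeasure (\<mu> (k + j)) C + (\<Sum>i<j. ennreal \<beta> * emeasure (\<mu> (k + i)) C * return_prob (j - Suc i))"
proof (induction j arbitrary: k)
  case 0
  have "(\<integral>\<^sup>+u. emeasure (kp (m * 0) u) C \<partial>\<mu> k) = (\<integral>\<^sup>+u. indicator C u \<partial>\<mu> k)"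
    by (intro nn_integral_cong) simp
  then show ?case by (simp add: sets_flow)
next
  case (Suc j)
  have "(\<integral>\<^sup>+u. emeasure (kp (m * Suc j) u) C \<partial>\<mu> k)
      = (\<integral>\<^sup>+u. (\<integral>\<^sup>+z. emeasure (kp (m * j) z) C \<partial>kp m u) \<partial>\<mu> k)"
    unfolding mult_Suc_right
    by (intro nn_integral_cong emeasure_kp_add) (simp_all add: space_flow)
  also have "\<dots> = (\<integral>\<^sup>+z. emeasure (kp (m * j) z) C \<partial>\<mu> (Suc k))
      + ennreal \<beta> * emeasure (\<mu> k) C * return_prob j"
    unfolding return_prob_def by (rule flow_step[symmetric]) measurable
  finally show ?case
    unfolding Suc sum.lessThan_Suc_shift by (simp add: ac_simps)
qed

lemma flow_nn_integral_le:
  assumes [measurable]: "f \<in> borel_measurable X"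
  shows "(\<integral>\<^sup>+z. f z \<partial>\<mu> (Suc k)) \<le> (\<integral>\<^sup>+u. (\<integral>\<^sup>+z. f z \<partial>kp m u) \<partial>\<mu> k)"
  by (subst flow_step[symmetric]) (simp_all add: add_increasing2)

lemma flow_mass_sum:
  "measure (\<mu> (k + n)) (space X) + \<beta> * (\<Sum>i<n. measure (\<mu> (k + i)) C) = measure (\<mu> k) (space X)"
proof (induction n)
  case (Suc n)
  interpret a: finite_measure "\<mu> i" for i by (rule finite_flow)
  have "ennreal (measure (\<mu> (Suc (k + n))) (space X) + \<beta> * measure (\<mu> (k + n)) C)
      = ennreal (measure (\<mu> (k + n)) (space X))"
    using flow_mass[of "k + n"] \<beta>_pos by (simp add: a.emeasure_eq_measure ennreal_mult)
  then have "measure (\<mu> (Suc (k + n))) (space X) + \<beta> * measure (\<mu> (k + n)) C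
      = measure (\<mu> (k + n)) (space X)"
    using \<beta>_pos by (subst (asm) ennreal_inj) auto
  with Suc show ?case by (simp add: algebra_simps)
qed simp

end

text \<open>The renewal equation determines \<open>\<mu> j C\<close> recursively from the initial law.\<close>

lemma flow_C_proportional:
  assumes flow: "killed_flow \<mu>" "killed_flow \<mu>'"
    and init: "\<And>f :: 'a \<Rightarrow> ennreal. f \<in> borel_measurable X \<Longrightarrow> (\<integral>\<^sup>+z. f z \<partial>\<mu> 0) = ennreal p * (\<integral>\<^sup>+z. f z \<partial>\<nu>)"
    and init': "\<And>f :: 'a \<Rightarrow> ennreal. f \<in> borel_measurable X \<Longrightarrow> (\<integral>\<^sup>+z. f z \<partial>\<mu>' 0) = ennreal p' * (\<integral>\<^sup>+z. f z \<partial>\<nu>)"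
    and p: "0 \<le> p" "0 \<le> p'"
  shows "measure (\<mu> j) C * p' = measure (\<mu>' j) C * p"
proof -
  define t where "t n = enn2real (return_prob n)" for n
  have t: "return_prob n = ennreal (t n)" "0 \<le> t n" for n
    unfolding t_def using le_less_trans[OF return_prob_le_1[of n] ennreal_one_less_top]
    by simp_all
  \<comment> \<open>The renewal equation at k = 0 for a flow started from q \<nu>, where the left
    side is q times \<open>return_prob j\<close>; it is moved to the reals so that terms can be
    subtracted.\<close>
  have real: "q * t j = measure (\<eta> j) C + (\<Sum>i<j. \<beta> * measure (\<eta> i) C * t (j - Suc i))"
    if \<eta>: "killed_flow \<eta>" and q: "0 \<le> q"
      and init: "\<And>f :: 'a \<Rightarrow> ennreal. f \<in> borel_measurable X \<Longrightarrow> (\<integral>\<^sup>+z. f z \<partial>\<eta> 0) = ennreal q * (\<integral>\<^sup>+z. f z \<partial>\<nu>)"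
    for \<eta> q j
  proof -
    interpret a: finite_measure "\<eta> i" for i by (rule finite_flow[OF \<eta>])
    have "ennreal (q * t j) = (\<integral>\<^sup>+u. emeasure (kp (m * j) u) C \<partial>\<eta> 0)"
      using q t(2) by (subst init) (simp_all add: t(1)[symmetric] ennreal_mult return_prob_def[symmetric])
    also have "\<dots> = ennreal (measure (\<eta> j) C + (\<Sum>i<j. \<beta> * measure (\<eta> i) C * t (j - Suc i)))"
      unfolding flow_renewal[OF \<eta>] using \<beta>_pos t(2)
      by (simp add: a.emeasure_eq_measure t(1) sum_nonneg ennreal_mult flip: sum_ennreal)
    finally show ?thesis
      using q t(2) \<beta>_pos by (subst (asm) ennreal_inj) (auto intro!: add_nonneg_nonneg sum_nonneg)
  qed
  \<comment> \<open>The sum in \<open>real\<close> involves only indices below j, so strong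
    induction applies. Cross-multiplying by p and p' avoids dividing by a mass that may be
    zero.\<close>
  show ?thesis
  proof (induction j rule: less_induct)
    case (less j)
    define S where "S = (\<Sum>i<j. \<beta> * measure (\<mu> i) C * t (j - Suc i))"
    define S' where "S' = (\<Sum>i<j. \<beta> * measure (\<mu>' i) C * t (j - Suc i))"
    have "S * p' = (\<Sum>i<j. \<beta> * (measure (\<mu> i) C * p') * t (j - Suc i))"
      by (simp add: S_def sum_distrib_left sum_distrib_right ac_simps)
    also have "\<dots> = (\<Sum>i<j. \<beta> * (measure (\<mu>' i) C * p) * t (j - Suc i))"
      using less by simp
    also have "\<dots> = S' * p"
      by (simp add: S'_def sum_distrib_left sum_distrib_right ac_simps)
    finally have S: "S * p' = S' * p" .
    have "measure (\<mu> j) C * p' = (p * t j - S) * p'"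
      using real[OF flow(1) p(1) init, of j] by (simp add: S_def)
    also have "\<dots> = (p' * t j - S') * p"
      using S by (simp add: algebra_simps)
    also have "\<dots> = measure (\<mu>' j) C * p"
      using real[OF flow(2) p(2) init', of j] by (simp add: S'_def)
    finally show ?case .
  qed
qed

end

section \<open>Geometric decay from the drift condition\<close>

locale drift_kernel = minorized_kernel X P C m \<beta> \<nu>
  for X :: "'a measure" and P C m \<beta> \<nu> +
  fixes \<psi> :: "'a measure" and V :: "'a \<Rightarrow> real" and lam b0 :: real and C0 :: "'a set"
  assumes psi: "psi_irreducible X P \<psi>" and aper: "aperiodic X P \<psi>"
    and petite: "petite X P C0"
    and lam: "0 \<le> lam" "lam < 1"
    and drift: "drift_condition X P V lam b0 C0"
begin

text \<open>The constant b0 comes without a sign. Raising it to at least 1 preserves the drift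
  inequality and allows division by it.\<close>

definition drift_const :: real where "drift_const = max b0 1"

lemma drift_const_ge_1: "1 \<le> drift_const" by (simp add: drift_const_def)

lemma V_measurable[measurable]: "V \<in> borel_measurable X"
  and V_ge_1: "u \<in> space X \<Longrightarrow> 1 \<le> V u"
  using drift by (auto simp: drift_condition_def)

lemma C0_sets[measurable]: "C0 \<in> sets X"
  using petite by (simp add: petite_def)

lemma drift_P:
  assumes u: "u \<in> space X"
  shows "(\<integral>\<^sup>+z. ennreal (V z) \<partial>P u) \<le> ennreal lam * ennreal (V u) + ennreal drift_const * indicator C0 u"
proof -
  have V_nonneg: "0 \<le> V u" using V_ge_1[OF u] by simp
  have "(\<integral>\<^sup>+z. ennreal (V z) \<partial>P u) \<le> ennreal (lam * V u + b0 * indicator C0 u)"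
    using drift u by (simp add: drift_condition_def)
  also have "\<dots> \<le> ennreal (lam * V u + drift_const * indicator C0 u)"
    by (intro ennreal_leI add_left_mono mult_right_mono) (auto simp: drift_const_def)
  also have "\<dots> = ennreal lam * ennreal (V u) + ennreal drift_const * indicator C0 u"
    using lam V_nonneg drift_const_ge_1
    by (simp add: ennreal_mult ennreal_indicator)
  finally show ?thesis .
qed

section \<open>Iterates of the drift inequality\<close>

lemma drift_kp_Suc:
  assumes u: "u \<in> space X"
  shows "(\<integral>\<^sup>+z. ennreal (V z) \<partial>kp (Suc n) u)
    \<le> ennreal lam * (\<integral>\<^sup>+z. ennreal (V z) \<partial>kp n u) + ennreal drift_const * emeasure (kp n u) C0"
proof -
  have [measurable]: "V \<in> borel_measurable (kp n u)" "C0 \<in> sets (kp n u)"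
    using V_measurable C0_sets by (simp_all add: sets_kp[OF u] cong: measurable_cong_sets)
  have "(\<integral>\<^sup>+z. ennreal (V z) \<partial>kp (Suc n) u) = (\<integral>\<^sup>+z. (\<integral>\<^sup>+w. ennreal (V w) \<partial>P z) \<partial>kp n u)"
    by (rule nn_integral_kp_Suc[OF u]) measurable
  also have "\<dots> \<le> (\<integral>\<^sup>+z. ennreal lam * ennreal (V z) + ennreal drift_const * indicator C0 z \<partial>kp n u)"
    by (intro nn_integral_mono drift_P) (simp add: space_kp[OF u])
  also have "\<dots> = ennreal lam * (\<integral>\<^sup>+z. ennreal (V z) \<partial>kp n u) + ennreal drift_const * emeasure (kp n u) C0"
    by (simp add: nn_integral_add nn_integral_cmult)
  finally show ?thesis .
qed

text \<open>This form keeps the visits to C0 and drops their discount factors; it serves to bound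
  those visits from below.\<close>

lemma drift_kp_sum:
  assumes u: "u \<in> space X"
  shows "(\<integral>\<^sup>+z. ennreal (V z) \<partial>kp n u)
    \<le> ennreal (lam ^ n * V u + drift_const * (\<Sum>j<n. measure (kp j u) C0))"
proof (induction n)
  case 0
  show ?case using u by (simp add: nn_integral_return)
next
  case (Suc n)
  interpret K: prob_space "kp n u" by (rule kp_space[OF u])
  have nn: "0 \<le> lam ^ n * V u" "0 \<le> drift_const * (\<Sum>j<n. measure (kp j u) C0)"
    using lam drift_const_ge_1 V_ge_1[OF u] by (auto intro!: mult_nonneg_nonneg sum_nonneg)
  have "(\<integral>\<^sup>+z. ennreal (V z) \<partial>kp (Suc n) u)
      \<le> ennreal lam * ennreal (lam ^ n * V u + drift_const * (\<Sum>j<n. measure (kp j u) C0))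
        + ennreal drift_const * ennreal (measure (kp n u) C0)"
    by (rule order_trans[OF drift_kp_Suc[OF u]])
       (intro add_mono mult_left_mono Suc, simp_all add: K.emeasure_eq_measure)
  also have "\<dots> = ennreal (lam * (lam ^ n * V u + drift_const * (\<Sum>j<n. measure (kp j u) C0)) + drift_const * measure (kp n u) C0)"
    using lam drift_const_ge_1 nn by (simp add: ennreal_mult)
  also have "\<dots> \<le> ennreal (lam ^ Suc n * V u + drift_const * (\<Sum>j<Suc n. measure (kp j u) C0))"
    using mult_right_mono[of lam 1, OF _ nn(2)] lam
    by (intro ennreal_leI) (simp add: algebra_simps)
  finally show ?case .
qed

text \<open>This form bounds every visit to C0 by 1 and keeps the discount, so the error is a
  geometric sum independent of n.\<close>

lemma drift_kp:
  assumes u: "u \<in> space X"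
  shows "(\<integral>\<^sup>+z. ennreal (V z) \<partial>kp n u) \<le> ennreal (lam ^ n * V u + drift_const / (1 - lam))"
proof (induction n)
  case 0
  have "V u \<le> V u + drift_const / (1 - lam)" using lam drift_const_ge_1 by simp
  then show ?case using u by (simp add: nn_integral_return ennreal_leI)
next
  case (Suc n)
  interpret K: prob_space "kp n u" by (rule kp_space[OF u])
  have nn: "0 \<le> lam ^ n * V u" "0 \<le> drift_const / (1 - lam)"
    using lam drift_const_ge_1 V_ge_1[OF u] by (auto intro!: mult_nonneg_nonneg)
  have "(\<integral>\<^sup>+z. ennreal (V z) \<partial>kp (Suc n) u)
      \<le> ennreal lam * ennreal (lam ^ n * V u + drift_const / (1 - lam)) + ennreal drift_const * 1"
    by (rule order_trans[OF drift_kp_Suc[OF u]])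
       (intro add_mono mult_left_mono Suc K.emeasure_le_1, simp_all)
  also have "\<dots> = ennreal (lam * (lam ^ n * V u + drift_const / (1 - lam)) + drift_const)"
    using lam drift_const_ge_1 nn by (simp add: ennreal_mult)
  also have "lam * (lam ^ n * V u + drift_const / (1 - lam)) + drift_const = lam ^ Suc n * V u + drift_const / (1 - lam)"
    using lam by (simp add: field_simps)
  finally show ?case .
qed

text \<open>Since V is at least 1, so is its expectation at time n. Once lam^n V(u) is at most 1/2,
  the visits to C0 must supply the other half, and some single time carries an equal share. That
  time depends on u, its bound n does not.\<close>

lemma C0_hit:
  obtains n :: nat and \<delta> :: real where "\<delta> > 0"
    "\<And>u. u \<in> space X \<Longrightarrow> V u \<le> r \<Longrightarrow> \<exists>j<n. \<delta> \<le> measure (kp j u) C0"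
proof -
  define R where "R = max r 1"
  have R: "r \<le> R" "1 \<le> R" by (auto simp: R_def)
  then obtain n0 where n0: "lam ^ n0 < 1 / (2 * R)"
    using real_arch_pow_inv[OF _ lam(2), of "1 / (2 * R)"] by auto
  \<comment> \<open>The successor makes n positive, as the averaging over n times requires.\<close>
  define n where "n = Suc n0"
  have n: "lam ^ n < 1 / (2 * R)"
    using n0 lam power_decreasing[of n0 n lam] by (simp add: n_def)
  show thesis
  proof (rule that[of "1 / (2 * drift_const) / n"])
    show "1 / (2 * drift_const) / n > 0" using drift_const_ge_1 by (simp add: n_def)
    fix u assume u: "u \<in> space X" and r: "V u \<le> r"
    have "lam ^ n * V u \<le> 1 / (2 * R) * R"
      using n lam V_ge_1[OF u] r R by (intro mult_mono) auto
    also have "\<dots> = 1 / 2" using R by (simp add: field_simps)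
    finally have half: "lam ^ n * V u \<le> 1 / 2" .
    interpret K: prob_space "kp n u" by (rule kp_space[OF u])
    have "1 = (\<integral>\<^sup>+z. 1 \<partial>kp n u)"
      by (simp add: K.emeasure_space_1)
    also have "\<dots> \<le> (\<integral>\<^sup>+z. ennreal (V z) \<partial>kp n u)"
      using V_ge_1 by (intro nn_integral_mono) (simp add: space_kp[OF u])
    also have "\<dots> \<le> ennreal (lam ^ n * V u + drift_const * (\<Sum>j<n. measure (kp j u) C0))"
      by (rule drift_kp_sum[OF u])
    finally have "1 \<le> lam ^ n * V u + drift_const * (\<Sum>j<n. measure (kp j u) C0)"
      by simp
    with half have "1 / (2 * drift_const) \<le> (\<Sum>j<n. measure (kp j u) C0)"
      using drift_const_ge_1 by (simp add: field_simps)
    from sum_ge_imp_ex_ge[OF this] show "\<exists>j<n. 1 / (2 * drift_const) / n \<le> measure (kp j u) C0"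
      by (simp add: n_def)
  qed
qed

text \<open>By accessibility, countably many sets B p, on each of which C is hit at a fixed time
  with a fixed minimal probability, cover the space. The petite measure \<eta> charges one of them,
  so every point of C0 reaches that B p along the sampling law a.\<close>

lemma C_hit_from_C0:
  obtains n :: nat and \<delta> :: real where "\<delta> > 0"
    "\<And>z. z \<in> C0 \<Longrightarrow> \<exists>j<n. \<delta> \<le> measure (kp j z) C"
proof -
  obtain a :: "nat pmf" and \<eta> where \<eta>: "sets \<eta> = sets X" "emeasure \<eta> (space X) > 0"
    "\<And>z B. z \<in> C0 \<Longrightarrow> B \<in> sets X \<Longrightarrow>
      emeasure \<eta> B \<le> (\<Sum>n. ennreal (pmf a n) * emeasure (kp n z) B)"
    using petite unfolding petite_def by blast
  define B where "B p = {z \<in> space X. 1 / real (Suc (snd p)) \<le> measure (kp (fst p) z) C}" for p :: "nat \<times> nat"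
  have B_sets[measurable]: "B p \<in> sets X" for p
    unfolding B_def by measurable
  have cover: "(\<Union>p. B p) = space X"
  proof (intro equalityI subsetI)
    fix z assume z: "z \<in> space X"
    then interpret prob: prob_space "kp n z" for n by (rule kp_space)
    obtain n where "emeasure (kp n z) C > 0"
      using accessibleD[OF z] by blast
    then have "measure (kp n z) C > 0"
      by (simp add: prob.emeasure_eq_measure)
    then obtain k where "inverse (real (Suc k)) < measure (kp n z) C"
      using reals_Archimedean by blast
    then have "z \<in> B (n, k)" using z by (simp add: B_def inverse_eq_divide)
    then show "z \<in> (\<Union>p. B p)" by blast
  qed (auto simp: B_def)
  have "\<exists>p. emeasure \<eta> (B p) \<noteq> 0"
  proof (rule ccontr)
    assume "\<not> ?thesis"
    then have "(\<Union>p. B p) \<in> null_sets \<eta>"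
      by (intro null_sets_UN') (auto simp: null_sets_def \<eta>(1))
    with cover \<eta>(2) show False by (simp add: null_sets_def)
  qed
  then obtain p where p: "emeasure \<eta> (B p) \<noteq> 0" ..
  \<comment> \<open>The cap at 1 yields a real number even if \<eta> is infinite on B p, which can
    happen when C0 is empty.\<close>
  define c where "c = enn2real (min 1 (emeasure \<eta> (B p)))"
  have c: "ennreal c = min 1 (emeasure \<eta> (B p))"
    unfolding c_def by (subst ennreal_enn2real) (auto simp: less_top[symmetric] min_def top_unique)
  have c_pos: "c > 0"
  proof -
    have "0 < ennreal c" unfolding c using p by (simp add: zero_less_iff_neq_zero)
    then show ?thesis by simp
  qed
  \<comment> \<open>Truncating a where its tail is below c / 3 leaves finitely many times. If each
    of them reached B p with probability below c / 3, the average under a would be less than c. As a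
    has total mass 1, no factor N is lost.\<close>
  have "(\<lambda>N. measure_pmf.prob a {N..}) \<longlonglongrightarrow> measure_pmf.prob a (\<Inter>N. {N..})"
    by (rule measure_pmf.finite_Lim_measure_decseq) (auto simp: decseq_def)
  also have "(\<Inter>N::nat. {N..}) = {}"
    using Suc_n_not_le_n by blast
  finally have "\<forall>\<^sub>F N in sequentially. measure_pmf.prob a {N..} < c / 3"
    using c_pos by (intro order_tendstoD) auto
  then obtain N where N: "measure_pmf.prob a {N..} < c / 3"
    by (auto simp: eventually_sequentially)
  define e where "e = 1 / real (Suc (snd p))"
  show thesis
  proof (rule that[of "c / 3 * e" "N + fst p"])
    show "c / 3 * e > 0" using c_pos by (simp add: e_def)
    fix z assume z: "z \<in> C0"
    then have zX: "z \<in> space X" using sets.sets_into_space[OF C0_sets] by auto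
    interpret K: prob_space "kp n z" for n by (rule kp_space[OF zX])
    have "\<exists>j<N. c / 3 \<le> measure (kp j z) (B p)"
    proof (rule ccontr)
      assume neg: "\<not> ?thesis"
      have "ennreal c \<le> (\<Sum>n. ennreal (pmf a n) * emeasure (kp n z) (B p))"
        using \<eta>(3)[OF z B_sets, of p] c by (simp add: min.coboundedI2)
      also have "\<dots> = (\<integral>\<^sup>+n. emeasure (kp n z) (B p) \<partial>measure_pmf a)"
        by (simp add: nn_integral_measure_pmf nn_integral_count_space_nat)
      also have "\<dots> \<le> (\<integral>\<^sup>+n. ennreal (c / 3) + indicator {N..} n \<partial>measure_pmf a)"
      proof (rule nn_integral_mono)
        fix n show "emeasure (kp n z) (B p) \<le> ennreal (c / 3) + indicator {N..} n"
        proof (cases "n < N")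
          case True
          with neg show ?thesis by (auto simp: K.emeasure_eq_measure intro!: ennreal_leI)
        next
          case False
          have "emeasure (kp n z) (B p) \<le> 1" by (rule K.emeasure_le_1)
          also have "1 \<le> ennreal (c / 3) + 1" by (simp add: add_increasing)
          finally show ?thesis using False by simp
        qed
      qed
      also have "\<dots> = ennreal (c / 3) + ennreal (measure_pmf.prob a {N..})"
        by (simp add: nn_integral_add measure_pmf.emeasure_eq_measure)
      also have "\<dots> = ennreal (c / 3 + measure_pmf.prob a {N..})"
        using c_pos by simp
      finally have "c \<le> c / 3 + measure_pmf.prob a {N..}"
        by (subst (asm) ennreal_le_iff) (use c_pos in auto)
      with N c_pos show False by simp
    qed
    then obtain j where j: "j < N" "c / 3 \<le> measure (kp j z) (B p)" by blast
    have "c / 3 * e \<le> measure (kp (j + fst p) z) C"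
      by (rule measure_kp_add_ge[OF zX C_sets B_sets _ j(2)])
         (use c_pos in \<open>auto simp: e_def B_def\<close>)
    with j(1) show "\<exists>j<N + fst p. c / 3 * e \<le> measure (kp j z) C"
      by (intro exI[of _ "j + fst p"]) simp
  qed
qed

text \<open>Three legs: from the sublevel set to C0, from C0 to C, and from C back to C in a number
  of steps whose residue completes the total time to a multiple of m. Only the m residues matter for
  the last leg, so its bounds can be taken as a minimum and a maximum.\<close>

lemma sublevel_hit:
  obtains J :: nat and \<epsilon> :: real where "\<epsilon> > 0"
    "\<And>u. u \<in> space X \<Longrightarrow> V u \<le> r \<Longrightarrow> \<exists>j\<le>J. \<epsilon> \<le> measure (kp (m * j) u) C"
proof -
  obtain n1 \<delta>1 where 1: "\<delta>1 > 0"
    "\<And>u. u \<in> space X \<Longrightarrow> V u \<le> r \<Longrightarrow> \<exists>j<n1. \<delta>1 \<le> measure (kp j u) C0"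
    by (rule C0_hit[of r], erule that, assumption)
  obtain n2 \<delta>2 where 2: "\<delta>2 > 0" "\<And>z. z \<in> C0 \<Longrightarrow> \<exists>j<n2. \<delta>2 \<le> measure (kp j z) C"
    by (rule C_hit_from_C0, erule that, assumption)
  have "\<exists>n \<epsilon>. \<epsilon> > 0 \<and> n mod m = s mod m \<and> (\<forall>z\<in>C. \<epsilon> \<le> measure (kp (m + n) z) C)" for s
  proof -
    obtain n where n: "n mod m = s mod m" "nu_pos n C"
      using nu_pos_every_residue[OF psi aper, of s] by (elim exE conjE)
    obtain \<epsilon> where \<epsilon>: "\<epsilon> > 0" "\<And>u. u \<in> C \<Longrightarrow> ennreal \<epsilon> \<le> emeasure (kp (m + n) u) C"
      by (rule nu_pos_bound[OF C_sets n(2)], erule that, assumption)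
    have "\<epsilon> \<le> measure (kp (m + n) z) C" if "z \<in> C" for z
    proof -
      interpret prob_space "kp (m + n) z"
        using that sets.sets_into_space[OF C_sets] by (intro kp_space) auto
      show ?thesis using \<epsilon>(2)[OF that] by (simp add: emeasure_eq_measure)
    qed
    with \<epsilon>(1) n(1) show ?thesis by (intro exI[of _ n] exI[of _ \<epsilon>]) simp
  qed
  then have "\<forall>s. \<exists>p. snd p > 0 \<and> fst p mod m = s mod m \<and> (\<forall>z\<in>C. snd p \<le> measure (kp (m + fst p) z) C)"
    by simp
  from choice[OF this] obtain f where f: "\<forall>s. snd (f s) > 0 \<and> fst (f s) mod m = s mod m \<and>
      (\<forall>z\<in>C. snd (f s) \<le> measure (kp (m + fst (f s)) z) C)" ..
  define n3 \<epsilon>3 where "n3 s = fst (f s)" and "\<epsilon>3 s = snd (f s)" for s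
  have 3: "\<epsilon>3 s > 0" "n3 s mod m = s mod m"
    "z \<in> C \<Longrightarrow> \<epsilon>3 s \<le> measure (kp (m + n3 s) z) C" for s z
    using f by (auto simp: n3_def \<epsilon>3_def)
  define \<epsilon>4 where "\<epsilon>4 = Min (\<epsilon>3 ` {..<m})"
  have ne: "{..<m} \<noteq> {}"
    using m_ge_1 by (auto simp: lessThan_empty_iff)
  have \<epsilon>4: "\<epsilon>4 > 0" "\<And>s. s < m \<Longrightarrow> \<epsilon>4 \<le> \<epsilon>3 s"
    using 3(1) ne unfolding \<epsilon>4_def by (auto intro!: Min_gr_iff[THEN iffD2])
  define n4 where "n4 = Max (n3 ` {..<m})"
  have n4: "n3 s \<le> n4" if "s < m" for s
    using that unfolding n4_def by simp
  define \<epsilon> where "\<epsilon> = \<delta>1 / n2 * \<delta>2 * \<epsilon>4"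
  show thesis
  \<comment> \<open>With n2 = 0 the set C0 is empty, hence by \<open>C0_hit\<close> the sublevel set
    is empty too and the claim is vacuous.\<close>
  proof (cases "n2 = 0")
    case True
    then have "C0 = {}" using 2(2) by blast
    then have "\<not> V u \<le> r" if "u \<in> space X" for u
      using 1(2)[OF that] 1(1) by auto
    then show thesis using that[of 1 0] by auto
  next
    case n2: False
    show thesis
    proof (rule that[of \<epsilon> "n1 + n2 + m + n4"])
      show "\<epsilon> > 0" using 1(1) 2(1) \<epsilon>4(1) n2 by (simp add: \<epsilon>_def)
      fix u assume u: "u \<in> space X" "V u \<le> r"
      obtain j where j: "j < n1" "\<delta>1 \<le> measure (kp j u) C0"
        using 1(2)[OF u] by (elim exE conjE)
      \<comment> \<open>The time from C0 to C depends on the entrance point. Sorting the points of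
        C0 by an admissible time i leaves one class with at least the share \<delta>1 / n2 of the
        mass.\<close>
      define S where "S i = {z \<in> C0. \<delta>2 \<le> measure (kp i z) C}" for i
      have S[measurable]: "S i \<in> sets X" for i
      proof -
        have "S i = C0 \<inter> {z \<in> space X. \<delta>2 \<le> measure (kp i z) C}"
          using sets.sets_into_space[OF C0_sets] by (auto simp: S_def)
        also have "\<dots> \<in> sets X" by measurable
        finally show ?thesis .
      qed
      interpret K: prob_space "kp j u" by (rule kp_space[OF u(1)])
      have "\<delta>1 \<le> measure (kp j u) (\<Union>i<n2. S i)"
        using j(2) 2(2) S by (intro order_trans[OF j(2)] K.finite_measure_mono) (auto simp: S_def sets_kp[OF u(1)])
      also have "\<dots> \<le> (\<Sum>i<n2. measure (kp j u) (S i))"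
        using S by (intro K.finite_measure_subadditive_finite) (auto simp: sets_kp[OF u(1)])
      finally obtain i where i: "i < n2" "\<delta>1 / n2 \<le> measure (kp j u) (S i)"
        using sum_ge_imp_ex_ge n2 by blast
      \<comment> \<open>The residue of - (j + i) modulo m; the outer reduction sends m to 0 when j +
        i is already a multiple.\<close>
      define s where "s = (m - (j + i) mod m) mod m"
      have s: "s < m" using m_ge_1 by (simp add: s_def)
      have "\<delta>1 / n2 * \<delta>2 \<le> measure (kp (j + i) u) C"
        using 1(1) 2(1) by (intro measure_kp_add_ge[OF u(1) C_sets S _ i(2)]) (auto simp: S_def)
      then have hit: "\<epsilon> \<le> measure (kp (j + i + (m + n3 s)) u) C"
        unfolding \<epsilon>_def
        by (rule measure_kp_add_ge[OF u(1) C_sets C_sets, rotated])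
           (use 1(1) 2(1) \<epsilon>4(1) order_trans[OF \<epsilon>4(2)[OF s] 3(3)] in auto)
      have "m dvd j + i + (m + n3 s)"
      proof -
        have "(j + i + (m + n3 s)) mod m = ((j + i + n3 s) + m) mod m"
          by (simp only: ac_simps)
        also have "\<dots> = ((j + i) mod m + n3 s mod m) mod m"
          by (simp only: mod_add_self2 mod_add_eq)
        also have "\<dots> = ((j + i) mod m + (m - (j + i) mod m)) mod m"
          unfolding 3(2) by (simp add: s_def mod_simps)
        also have "\<dots> = 0"
          using m_ge_1 mod_less_divisor[of m "j + i"] by simp
        finally show ?thesis by (simp add: dvd_eq_mod_eq_0)
      qed
      then obtain k where k: "j + i + (m + n3 s) = m * k" by (elim dvdE)
      have "k \<le> m * k" using m_ge_1 by simp
      also have "m * k \<le> n1 + n2 + m + n4"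
        unfolding k[symmetric] using j(1) i(1) n4[OF s] by linarith
      finally show "\<exists>k\<le>n1 + n2 + m + n4. \<epsilon> \<le> measure (kp (m * k) u) C"
        using hit k by (intro exI[of _ k]) auto
    qed
  qed
qed

text \<open>A single point u of C suffices: \<beta> times the integral is at most P^m V(u), which
  the drift bounds.\<close>

lemma nu_V_finite: "(\<integral>\<^sup>+z. ennreal (V z) \<partial>\<nu>) < \<infinity>"
proof -
  obtain u where u: "u \<in> C" "u \<in> space X" by (rule C_not_empty)
  have "ennreal \<beta> * (\<integral>\<^sup>+z. ennreal (V z) \<partial>\<nu>) \<le> (\<integral>\<^sup>+z. ennreal (V z) \<partial>kp m u)"
    by (rule minor_le[OF u(1)]) measurable
  also have "\<dots> \<le> ennreal (lam ^ m * V u + drift_const / (1 - lam))"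
    by (rule drift_kp[OF u(2)])
  also have "\<dots> < \<infinity>" by simp
  finally show ?thesis
    using \<beta>_pos by (auto simp: ennreal_mult_less_top)
qed

text \<open>The data for \<open>contraction_decay\<close> are the total mass M, the V-moment v and
  the mass h on the sublevel set. Killing only removes mass, so v inherits the m-step drift with
  factor lam^m; \<open>markov\<close> is Markov's inequality for V; the drop of M comes from
  \<open>sublevel_hit\<close>.\<close>

lemma flow_decay:
  assumes flow: "killed_flow \<mu>" and V0: "(\<integral>\<^sup>+z. ennreal (V z) \<partial>\<mu> 0) < \<infinity>"
  shows "\<exists>b>0. \<exists>\<rho>. 0 < \<rho> \<and> \<rho> < 1 \<and> (\<forall>k. measure (\<mu> k) (space X) \<le> b * \<rho> ^ k)"
proof -
  note [measurable_cong] = sets_flow[OF flow]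
  note space_flow[OF flow, simp]
  interpret a: finite_measure "\<mu> k" for k by (rule finite_flow[OF flow])
  define \<gamma> where "\<gamma> = lam ^ m"
  define K where "K = drift_const / (1 - lam)"
  define r where "r = 4 * (K / (1 - \<gamma>) + 1) / (1 - \<gamma>)"
  have \<gamma>: "0 \<le> \<gamma>" "\<gamma> < 1"
    using lam m_ge_1 by (auto simp: \<gamma>_def power_less_one_iff)
  have K: "0 \<le> K" using lam drift_const_ge_1 by (simp add: K_def)
  have r_pos: "r > 0"
    using \<gamma> K by (simp add: r_def add_nonneg_pos)
  obtain J \<epsilon> where \<epsilon>: "\<epsilon> > 0"
    "\<And>u. u \<in> space X \<Longrightarrow> V u \<le> r \<Longrightarrow> \<exists>j\<le>J. \<epsilon> \<le> measure (kp (m * j) u) C"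
    by (rule sublevel_hit[of r], erule that, assumption)
  define M where "M k = measure (\<mu> k) (space X)" for k
  define c where "c k = measure (\<mu> k) C" for k
  define S where "S = {u \<in> space X. V u \<le> r}"
  have S[measurable]: "S \<in> sets X" unfolding S_def by measurable
  define h where "h k = measure (\<mu> k) S" for k
  define v where "v k = enn2real (\<integral>\<^sup>+z. ennreal (V z) \<partial>\<mu> k)" for k
  have v_bound: "(\<integral>\<^sup>+z. ennreal (V z) \<partial>\<mu> (Suc k))
      \<le> ennreal \<gamma> * (\<integral>\<^sup>+z. ennreal (V z) \<partial>\<mu> k) + ennreal K * ennreal (M k)" for k
  proof -
    have "(\<integral>\<^sup>+z. ennreal (V z) \<partial>\<mu> (Suc k)) \<le> (\<integral>\<^sup>+u. (\<integral>\<^sup>+z. ennreal (V z) \<partial>kp m u) \<partial>\<mu> k)"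
      by (rule flow_nn_integral_le[OF flow]) measurable
    also have "\<dots> \<le> (\<integral>\<^sup>+u. ennreal \<gamma> * ennreal (V u) + ennreal K \<partial>\<mu> k)"
    proof (rule nn_integral_mono)
      fix u assume "u \<in> space (\<mu> k)"
      then have u: "u \<in> space X" by simp
      have "0 \<le> V u" using V_ge_1[OF u] by simp
      then have "ennreal (\<gamma> * V u + K) = ennreal \<gamma> * ennreal (V u) + ennreal K"
        using \<gamma> K by (simp add: ennreal_mult)
      then show "(\<integral>\<^sup>+z. ennreal (V z) \<partial>kp m u) \<le> ennreal \<gamma> * ennreal (V u) + ennreal K"
        using drift_kp[OF u, of m] by (simp add: \<gamma>_def K_def)
    qed
    also have "\<dots> = ennreal \<gamma> * (\<integral>\<^sup>+z. ennreal (V z) \<partial>\<mu> k) + ennreal K * ennreal (M k)"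
      by (simp add: nn_integral_add nn_integral_cmult a.emeasure_eq_measure M_def)
    finally show ?thesis .
  qed
  have v_fin: "(\<integral>\<^sup>+z. ennreal (V z) \<partial>\<mu> k) < \<infinity>" for k
  proof (induction k)
    case (Suc k)
    show ?case
      by (rule le_less_trans[OF v_bound]) (use Suc in \<open>simp add: ennreal_mult_less_top\<close>)
  qed (rule V0)
  have v: "(\<integral>\<^sup>+z. ennreal (V z) \<partial>\<mu> k) = ennreal (v k)" "0 \<le> v k" for k
    using v_fin[of k] by (simp_all add: v_def)
  have v_step: "v (Suc k) \<le> \<gamma> * v k + K * M k" for k
  proof -
    have "ennreal (v (Suc k)) \<le> ennreal (\<gamma> * v k + K * M k)"
      using v_bound[of k] \<gamma> K v(2) by (simp add: v ennreal_mult M_def)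
    then show ?thesis
      using \<gamma> K v(2) by (subst (asm) ennreal_le_iff) (auto simp: M_def)
  qed
  have sum_c: "M (k + n) + \<beta> * (\<Sum>i<n. c (k + i)) = M k" for k n
    using flow_mass_sum[OF flow, of k n] by (simp add: M_def c_def)
  have M_step: "M (Suc k) \<le> M k" for k
  proof -
    have "0 \<le> \<beta> * c k" using \<beta>_pos by (simp add: c_def)
    with sum_c[of k 1] show ?thesis by simp
  qed
  have markov: "M k \<le> h k + v k / r" for k
  proof -
    have "M k = h k + measure (\<mu> k) (space X - S)"
      using a.finite_measure_Union[of S k "space X - S"] sets.sets_into_space[OF S]
      by (simp add: M_def h_def Un_absorb1)
    also have "measure (\<mu> k) (space X - S) \<le> v k / r"
    proof -
      have "ennreal r * emeasure (\<mu> k) (space X - S) = (\<integral>\<^sup>+u. ennreal r * indicator (space X - S) u \<partial>\<mu> k)"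
        by (rule nn_integral_cmult_indicator[symmetric]) measurable
      also have "\<dots> \<le> (\<integral>\<^sup>+u. ennreal (V u) \<partial>\<mu> k)"
        by (intro nn_integral_mono) (auto simp: S_def intro!: ennreal_leI split: split_indicator)
      finally have "ennreal (r * measure (\<mu> k) (space X - S)) \<le> ennreal (v k)"
        using r_pos by (simp add: v a.emeasure_eq_measure ennreal_mult)
      then show ?thesis
        using r_pos v(2) by (simp add: field_simps)
    qed
    finally show ?thesis by simp
  qed
  \<comment> \<open>D and \<delta> are read off from the end of \<open>drop\<close>: hits from the
    sublevel set give \<epsilon> h k \<le> D T, while the mass lost over J + 1 blocks is \<beta> T.
    The times 0 to J are summed because the good time varies with u.\<close>
  define D where "D = real (Suc J) * (1 + \<beta>)"
  have D: "D > 0" using \<beta>_pos by (simp add: D_def del: of_nat_Suc)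
  define \<delta> where "\<delta> = \<epsilon> * \<beta> / D"
  have \<delta>: "\<delta> > 0" using \<epsilon>(1) \<beta>_pos D by (simp add: \<delta>_def)
  have drop: "M (k + Suc J) + \<delta> * h k \<le> M k" for k
  proof -
    define T where "T = (\<Sum>i<Suc J. c (k + i))"
    have T: "0 \<le> T" by (simp add: T_def c_def sum_nonneg)
    \<comment> \<open>In the renewal equation the unkilled hit at block k + j is at most T, and the
      hits after a regeneration are at most \<beta> T because \<open>return_prob\<close> is at most
      1.\<close>
    have hit: "(\<integral>\<^sup>+u. emeasure (kp (m * j) u) C \<partial>\<mu> k) \<le> ennreal ((1 + \<beta>) * T)" if j: "j \<le> J" for j
    proof -
      have "(\<integral>\<^sup>+u. emeasure (kp (m * j) u) C \<partial>\<mu> k)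
          \<le> emeasure (\<mu> (k + j)) C + (\<Sum>i<j. ennreal \<beta> * emeasure (\<mu> (k + i)) C * 1)"
        unfolding flow_renewal[OF flow]
        by (intro add_left_mono sum_mono mult_left_mono return_prob_le_1) simp
      also have "\<dots> = ennreal (c (k + j) + (\<Sum>i<j. \<beta> * c (k + i)))"
        using \<beta>_pos by (simp add: c_def a.emeasure_eq_measure sum_nonneg ennreal_mult flip: sum_ennreal)
      also have "c (k + j) + (\<Sum>i<j. \<beta> * c (k + i)) \<le> T + \<beta> * T"
        unfolding T_def sum_distrib_left[symmetric] using j \<beta>_pos
        by (intro add_mono mult_left_mono sum_mono2 member_le_sum[of j _ "\<lambda>j. c (k + j)"]) (auto simp: c_def)
      finally show ?thesis by (simp add: algebra_simps ennreal_leI)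
    qed
    have "ennreal (\<epsilon> * h k) = (\<integral>\<^sup>+u. ennreal \<epsilon> * indicator S u \<partial>\<mu> k)"
      using \<epsilon>(1) by (simp add: nn_integral_cmult_indicator a.emeasure_eq_measure h_def ennreal_mult)
    also have "\<dots> \<le> (\<integral>\<^sup>+u. (\<Sum>j<Suc J. emeasure (kp (m * j) u) C) \<partial>\<mu> k)"
    proof (rule nn_integral_mono)
      fix u assume "u \<in> space (\<mu> k)"
      then have u: "u \<in> space X" by simp
      interpret K: prob_space "kp n u" for n by (rule kp_space[OF u])
      show "ennreal \<epsilon> * indicator S u \<le> (\<Sum>j<Suc J. emeasure (kp (m * j) u) C)"
      proof (cases "u \<in> S")
        case True
        then obtain j where j: "j \<le> J" "\<epsilon> \<le> measure (kp (m * j) u) C"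
          using \<epsilon>(2)[OF u] by (auto simp: S_def)
        have "ennreal \<epsilon> \<le> emeasure (kp (m * j) u) C"
          using j(2) by (simp add: K.emeasure_eq_measure ennreal_leI)
        also have "\<dots> \<le> (\<Sum>j<Suc J. emeasure (kp (m * j) u) C)"
          using j(1) by (intro member_le_sum) auto
        finally show ?thesis using True by simp
      qed simp
    qed
    also have "\<dots> = (\<Sum>j<Suc J. (\<integral>\<^sup>+u. emeasure (kp (m * j) u) C \<partial>\<mu> k))"
      by (rule nn_integral_sum) measurable
    also have "\<dots> \<le> (\<Sum>j<Suc J. ennreal ((1 + \<beta>) * T))"
      by (intro sum_mono hit) simp
    also have "\<dots> = ennreal (real (Suc J) * ((1 + \<beta>) * T))"
      using \<beta>_pos T by (simp add: ennreal_of_nat_eq_real_of_nat ennreal_mult del: of_nat_Suc)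
    finally have "\<epsilon> * h k \<le> real (Suc J) * ((1 + \<beta>) * T)"
      using \<beta>_pos T by (subst (asm) ennreal_le_iff) auto
    then have "\<epsilon> * h k \<le> D * T"
      by (simp add: D_def mult.assoc)
    then have "\<beta> * (\<epsilon> * h k) / D \<le> \<beta> * (D * T) / D"
      using \<beta>_pos D by (intro divide_right_mono mult_left_mono) auto
    then have "\<delta> * h k \<le> \<beta> * T"
      using D by (simp add: \<delta>_def ac_simps)
    then show ?thesis
      using sum_c[of k "Suc J"] unfolding T_def by simp
  qed
  have "\<exists>b>0. \<exists>\<rho>. 0 < \<rho> \<and> \<rho> < 1 \<and> (\<forall>k. M k \<le> b * \<rho> ^ k)"
    by (rule contraction_decay[OF \<gamma> K \<delta>, of "Suc J" r v M h])
       (use r_def v(2) v_step M_step drop markov in \<open>auto simp: M_def\<close>)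
  then show ?thesis by (simp add: M_def)
qed

end

section \<open>Times of visits along a binary sequence\<close>

text \<open>Indices are shifted by one: \<open>hit_time z i\<close> is \<open>r\<^bsub>i+1\<^esub>\<close> and \<open>gap z i\<close> is \<open>L\<^bsub>i+1\<^esub>\<close>, as functions of
  the visits \<open>z\<close> of the skeleton to the atom.\<close>

fun hit_time :: "(nat \<Rightarrow> bool) \<Rightarrow> nat \<Rightarrow> enat" where
  "hit_time z 0 = Inf {enat k | k. z k}"
| "hit_time z (Suc i) = Inf {enat k | k. hit_time z i < enat k \<and> z k}"

fun gap :: "(nat \<Rightarrow> bool) \<Rightarrow> nat \<Rightarrow> enat" where
  "gap z 0 = hit_time z 0 + 1"
| "gap z (Suc i) = (hit_time z (Suc i) + 1) - (hit_time z i + 1)"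

lemma regen_time_eq_hit_time:
  "regen_time C m x y (Suc i) = hit_time (\<lambda>k. x (k * m) \<in> C \<and> y (k * m)) i"
  by (induction i) simp_all

lemma cycle_length_eq_gap:
  "cycle_length C m x y (Suc i) \<omega> = gap (\<lambda>k. x (k * m) \<omega> \<in> C \<and> y (k * m) \<omega>) i"
proof (cases i)
  case 0
  then show ?thesis
    by (simp add: cycle_length_def cycle_end_def regen_time_eq_hit_time zero_enat_def[symmetric])
next
  case (Suc n)
  then show ?thesis
    by (simp add: cycle_length_def cycle_end_def regen_time_eq_hit_time del: hit_time.simps)
qed

lemma Inf_enat_eq_iff: "Inf {enat k | k. Q k} = enat k \<longleftrightarrow> Q k \<and> (\<forall>j<k. \<not> Q j)"
proof
  assume eq: "Inf {enat k | k. Q k} = enat k"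
  then have "{enat k | k. Q k} \<noteq> {}"
    by (auto simp: Inf_enat_def split: if_splits)
  then have "Inf {enat k | k. Q k} \<in> {enat k | k. Q k}"
    unfolding Inf_enat_def by (auto intro: LeastI)
  moreover have "\<not> Q j" if "j < k" for j
  proof
    assume "Q j"
    then have "Inf {enat k | k. Q k} \<le> enat j" by (intro Inf_lower) auto
    with eq that show False by simp
  qed
  ultimately show "Q k \<and> (\<forall>j<k. \<not> Q j)" using eq by auto
next
  assume "Q k \<and> (\<forall>j<k. \<not> Q j)"
  then show "Inf {enat k | k. Q k} = enat k"
    by (intro antisym Inf_lower Inf_greatest) (auto simp: not_less[symmetric])
qed

lemma Inf_enat_eq_infinity_iff: "Inf {enat k | k. Q k} = \<infinity> \<longleftrightarrow> (\<forall>k. \<not> Q k)"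
proof
  assume eq: "Inf {enat k | k. Q k} = \<infinity>"
  show "\<forall>k. \<not> Q k"
  proof (intro allI notI)
    fix k assume "Q k"
    then have "Inf {enat k | k. Q k} \<le> enat k" by (intro Inf_lower) auto
    with eq show False by simp
  qed
qed (simp add: Inf_enat_def)

lemma hit_time_imp: "hit_time z i = enat k \<Longrightarrow> z k"
  by (cases i) (auto simp: Inf_enat_eq_iff)

lemma hit_time_finite_pred:
  assumes "hit_time z (Suc i) = enat k"
  obtains l where "hit_time z i = enat l" "l < k"
  using assms by (cases "hit_time z i") (auto simp: Inf_enat_eq_iff top_enat_def)

text \<open>The stopping-time property: whether a hit time equals k, and then all earlier hit times,
  can be read off from the visits up to k.\<close>

lemma hit_time_cong:
  assumes "hit_time z i = enat k" "\<And>j. j \<le> k \<Longrightarrow> z j = z' j" "i' \<le> i"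
  shows "hit_time z' i' = hit_time z i'"
  using assms
proof (induction i arbitrary: k i')
  case 0
  then have "hit_time z' 0 = enat k"
    by (auto simp: Inf_enat_eq_iff)
  with 0 show ?case by simp
next
  case (Suc i)
  obtain l where l: "hit_time z i = enat l" "l < k"
    using Suc.prems(1) by (rule hit_time_finite_pred)
  have IH: "hit_time z' i' = hit_time z i'" if "i' \<le> i" for i'
    using Suc.IH[OF l(1)] Suc.prems(2) l(2) that by simp
  show ?case
  proof (cases "i' = Suc i")
    case True
    have "z k \<and> (\<forall>j<k. \<not> (enat l < enat j \<and> z j))"
      using Suc.prems(1) l(1) by (auto simp: Inf_enat_eq_iff)
    then have "hit_time z' (Suc i) = enat k"
      using IH[of i] l Suc.prems(2) by (auto simp: Inf_enat_eq_iff)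
    with True Suc.prems(1) show ?thesis by simp
  qed (use IH Suc.prems(3) in simp)
qed

lemma gap_cong:
  assumes "hit_time z i = enat k" "\<And>j. j \<le> k \<Longrightarrow> z j = z' j" "i' \<le> i"
  shows "gap z' i' = gap z i'"
  using hit_time_cong[OF assms(1,2)] assms(3) by (cases i') (simp_all del: hit_time.simps)

text \<open>Translates a cycle length into j blocks without a visit followed by a visit. The cycle
  starts at block k + 1, so j quiet blocks correspond to length j + 1.\<close>

lemma gap_Suc_eq_iff:
  assumes "hit_time z i = enat k"
  shows "gap z (Suc i) = enat (Suc j) \<longleftrightarrow> z (Suc k + j) \<and> (\<forall>l<j. \<not> z (Suc k + l))"
proof -
  have "gap z (Suc i) = enat (Suc j) \<longleftrightarrow> hit_time z (Suc i) = enat (Suc k + j)"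
    using assms by (cases "hit_time z (Suc i)") (auto simp del: hit_time.simps simp: one_enat_def)
  also have "\<dots> \<longleftrightarrow> z (Suc k + j) \<and> (\<forall>l<Suc k + j. \<not> (k < l \<and> z l))"
    using assms by (simp add: Inf_enat_eq_iff)
  also have "(\<forall>l<Suc k + j. \<not> (k < l \<and> z l)) \<longleftrightarrow> (\<forall>l<j. \<not> z (Suc k + l))"
  proof (intro iffI allI impI notI)
    fix l assume *: "\<forall>l<j. \<not> z (Suc k + l)" and l: "l < Suc k + j" "k < l \<and> z l"
    then have "\<not> z (Suc k + (l - Suc k))" by (intro *[rule_format]) auto
    with l show False by simp
  qed auto
  finally show ?thesis .
qed

lemma gap_Suc_pos:
  assumes "hit_time z i = enat k"
  shows "gap z (Suc i) \<noteq> 0"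
proof -
  have "hit_time z (Suc i) = enat l \<Longrightarrow> k < l" for l
    using assms by (auto simp: Inf_enat_eq_iff)
  then show ?thesis
    using assms by (cases "hit_time z (Suc i)") (auto simp del: hit_time.simps simp: one_enat_def zero_enat_def)
qed

lemma gap_Suc_gt_imp:
  assumes "hit_time z i = enat k" "gap z (Suc i) > enat l" "j < l"
  shows "\<not> z (Suc k + j)"
proof
  assume "z (Suc k + j)"
  then have "hit_time z (Suc i) \<le> enat (Suc k + j)"
    using assms(1) by (auto intro!: Inf_lower)
  then have "gap z (Suc i) \<le> enat (Suc j)"
    using assms(1) by (cases "hit_time z (Suc i)") (auto simp del: hit_time.simps simp: one_enat_def)
  with assms(2,3) show False
    by (meson Suc_leI enat_ord_simps(1) leD order_trans)
qed

lemma gap_0_gt_imp: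
  assumes "gap z 0 > enat l" "j < l"
  shows "\<not> z j"
proof
  assume "z j"
  then have "hit_time z 0 \<le> enat j"
    by (auto intro!: Inf_lower)
  then have "gap z 0 \<le> enat (Suc j)"
    by (cases "hit_time z 0") (auto simp del: hit_time.simps simp: one_enat_def)
  with assms show False
    by (meson Suc_leI enat_ord_simps(1) leD order_trans)
qed

section \<open>The split chain\<close>

lemma measurable_history:
  assumes "\<And>n. x n \<in> \<Omega> \<rightarrow>\<^sub>M X" "\<And>n. y n \<in> \<Omega> \<rightarrow>\<^sub>M count_space UNIV"
  shows "(\<lambda>\<omega>. (\<lambda>i\<in>I. x i \<omega>, \<lambda>j\<in>J. y j \<omega>)) \<in> history \<Omega> X x y I J
    \<rightarrow>\<^sub>M PiM I (\<lambda>_. X) \<Otimes>\<^sub>M PiM J (\<lambda>_. count_space (UNIV :: bool set))"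
    (is "?f \<in> _ \<rightarrow>\<^sub>M ?N")
proof -
  have "?f \<in> \<Omega> \<rightarrow>\<^sub>M ?N"
    using assms by (intro measurable_Pair measurable_restrict) auto
  then have "?f \<in> space \<Omega> \<rightarrow> space ?N"
    by (rule measurable_space[THEN funcsetI])
  then show ?thesis
    unfolding history_def by (rule measurable_vimage_algebra1)
qed

lemma measurable_history_x:
  assumes "i \<in> I" "\<And>n. x n \<in> \<Omega> \<rightarrow>\<^sub>M X" "\<And>n. y n \<in> \<Omega> \<rightarrow>\<^sub>M count_space UNIV"
  shows "x i \<in> history \<Omega> X x y I J \<rightarrow>\<^sub>M X"
  using measurable_compose[OF measurable_compose[OF measurable_history[OF assms(2,3)] measurable_fst]
      measurable_component_singleton[OF assms(1)]] assms(1)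
  by simp

lemma measurable_history_y:
  assumes "j \<in> J" "\<And>n. x n \<in> \<Omega> \<rightarrow>\<^sub>M X" "\<And>n. y n \<in> \<Omega> \<rightarrow>\<^sub>M count_space UNIV"
  shows "y j \<in> history \<Omega> X x y I J \<rightarrow>\<^sub>M count_space UNIV"
  using measurable_compose[OF measurable_compose[OF measurable_history[OF assms(2,3)] measurable_snd]
      measurable_component_singleton[OF assms(1)]] assms(1)
  by simp

lemma space_history: "space (history \<Omega> X x y I J) = space \<Omega>"
  by (simp add: history_def)

lemma sets_history_le:
  assumes "space N = space \<Omega>" "\<And>i. i \<in> I \<Longrightarrow> x i \<in> N \<rightarrow>\<^sub>M X" "\<And>j. j \<in> J \<Longrightarrow> y j \<in> N \<rightarrow>\<^sub>M count_space UNIV"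
  shows "sets (history \<Omega> X x y I J) \<subseteq> sets N"
  unfolding history_def using assms
  by (intro sets_image_in_sets measurable_Pair measurable_restrict) auto

text \<open>Turns a conditional law into an identity for integrals against bounded F-measurable
  weights. The conditional probability of one event A is represented by a random variable k, so no
  regular conditional distribution is involved.\<close>

lemma cond_law_integral:
  fixes g :: "'w \<Rightarrow> real"
  assumes \<Omega>: "prob_space \<Omega>" and F: "subalgebra \<Omega> F" and cl: "cond_law \<Omega> F Z S \<kappa>"
    and Z[measurable]: "Z \<in> \<Omega> \<rightarrow>\<^sub>M S" and A[measurable]: "A \<in> sets S"
    and g: "g \<in> borel_measurable F" and bound: "\<And>\<omega>. \<omega> \<in> space \<Omega> \<Longrightarrow> \<bar>g \<omega>\<bar> \<le> B"
    and k[measurable]: "k \<in> borel_measurable \<Omega>" and k_eq: "\<And>\<omega>. \<omega> \<in> space \<Omega> \<Longrightarrow> \<kappa> \<omega> A = k \<omega>"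
  shows "(\<integral>\<omega>. g \<omega> * indicator {\<omega> \<in> space \<Omega>. Z \<omega> \<in> A} \<omega> \<partial>\<Omega>) = (\<integral>\<omega>. g \<omega> * k \<omega> \<partial>\<Omega>)"
proof -
  interpret prob_space \<Omega> by (rule \<Omega>)
  interpret finite_measure_subalgebra \<Omega> F by unfold_locales (rule F)
  have g'[measurable]: "g \<in> borel_measurable \<Omega>"
    by (rule measurable_from_subalg[OF F g])
  let ?E = "{\<omega> \<in> space \<Omega>. Z \<omega> \<in> A}"
  have "integrable \<Omega> (\<lambda>\<omega>. g \<omega> * indicator ?E \<omega>)"
    using bound order_trans[OF abs_ge_zero bound]
    by (intro integrable_const_bound[where B=B] AE_I2) (auto split: split_indicator)
  from real_cond_exp_intg(2)[OF this g]
  have "(\<integral>\<omega>. g \<omega> * indicator ?E \<omega> \<partial>\<Omega>) = (\<integral>\<omega>. g \<omega> * real_cond_exp \<Omega> F (indicator ?E) \<omega> \<partial>\<Omega>)"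
    by simp
  also have "\<dots> = (\<integral>\<omega>. g \<omega> * k \<omega> \<partial>\<Omega>)"
  proof (rule integral_cong_AE)
    have "AE \<omega> in \<Omega>. cprob \<Omega> F ?E \<omega> = \<kappa> \<omega> A"
      using cl A unfolding cond_law_def by blast
    then show "AE \<omega> in \<Omega>. g \<omega> * real_cond_exp \<Omega> F (indicator ?E) \<omega> = g \<omega> * k \<omega>"
      using AE_space by eventually_elim (simp add: cprob_def k_eq)
  qed measurable
  finally show ?thesis .
qed

text \<open>Both sides are additive, homogeneous and continuous along increasing sequences, so
  equality on indicators extends to all nonnegative functions. This brings the flow equation from
  sets to functions.\<close>

lemma nn_integral_eqI_kernel:
  fixes f :: "'a \<Rightarrow> ennreal"
  assumes sets: "sets \<mu>' = sets X" "sets \<nu> = sets X" "sets \<mu> = sets X"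
    and K: "K \<in> X \<rightarrow>\<^sub>M subprob_algebra X"
    and eq: "\<And>A. A \<in> sets X \<Longrightarrow> emeasure \<mu>' A + c * emeasure \<nu> A = (\<integral>\<^sup>+u. emeasure (K u) A \<partial>\<mu>)"
    and f: "f \<in> borel_measurable X"
  shows "(\<integral>\<^sup>+z. f z \<partial>\<mu>') + c * (\<integral>\<^sup>+z. f z \<partial>\<nu>) = (\<integral>\<^sup>+u. (\<integral>\<^sup>+z. f z \<partial>K u) \<partial>\<mu>)"
proof -
  note [measurable_cong] = sets
  have space: "space \<mu>' = space X" "space \<nu> = space X" "space \<mu> = space X"
    by (rule sets[THEN sets_eq_imp_space_eq])+
  have K': "sets (K u) = sets X" if "u \<in> space X" for u
    by (rule subprob_measurableD(2)[OF K that])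
  have K_space: "space (K u) = space X" if "u \<in> space X" for u
    by (rule sets_eq_imp_space_eq[OF K'[OF that]])
  have [measurable]: "(\<lambda>u. \<integral>\<^sup>+z. f z \<partial>K u) \<in> borel_measurable X" if "f \<in> borel_measurable X" for f :: "'a \<Rightarrow> ennreal"
    by (rule measurable_compose[OF K nn_integral_measurable_subprob_algebra[OF that]])
  show ?thesis
    using f
  proof (induction rule: borel_measurable_induct)
    case (cong f g)
    have eq: "(\<integral>\<^sup>+z. f z \<partial>\<eta>) = (\<integral>\<^sup>+z. g z \<partial>\<eta>)" if "space \<eta> = space X" for \<eta>
      using cong(3) that by (intro nn_integral_cong) simp
    have "(\<integral>\<^sup>+u. (\<integral>\<^sup>+z. f z \<partial>K u) \<partial>\<mu>) = (\<integral>\<^sup>+u. (\<integral>\<^sup>+z. g z \<partial>K u) \<partial>\<mu>)"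
      by (intro nn_integral_cong eq K_space) (simp add: space)
    with cong(4) eq[OF space(1)] eq[OF space(2)] show ?case by simp
  next
    case (set A)
    have "(\<integral>\<^sup>+u. (\<integral>\<^sup>+z. indicator A z \<partial>K u) \<partial>\<mu>) = (\<integral>\<^sup>+u. emeasure (K u) A \<partial>\<mu>)"
      using set by (intro nn_integral_cong) (simp add: space K')
    with set eq[OF set] show ?case by (simp add: sets)
  next
    case (mult u c')
    have [measurable]: "u \<in> borel_measurable X" by (rule mult)
    have K_eq: "(\<integral>\<^sup>+z. c' * u z \<partial>K t) = c' * (\<integral>\<^sup>+z. u z \<partial>K t)" if "t \<in> space X" for t
      using mult K'[OF that] by (intro nn_integral_cmult) (simp cong: measurable_cong_sets)
    have "(\<integral>\<^sup>+t. (\<integral>\<^sup>+z. c' * u z \<partial>K t) \<partial>\<mu>) = (\<integral>\<^sup>+t. c' * (\<integral>\<^sup>+z. u z \<partial>K t) \<partial>\<mu>)"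
      by (intro nn_integral_cong K_eq) (simp add: space)
    also have "\<dots> = c' * ((\<integral>\<^sup>+z. u z \<partial>\<mu>') + c * (\<integral>\<^sup>+z. u z \<partial>\<nu>))"
      unfolding mult.IH by (rule nn_integral_cmult) measurable
    also have "\<dots> = (\<integral>\<^sup>+z. c' * u z \<partial>\<mu>') + c * (\<integral>\<^sup>+z. c' * u z \<partial>\<nu>)"
      by (simp add: nn_integral_cmult distrib_left mult.left_commute)
    finally show ?case ..
  next
    case (add u v)
    have [measurable]: "u \<in> borel_measurable X" "v \<in> borel_measurable X" by (rule add)+
    have K_eq: "(\<integral>\<^sup>+z. v z + u z \<partial>K t) = (\<integral>\<^sup>+z. v z \<partial>K t) + (\<integral>\<^sup>+z. u z \<partial>K t)" if "t \<in> space X" for t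
      using add K'[OF that] by (intro nn_integral_add) (simp_all cong: measurable_cong_sets)
    have "(\<integral>\<^sup>+t. (\<integral>\<^sup>+z. v z + u z \<partial>K t) \<partial>\<mu>)
        = (\<integral>\<^sup>+t. (\<integral>\<^sup>+z. v z \<partial>K t) + (\<integral>\<^sup>+z. u z \<partial>K t) \<partial>\<mu>)"
      by (intro nn_integral_cong K_eq) (simp add: space)
    also have "\<dots> = ((\<integral>\<^sup>+z. v z \<partial>\<mu>') + c * (\<integral>\<^sup>+z. v z \<partial>\<nu>)) + ((\<integral>\<^sup>+z. u z \<partial>\<mu>') + c * (\<integral>\<^sup>+z. u z \<partial>\<nu>))"
      unfolding add.IH by (rule nn_integral_add) measurable
    also have "\<dots> = (\<integral>\<^sup>+z. v z + u z \<partial>\<mu>') + c * (\<integral>\<^sup>+z. v z + u z \<partial>\<nu>)"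
      by (simp add: nn_integral_add distrib_left ac_simps)
    finally show ?case ..
  next
    case (seq U)
    have U: "U i \<in> borel_measurable X" for i by (rule seq)
    have sup: "(\<integral>\<^sup>+z. (SUP i. U i) z \<partial>\<eta>) = (SUP i. \<integral>\<^sup>+z. U i z \<partial>\<eta>)" if "sets \<eta> = sets X" for \<eta>
      unfolding SUP_apply using seq(3) U
      by (intro nn_integral_monotone_convergence_SUP) (simp_all add: that cong: measurable_cong_sets)
    have inc: "incseq (\<lambda>i. \<integral>\<^sup>+z. U i z \<partial>\<eta>)" for \<eta>
      using seq(3) by (auto simp: incseq_def le_fun_def intro!: nn_integral_mono)
    have "(\<integral>\<^sup>+t. (\<integral>\<^sup>+z. (SUP i. U i) z \<partial>K t) \<partial>\<mu>) = (\<integral>\<^sup>+t. (SUP i. \<integral>\<^sup>+z. U i z \<partial>K t) \<partial>\<mu>)"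
      by (intro nn_integral_cong sup K') (simp add: space)
    also have "\<dots> = (SUP i. \<integral>\<^sup>+t. (\<integral>\<^sup>+z. U i z \<partial>K t) \<partial>\<mu>)"
      using U inc by (intro nn_integral_monotone_convergence_SUP) (auto simp: incseq_def le_fun_def)
    also have "\<dots> = (SUP i. (\<integral>\<^sup>+z. U i z \<partial>\<mu>') + c * (\<integral>\<^sup>+z. U i z \<partial>\<nu>))"
      by (simp add: seq)
    also have "\<dots> = (SUP i. \<integral>\<^sup>+z. U i z \<partial>\<mu>') + (SUP i. c * (\<integral>\<^sup>+z. U i z \<partial>\<nu>))"
      using inc by (intro ennreal_SUP_add) (auto simp: incseq_def intro!: mult_left_mono)
    also have "\<dots> = (\<integral>\<^sup>+z. (SUP i. U i) z \<partial>\<mu>') + c * (\<integral>\<^sup>+z. (SUP i. U i) z \<partial>\<nu>)"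
      unfolding sup[OF sets(1)] sup[OF sets(2)] by (simp add: SUP_mult_left_ennreal)
    finally show ?case ..
  qed
qed

locale split_process = minorized_kernel X P C m \<beta> \<nu>
  for X :: "'a measure" and P C m \<beta> \<nu> +
  fixes \<Omega> :: "'w measure" and x :: "nat \<Rightarrow> 'w \<Rightarrow> 'a" and y :: "nat \<Rightarrow> 'w \<Rightarrow> bool"
  assumes split: "nummelin_splitting \<Omega> X P C m \<beta> \<nu> x y"
begin

section \<open>The histories of the split chain\<close>

lemma prob_\<Omega>: "prob_space \<Omega>" and x_measurable[measurable]: "x n \<in> \<Omega> \<rightarrow>\<^sub>M X"
  and y_measurable[measurable]: "y n \<in> \<Omega> \<rightarrow>\<^sub>M count_space UNIV"
  using split by (auto simp: nummelin_splitting_def)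

sublocale \<Omega>: prob_space \<Omega> by (rule prob_\<Omega>)

text \<open>The histories just before and just after \<open>y (k m)\<close> is drawn.\<close>

definition before :: "nat \<Rightarrow> 'w measure" where
  "before k = history \<Omega> X x y {..k * m} {j * m | j. j < k}"

definition after :: "nat \<Rightarrow> 'w measure" where
  "after k = history \<Omega> X x y {..k * m} {j * m | j. j \<le> k}"

definition Z :: "nat \<Rightarrow> 'w \<Rightarrow> bool" where
  "Z k \<omega> \<longleftrightarrow> x (k * m) \<omega> \<in> C \<and> y (k * m) \<omega>"

lemma space_before: "space (before k) = space \<Omega>" and space_after: "space (after k) = space \<Omega>"
  by (simp_all add: before_def after_def space_history)

lemma x_before: "i \<le> k * m \<Longrightarrow> x i \<in> before k \<rightarrow>\<^sub>M X"
  and x_after: "i \<le> k * m \<Longrightarrow> x i \<in> after k \<rightarrow>\<^sub>M X"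
  unfolding before_def after_def by (auto intro!: measurable_history_x)

lemma y_before: "j < k \<Longrightarrow> y (j * m) \<in> before k \<rightarrow>\<^sub>M count_space UNIV"
  and y_after: "j \<le> k \<Longrightarrow> y (j * m) \<in> after k \<rightarrow>\<^sub>M count_space UNIV"
  unfolding before_def after_def by (auto intro!: measurable_history_y)

lemma before_subset_after: "sets (before k) \<subseteq> sets (after k)"
  unfolding before_def[of k] by (intro sets_history_le) (auto simp: space_after intro: x_after y_after)

lemma after_subset_before_Suc: "sets (after k) \<subseteq> sets (before (Suc k))"
  unfolding after_def[of k] by (intro sets_history_le) (auto simp: space_before intro!: x_before y_before)

lemma subalgebra_before: "subalgebra \<Omega> (before k)"
  unfolding before_def subalgebra_def by (intro conjI sets_history_le) (auto simp: space_history)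

lemma subalgebra_after: "subalgebra \<Omega> (after k)"
  unfolding after_def subalgebra_def by (intro conjI sets_history_le) (auto simp: space_history)

lemma before_\<Omega>: "G \<in> sets (before k) \<Longrightarrow> G \<in> sets \<Omega>"
  and after_\<Omega>: "G \<in> sets (after k) \<Longrightarrow> G \<in> sets \<Omega>"
  using subalgebra_before[of k] subalgebra_after[of k] by (auto simp: subalgebra_def)

lemma Z_measurable[measurable]: "Z k \<in> \<Omega> \<rightarrow>\<^sub>M count_space UNIV"
  unfolding Z_def[abs_def] by measurable

lemma Z_after: "j \<le> k \<Longrightarrow> Z j \<in> after k \<rightarrow>\<^sub>M count_space UNIV"
proof -
  assume j: "j \<le> k"
  have [measurable]: "x (j * m) \<in> after k \<rightarrow>\<^sub>M X" "y (j * m) \<in> after k \<rightarrow>\<^sub>M count_space UNIV"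
    using j by (auto intro: x_after y_after)
  show ?thesis unfolding Z_def[abs_def] by measurable
qed

section \<open>One block of the split chain\<close>

lemma integral_y:
  assumes g: "g \<in> borel_measurable (before k)" and bound: "\<And>\<omega>. \<omega> \<in> space \<Omega> \<Longrightarrow> \<bar>g \<omega>\<bar> \<le> B"
  shows "(\<integral>\<omega>. g \<omega> * of_bool (y (k * m) \<omega>) \<partial>\<Omega>) = (\<integral>\<omega>. g \<omega> * (\<beta> * indicator C (x (k * m) \<omega>)) \<partial>\<Omega>)"
proof -
  have "(\<integral>\<omega>. g \<omega> * of_bool (y (k * m) \<omega>) \<partial>\<Omega>)
      = (\<integral>\<omega>. g \<omega> * indicator {\<omega> \<in> space \<Omega>. y (k * m) \<omega> \<in> {True}} \<omega> \<partial>\<Omega>)"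
    by (intro Bochner_Integration.integral_cong) (auto split: split_indicator)
  also have "\<dots> = (\<integral>\<omega>. g \<omega> * (\<beta> * indicator C (x (k * m) \<omega>)) \<partial>\<Omega>)"
  proof (rule cond_law_integral[OF prob_\<Omega> subalgebra_before _ y_measurable _ g bound])
    show "cond_law \<Omega> (before k) (y (k * m)) (count_space UNIV)
            (\<lambda>\<omega> B. measure (measure_pmf (bernoulli_pmf (\<beta> * indicator C (x (k * m) \<omega>)))) B)"
      using split unfolding nummelin_splitting_def before_def by blast
    show "measure (measure_pmf (bernoulli_pmf (\<beta> * indicator C (x (k * m) \<omega>)))) {True}
        = \<beta> * indicator C (x (k * m) \<omega>)" for \<omega>
      using \<beta>_pos \<beta>_less_1 by (simp add: measure_pmf_single split: split_indicator)
  qed simp_all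
  finally show ?thesis .
qed

definition residual :: "nat \<Rightarrow> 'a set \<Rightarrow> 'w \<Rightarrow> real" where
  "residual k A \<omega> = (measure (kp m (x (k * m) \<omega>)) A - \<beta> * indicator C (x (k * m) \<omega>) * measure \<nu> A)
     / (1 - \<beta> * indicator C (x (k * m) \<omega>))"

lemma integral_x:
  assumes g: "g \<in> borel_measurable (after k)" and bound: "\<And>\<omega>. \<omega> \<in> space \<Omega> \<Longrightarrow> \<bar>g \<omega>\<bar> \<le> B" and A[measurable]: "A \<in> sets X"
  shows "(\<integral>\<omega>. g \<omega> * indicator A (x (Suc k * m) \<omega>) \<partial>\<Omega>)
    = (\<integral>\<omega>. g \<omega> * (if y (k * m) \<omega> then measure \<nu> A else residual k A \<omega>) \<partial>\<Omega>)"
proof -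
  have "(\<integral>\<omega>. g \<omega> * indicator A (x (Suc k * m) \<omega>) \<partial>\<Omega>)
      = (\<integral>\<omega>. g \<omega> * indicator {\<omega> \<in> space \<Omega>. x (Suc k * m) \<omega> \<in> A} \<omega> \<partial>\<Omega>)"
    by (intro Bochner_Integration.integral_cong) (auto split: split_indicator)
  also have "\<dots> = (\<integral>\<omega>. g \<omega> * (if y (k * m) \<omega> then measure \<nu> A else residual k A \<omega>) \<partial>\<Omega>)"
  proof (rule cond_law_integral[OF prob_\<Omega> subalgebra_after _ x_measurable A g bound])
    show "cond_law \<Omega> (after k) (x (Suc k * m)) X
            (\<lambda>\<omega> A. if y (k * m) \<omega> then measure \<nu> A
              else (measure (kp m (x (k * m) \<omega>)) A - \<beta> * indicator C (x (k * m) \<omega>) * measure \<nu> A)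
                   / (1 - \<beta> * indicator C (x (k * m) \<omega>)))"
      using split unfolding nummelin_splitting_def after_def by blast
    show "(\<lambda>\<omega>. if y (k * m) \<omega> then measure \<nu> A else residual k A \<omega>) \<in> borel_measurable \<Omega>"
      unfolding residual_def by measurable
  qed (simp_all add: residual_def)
  finally show ?thesis .
qed

text \<open>A crude bound for integrability, obtained from \<beta> < 1 without using the
  minorization.\<close>

lemma abs_residual_le: "\<omega> \<in> space \<Omega> \<Longrightarrow> \<bar>residual k A \<omega>\<bar> \<le> 1 / (1 - \<beta>)"
proof -
  assume "\<omega> \<in> space \<Omega>"
  then have "x (k * m) \<omega> \<in> space X"
    using measurable_space[OF x_measurable] by blast
  then interpret K: prob_space "kp m (x (k * m) \<omega>)" by (rule kp_space)
  let ?c = "indicator C (x (k * m) \<omega>) :: real"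
  have 1: "0 \<le> \<beta> * ?c * measure \<nu> A" "\<beta> * ?c * measure \<nu> A \<le> 1"
    using \<beta>_pos \<beta>_less_1 by (auto intro!: mult_le_one split: split_indicator)
  have "\<bar>measure (kp m (x (k * m) \<omega>)) A - \<beta> * ?c * measure \<nu> A\<bar> \<le> 1"
    using 1 K.prob_le_1[of A] measure_nonneg[of "kp m (x (k * m) \<omega>)" A] by linarith
  moreover have "0 < 1 - \<beta>" "1 - \<beta> \<le> \<bar>1 - \<beta> * ?c\<bar>"
    using \<beta>_pos \<beta>_less_1 by (auto split: split_indicator)
  ultimately show ?thesis
    unfolding residual_def abs_divide by (intro frac_le) auto
qed

lemma x_before_borel:
  assumes "f \<in> borel_measurable X"
  shows "(\<lambda>\<omega>. f (x (k * m) \<omega>)) \<in> borel_measurable (before k)"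
  by (rule measurable_compose[OF x_before assms]) simp

lemma x_space: "\<omega> \<in> space \<Omega> \<Longrightarrow> x n \<omega> \<in> space X"
  using measurable_space[OF x_measurable] by blast

text \<open>The next skeleton state is integrated out first, then y. On C the event y = 0 has weight
  1 - \<beta>, which cancels the denominator of the residual law and leaves P^m - \<beta> \<nu>; off
  C the residual law is P^m itself.\<close>

lemma measure_not_Z_step:
  assumes G: "G \<in> sets (before k)" and A[measurable]: "A \<in> sets X"
  shows "measure \<Omega> (G \<inter> {\<omega> \<in> space \<Omega>. \<not> Z k \<omega> \<and> x (Suc k * m) \<omega> \<in> A})
      + \<beta> * measure \<Omega> (G \<inter> {\<omega> \<in> space \<Omega>. x (k * m) \<omega> \<in> C}) * measure \<nu> A
    = (\<integral>\<omega>. indicator G \<omega> * measure (kp m (x (k * m) \<omega>)) A \<partial>\<Omega>)"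
proof -
  have G'[measurable]: "G \<in> sets \<Omega>" by (rule before_\<Omega>[OF G])
  have G_space: "\<omega> \<in> space \<Omega>" if "\<omega> \<in> G" for \<omega>
    using that sets.sets_into_space[OF G'] by auto
  define g where "g = (indicator G :: 'w \<Rightarrow> real)"
  define a where "a = measure \<nu> A"
  define c where "c \<omega> = (indicator C (x (k * m) \<omega>) :: real)" for \<omega>
  define Y where "Y \<omega> = (of_bool (y (k * m) \<omega>) :: real)" for \<omega>
  define h where "h \<omega> = measure (kp m (x (k * m) \<omega>)) A" for \<omega>
  define q where "q = residual k A"
  have a: "0 \<le> a" "a \<le> 1" by (auto simp: a_def)
  have c01: "c \<omega> = 0 \<or> c \<omega> = 1" for \<omega> by (auto simp: c_def split: split_indicator)
  have g01: "g \<omega> = 0 \<or> g \<omega> = 1" for \<omega> by (auto simp: g_def split: split_indicator)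
  have g_before: "g \<in> borel_measurable (before k)"
    unfolding g_def using G by simp
  have c_before: "c \<in> borel_measurable (before k)"
    unfolding c_def[abs_def] by (rule x_before_borel) measurable
  have h_before: "h \<in> borel_measurable (before k)"
    unfolding h_def[abs_def] by (rule x_before_borel) measurable
  have q_eq: "q \<omega> = (h \<omega> - \<beta> * c \<omega> * a) / (1 - \<beta> * c \<omega>)" for \<omega>
    by (simp add: q_def residual_def h_def c_def a_def)
  have q_before: "q \<in> borel_measurable (before k)"
    unfolding q_eq[abs_def] using h_before c_before by measurable
  have q_bound: "\<bar>q \<omega>\<bar> \<le> 1 / (1 - \<beta>)" if "\<omega> \<in> space \<Omega>" for \<omega>
    unfolding q_def by (rule abs_residual_le[OF that])
  note [measurable] = measurable_from_subalg[OF subalgebra_before g_before]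
    measurable_from_subalg[OF subalgebra_before c_before]
    measurable_from_subalg[OF subalgebra_before h_before]
    measurable_from_subalg[OF subalgebra_before q_before]
  have Y_meas[measurable]: "Y \<in> borel_measurable \<Omega>"
    unfolding Y_def[abs_def] by measurable
  have in_after: "f \<in> borel_measurable (after k)" if "f \<in> borel_measurable (before k)" for f :: "'w \<Rightarrow> real"
    using before_subset_after by (intro measurable_from_subalg[OF _ that])
      (simp add: subalgebra_def space_before space_after)
  have Y_after: "Y \<in> borel_measurable (after k)"
    unfolding Y_def[abs_def] by (rule measurable_compose[OF y_after]) simp_all
  have "measure \<Omega> (G \<inter> {\<omega> \<in> space \<Omega>. \<not> Z k \<omega> \<and> x (Suc k * m) \<omega> \<in> A})
      = (\<integral>\<omega>. indicator (G \<inter> {\<omega> \<in> space \<Omega>. \<not> Z k \<omega> \<and> x (Suc k * m) \<omega> \<in> A}) \<omega> \<partial>\<Omega>)"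
    using sets.sets_into_space[OF G'] by (simp add: Int_absorb2 Int_assoc)
  also have "\<dots> = (\<integral>\<omega>. (g \<omega> * (1 - c \<omega> * Y \<omega>)) * indicator A (x (Suc k * m) \<omega>) \<partial>\<Omega>)"
    by (intro Bochner_Integration.integral_cong)
       (auto simp: g_def c_def Y_def Z_def split: split_indicator)
  also have "\<dots> = (\<integral>\<omega>. (g \<omega> * (1 - c \<omega> * Y \<omega>)) * (if y (k * m) \<omega> then measure \<nu> A else residual k A \<omega>) \<partial>\<Omega>)"
  proof (rule integral_x[where B=1])
    show "(\<lambda>\<omega>. g \<omega> * (1 - c \<omega> * Y \<omega>)) \<in> borel_measurable (after k)"
      using in_after[OF g_before] in_after[OF c_before] Y_after by measurable
  qed (auto simp: g_def c_def Y_def split: split_indicator)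
  \<comment> \<open>The integrand is made affine in Y with coefficients known before y is drawn, as
    \<open>integral_y\<close> requires. For Y = 1 only the part off C remains, with \<nu>(A) as next
    law.\<close>
  also have "\<dots> = (\<integral>\<omega>. g \<omega> * q \<omega> + (g \<omega> * ((1 - c \<omega>) * a - q \<omega>)) * Y \<omega> \<partial>\<Omega>)"
    by (intro Bochner_Integration.integral_cong)
       (auto simp: Y_def a_def q_def algebra_simps c_def residual_def split: split_indicator)
  also have "\<dots> = (\<integral>\<omega>. g \<omega> * q \<omega> \<partial>\<Omega>) + (\<integral>\<omega>. (g \<omega> * ((1 - c \<omega>) * a - q \<omega>)) * Y \<omega> \<partial>\<Omega>)"
  proof (rule Bochner_Integration.integral_add)
    show "integrable \<Omega> (\<lambda>\<omega>. g \<omega> * q \<omega>)"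
      using q_bound \<beta>_less_1 by (intro \<Omega>.integrable_const_bound[where B="1 / (1 - \<beta>)"] AE_I2)
        (auto simp: g_def split: split_indicator)
    show "integrable \<Omega> (\<lambda>\<omega>. (g \<omega> * ((1 - c \<omega>) * a - q \<omega>)) * Y \<omega>)"
    proof (intro \<Omega>.integrable_const_bound[where B="1 + 1 / (1 - \<beta>)"] AE_I2)
      fix \<omega> assume \<omega>: "\<omega> \<in> space \<Omega>"
      have "\<bar>(1 - c \<omega>) * a - q \<omega>\<bar> \<le> 1 + 1 / (1 - \<beta>)"
        using q_bound[OF \<omega>] a c01[of \<omega>] by auto
      then show "norm ((g \<omega> * ((1 - c \<omega>) * a - q \<omega>)) * Y \<omega>) \<le> 1 + 1 / (1 - \<beta>)"
        using \<beta>_less_1 by (auto simp: g_def Y_def split: split_indicator)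
    qed measurable
  qed
  also have "(\<integral>\<omega>. (g \<omega> * ((1 - c \<omega>) * a - q \<omega>)) * Y \<omega> \<partial>\<Omega>)
      = (\<integral>\<omega>. (g \<omega> * ((1 - c \<omega>) * a - q \<omega>)) * (\<beta> * c \<omega>) \<partial>\<Omega>)"
    unfolding Y_def c_def
  proof (rule integral_y[where B="1 + 1 / (1 - \<beta>)"], unfold c_def[symmetric])
    show "(\<lambda>\<omega>. g \<omega> * ((1 - c \<omega>) * a - q \<omega>)) \<in> borel_measurable (before k)"
      using g_before c_before q_before by measurable
    fix \<omega> assume \<omega>: "\<omega> \<in> space \<Omega>"
    have "\<bar>(1 - c \<omega>) * a - q \<omega>\<bar> \<le> 1 + 1 / (1 - \<beta>)"
      using q_bound[OF \<omega>] a c01[of \<omega>] by auto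
    then show "\<bar>g \<omega> * ((1 - c \<omega>) * a - q \<omega>)\<bar> \<le> 1 + 1 / (1 - \<beta>)"
      using \<beta>_less_1 by (auto simp: g_def split: split_indicator)
  qed
  also have "(\<integral>\<omega>. g \<omega> * q \<omega> \<partial>\<Omega>) + \<dots>
      = (\<integral>\<omega>. g \<omega> * q \<omega> + (g \<omega> * ((1 - c \<omega>) * a - q \<omega>)) * (\<beta> * c \<omega>) \<partial>\<Omega>)"
  proof (rule Bochner_Integration.integral_add[symmetric])
    show "integrable \<Omega> (\<lambda>\<omega>. g \<omega> * q \<omega>)"
      using q_bound \<beta>_less_1 by (intro \<Omega>.integrable_const_bound[where B="1 / (1 - \<beta>)"] AE_I2)
        (auto simp: g_def split: split_indicator)
    show "integrable \<Omega> (\<lambda>\<omega>. (g \<omega> * ((1 - c \<omega>) * a - q \<omega>)) * (\<beta> * c \<omega>))"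
    proof (intro \<Omega>.integrable_const_bound[where B="(1 + 1 / (1 - \<beta>)) * 1"] AE_I2)
      fix \<omega> assume \<omega>: "\<omega> \<in> space \<Omega>"
      have 1: "\<bar>(1 - c \<omega>) * a - q \<omega>\<bar> \<le> 1 + 1 / (1 - \<beta>)"
        using q_bound[OF \<omega>] a c01[of \<omega>] by auto
      have "\<bar>((1 - c \<omega>) * a - q \<omega>) * (\<beta> * c \<omega>)\<bar> \<le> (1 + 1 / (1 - \<beta>)) * 1"
        unfolding abs_mult using 1 c01[of \<omega>] \<beta>_pos \<beta>_less_1 by (intro mult_mono) auto
      then show "norm ((g \<omega> * ((1 - c \<omega>) * a - q \<omega>)) * (\<beta> * c \<omega>)) \<le> (1 + 1 / (1 - \<beta>)) * 1"
        using \<beta>_less_1 g01[of \<omega>] by auto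
    qed measurable
  qed
  \<comment> \<open>Since c is 0 or 1, the product (1 - c) c removes the contribution of y = 1 off
    C, and what is left is q (1 - \<beta> c), where the denominator of q cancels.\<close>
  also have "\<dots> = (\<integral>\<omega>. g \<omega> * h \<omega> - \<beta> * a * (g \<omega> * c \<omega>) \<partial>\<Omega>)"
  proof (intro Bochner_Integration.integral_cong refl)
    fix \<omega>
    have "q \<omega> * (1 - \<beta> * c \<omega>) = h \<omega> - \<beta> * c \<omega> * a"
      unfolding q_eq using c01[of \<omega>] \<beta>_less_1 by auto
    then show "g \<omega> * q \<omega> + (g \<omega> * ((1 - c \<omega>) * a - q \<omega>)) * (\<beta> * c \<omega>) = g \<omega> * h \<omega> - \<beta> * a * (g \<omega> * c \<omega>)"
      using c01[of \<omega>] g01[of \<omega>] by (auto simp: algebra_simps)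
  qed
  also have "\<dots> = (\<integral>\<omega>. g \<omega> * h \<omega> \<partial>\<Omega>) - \<beta> * a * (\<integral>\<omega>. g \<omega> * c \<omega> \<partial>\<Omega>)"
  proof -
    have "h \<omega> \<le> 1" if "\<omega> \<in> space \<Omega>" for \<omega>
      unfolding h_def using prob_space.prob_le_1[OF kp_space[OF x_space[OF that]]] .
    then have 1: "integrable \<Omega> (\<lambda>\<omega>. g \<omega> * h \<omega>)"
      by (intro \<Omega>.integrable_const_bound[where B=1] AE_I2)
         (auto simp: g_def h_def split: split_indicator)
    have 2: "integrable \<Omega> (\<lambda>\<omega>. \<beta> * a * (g \<omega> * c \<omega>))"
      by (intro integrable_mult_right \<Omega>.integrable_const_bound[where B=1] AE_I2)
         (auto simp: g_def c_def split: split_indicator)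
    show ?thesis
      by (subst Bochner_Integration.integral_diff[OF 1 2]) simp
  qed
  also have "(\<integral>\<omega>. g \<omega> * c \<omega> \<partial>\<Omega>) = (\<integral>\<omega>. indicator (G \<inter> {\<omega> \<in> space \<Omega>. x (k * m) \<omega> \<in> C}) \<omega> \<partial>\<Omega>)"
    by (intro Bochner_Integration.integral_cong) (auto simp: g_def c_def split: split_indicator)
  also have "\<dots> = measure \<Omega> (G \<inter> {\<omega> \<in> space \<Omega>. x (k * m) \<omega> \<in> C})"
    using sets.sets_into_space[OF G'] by (simp add: Int_absorb2 Int_assoc)
  finally show ?thesis
    by (simp add: g_def h_def a_def)
qed

lemma measure_Z:
  assumes G: "G \<in> sets (before k)"
  shows "measure \<Omega> (G \<inter> {\<omega> \<in> space \<Omega>. Z k \<omega>}) = \<beta> * measure \<Omega> (G \<inter> {\<omega> \<in> space \<Omega>. x (k * m) \<omega> \<in> C})"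
proof -
  have G'[measurable]: "G \<in> sets \<Omega>" by (rule before_\<Omega>[OF G])
  let ?g = "\<lambda>\<omega>. indicator G \<omega> * indicator C (x (k * m) \<omega>) :: real"
  have c_before: "(\<lambda>\<omega>. indicator C (x (k * m) \<omega>) :: real) \<in> borel_measurable (before k)"
    by (rule x_before_borel) measurable
  have "measure \<Omega> (G \<inter> {\<omega> \<in> space \<Omega>. Z k \<omega>}) = (\<integral>\<omega>. indicator (G \<inter> {\<omega> \<in> space \<Omega>. Z k \<omega>}) \<omega> \<partial>\<Omega>)"
    using sets.sets_into_space[OF G'] by (simp add: Int_absorb2 Int_assoc)
  also have "\<dots> = (\<integral>\<omega>. ?g \<omega> * of_bool (y (k * m) \<omega>) \<partial>\<Omega>)"
    by (intro Bochner_Integration.integral_cong) (auto simp: Z_def split: split_indicator)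
  also have "\<dots> = (\<integral>\<omega>. ?g \<omega> * (\<beta> * indicator C (x (k * m) \<omega>)) \<partial>\<Omega>)"
    by (rule integral_y[where B=1]) (use G c_before in \<open>auto split: split_indicator\<close>)
  also have "\<dots> = (\<integral>\<omega>. \<beta> * indicator (G \<inter> {\<omega> \<in> space \<Omega>. x (k * m) \<omega> \<in> C}) \<omega> \<partial>\<Omega>)"
    by (intro Bochner_Integration.integral_cong) (auto split: split_indicator)
  also have "\<dots> = \<beta> * measure \<Omega> (G \<inter> {\<omega> \<in> space \<Omega>. x (k * m) \<omega> \<in> C})"
    using sets.sets_into_space[OF G'] by (simp add: Int_absorb2 Int_assoc)
  finally show ?thesis .
qed

text \<open>On a visit the law of the next skeleton state is \<nu> whatever the past, so it factors
  out for every past event contained in the visit.\<close>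

lemma measure_regeneration:
  assumes G: "G \<in> sets (after k)" and sub: "\<And>\<omega>. \<omega> \<in> G \<Longrightarrow> Z k \<omega>" and A[measurable]: "A \<in> sets X"
  shows "measure \<Omega> (G \<inter> {\<omega> \<in> space \<Omega>. x (Suc k * m) \<omega> \<in> A}) = measure \<Omega> G * measure \<nu> A"
proof -
  have G'[measurable]: "G \<in> sets \<Omega>" by (rule after_\<Omega>[OF G])
  have "measure \<Omega> (G \<inter> {\<omega> \<in> space \<Omega>. x (Suc k * m) \<omega> \<in> A})
      = (\<integral>\<omega>. indicator (G \<inter> {\<omega> \<in> space \<Omega>. x (Suc k * m) \<omega> \<in> A}) \<omega> \<partial>\<Omega>)"
    using sets.sets_into_space[OF G'] by (simp add: Int_absorb2 Int_assoc)
  also have "\<dots> = (\<integral>\<omega>. indicator G \<omega> * indicator A (x (Suc k * m) \<omega>) \<partial>\<Omega>)"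
    by (intro Bochner_Integration.integral_cong) (auto split: split_indicator)
  also have "\<dots> = (\<integral>\<omega>. indicator G \<omega> * (if y (k * m) \<omega> then measure \<nu> A else residual k A \<omega>) \<partial>\<Omega>)"
    by (rule integral_x[where B=1]) (use G in \<open>auto split: split_indicator\<close>)
  also have "\<dots> = (\<integral>\<omega>. indicator G \<omega> * measure \<nu> A \<partial>\<Omega>)"
    by (intro Bochner_Integration.integral_cong) (auto simp: Z_def dest: sub split: split_indicator)
  also have "\<dots> = measure \<Omega> G * measure \<nu> A"
    using sets.sets_into_space[OF G'] by (simp add: Int_absorb2)
  finally show ?thesis .
qed

text \<open>The law of x n restricted to E, of total mass P(E). Leaving it unnormalized makes it
  additive in E and meaningful for null E.\<close>

definition law :: "'w set \<Rightarrow> nat \<Rightarrow> 'a measure" where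
  "law E n = distr (density \<Omega> (indicator E)) X (x n)"

lemma sets_law: "sets (law E n) = sets X"
  by (simp add: law_def)

lemma nn_integral_law:
  assumes [measurable]: "E \<in> sets \<Omega>" "f \<in> borel_measurable X"
  shows "(\<integral>\<^sup>+z. f z \<partial>law E n) = (\<integral>\<^sup>+\<omega>. indicator E \<omega> * f (x n \<omega>) \<partial>\<Omega>)"
  unfolding law_def by (subst nn_integral_distr) (simp_all add: nn_integral_density)

lemma emeasure_law:
  assumes [measurable]: "E \<in> sets \<Omega>" "A \<in> sets X"
  shows "emeasure (law E n) A = ennreal (measure \<Omega> (E \<inter> {\<omega> \<in> space \<Omega>. x n \<omega> \<in> A}))"
proof -
  have "emeasure (law E n) A = (\<integral>\<^sup>+z. indicator A z \<partial>law E n)"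
    by (simp add: sets_law)
  also have "\<dots> = (\<integral>\<^sup>+\<omega>. indicator E \<omega> * indicator A (x n \<omega>) \<partial>\<Omega>)"
    by (rule nn_integral_law) measurable
  also have "\<dots> = (\<integral>\<^sup>+\<omega>. indicator (E \<inter> {\<omega> \<in> space \<Omega>. x n \<omega> \<in> A}) \<omega> \<partial>\<Omega>)"
    by (intro nn_integral_cong) (auto split: split_indicator)
  finally show ?thesis
    by (simp add: \<Omega>.emeasure_eq_measure)
qed

lemma measure_law:
  assumes "E \<in> sets \<Omega>" "A \<in> sets X"
  shows "measure (law E n) A = measure \<Omega> (E \<inter> {\<omega> \<in> space \<Omega>. x n \<omega> \<in> A})"
  using emeasure_law[OF assms] by (simp add: measure_def)

lemma measure_law_space:
  assumes E: "E \<in> sets \<Omega>" shows "measure (law E n) (space X) = measure \<Omega> E"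
proof -
  have "E \<inter> {\<omega> \<in> space \<Omega>. x n \<omega> \<in> space X} = E"
    using sets.sets_into_space[OF E] x_space by auto
  then show ?thesis
    using measure_law[OF E sets.top, of n] by simp
qed

lemma finite_law: "E \<in> sets \<Omega> \<Longrightarrow> finite_measure (law E n)"
  using emeasure_law[of E "space X" n] sets_eq_imp_space_eq[OF sets_law, of E n]
  by (intro finite_measureI) simp

definition quiet :: "'w set \<Rightarrow> nat \<Rightarrow> nat \<Rightarrow> 'w set" where
  "quiet G k j = G \<inter> {\<omega> \<in> space \<Omega>. \<forall>i<j. \<not> Z (k + i) \<omega>}"

lemma quiet_0: "G \<in> sets \<Omega> \<Longrightarrow> quiet G k 0 = G"
  using sets.sets_into_space[of G \<Omega>] by (auto simp: quiet_def)

lemma quiet_Suc: "quiet G k (Suc j) = quiet G k j \<inter> {\<omega> \<in> space \<Omega>. \<not> Z (k + j) \<omega>}"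
  by (auto simp: quiet_def less_Suc_eq)

lemma quiet_before:
  assumes G: "G \<in> sets (before k)"
  shows "quiet G k j \<in> sets (before (k + j))"
proof (induction j)
  case 0
  then show ?case using G quiet_0[OF before_\<Omega>[OF G]] by simp
next
  case (Suc j)
  have [measurable]: "Z (k + j) \<in> after (k + j) \<rightarrow>\<^sub>M count_space UNIV"
    by (rule Z_after) simp
  have "{\<omega> \<in> space (after (k + j)). \<not> Z (k + j) \<omega>} \<in> sets (after (k + j))"
    by measurable
  then have "quiet G k (Suc j) \<in> sets (after (k + j))"
    unfolding quiet_Suc using Suc before_subset_after[of "k + j"] by (auto simp: space_after)
  then show ?case
    using after_subset_before_Suc[of "k + j"] by auto
qed

lemma quiet_\<Omega>: "G \<in> sets (before k) \<Longrightarrow> quiet G k j \<in> sets \<Omega>"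
  by (rule before_\<Omega>[OF quiet_before])

text \<open>Applying \<open>measure_not_Z_step\<close> to the past event \<open>quiet G k j\<close>
  gives the flow equation on sets. Restricting to no visit at the next block is the killing, and G
  may be any event of the past of block k.\<close>

lemma quiet_flow:
  assumes G: "G \<in> sets (before k)"
  shows "killed_flow (\<lambda>j. law (quiet G k j) ((k + j) * m))"
  unfolding killed_flow_def
proof (intro conjI allI impI)
  fix j
  show "sets (law (quiet G k j) ((k + j) * m)) = sets X" by (rule sets_law)
  show "finite_measure (law (quiet G k j) ((k + j) * m))" by (rule finite_law[OF quiet_\<Omega>[OF G]])
  fix f :: "'a \<Rightarrow> ennreal" assume f: "f \<in> borel_measurable X"
  note Q = quiet_\<Omega>[OF G] quiet_before[OF G]
  show "(\<integral>\<^sup>+z. f z \<partial>law (quiet G k (Suc j)) ((k + Suc j) * m))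
      + ennreal \<beta> * emeasure (law (quiet G k j) ((k + j) * m)) C * (\<integral>\<^sup>+z. f z \<partial>\<nu>)
    = (\<integral>\<^sup>+u. (\<integral>\<^sup>+z. f z \<partial>kp m u) \<partial>law (quiet G k j) ((k + j) * m))"
  proof (rule nn_integral_eqI_kernel[OF sets_law sets_\<nu> sets_law kp_subprob _ f])
    fix A assume A[measurable]: "A \<in> sets X"
    let ?n = "k + j"
    have "(\<integral>\<^sup>+u. emeasure (kp m u) A \<partial>law (quiet G k j) (?n * m))
        = (\<integral>\<^sup>+\<omega>. indicator (quiet G k j) \<omega> * emeasure (kp m (x (?n * m) \<omega>)) A \<partial>\<Omega>)"
      by (rule nn_integral_law[OF Q(1)]) measurable
    also have "\<dots> = (\<integral>\<^sup>+\<omega>. ennreal (indicator (quiet G k j) \<omega> * measure (kp m (x (?n * m) \<omega>)) A) \<partial>\<Omega>)"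
    proof (rule nn_integral_cong)
      fix \<omega> assume "\<omega> \<in> space \<Omega>"
      then interpret K: prob_space "kp m (x (?n * m) \<omega>)" by (intro kp_space x_space)
      show "indicator (quiet G k j) \<omega> * emeasure (kp m (x (?n * m) \<omega>)) A
          = ennreal (indicator (quiet G k j) \<omega> * measure (kp m (x (?n * m) \<omega>)) A)"
        by (simp add: K.emeasure_eq_measure split: split_indicator)
    qed
    also have "\<dots> = ennreal (\<integral>\<omega>. indicator (quiet G k j) \<omega> * measure (kp m (x (?n * m) \<omega>)) A \<partial>\<Omega>)"
    proof (rule nn_integral_eq_integral)
      note [measurable] = Q(1)
      show "integrable \<Omega> (\<lambda>\<omega>. indicator (quiet G k j) \<omega> * measure (kp m (x (?n * m) \<omega>)) A)"
      proof (intro \<Omega>.integrable_const_bound[where B=1] AE_I2)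
        fix \<omega> assume "\<omega> \<in> space \<Omega>"
        then interpret K: prob_space "kp m (x (?n * m) \<omega>)" by (intro kp_space x_space)
        show "norm (indicator (quiet G k j) \<omega> * measure (kp m (x (?n * m) \<omega>)) A) \<le> 1"
          by (simp split: split_indicator)
      qed measurable
    qed simp
    also have "\<dots> = ennreal (measure \<Omega> (quiet G k j \<inter> {\<omega> \<in> space \<Omega>. \<not> Z ?n \<omega> \<and> x (Suc ?n * m) \<omega> \<in> A})
        + \<beta> * measure \<Omega> (quiet G k j \<inter> {\<omega> \<in> space \<Omega>. x (?n * m) \<omega> \<in> C}) * measure \<nu> A)"
      using measure_not_Z_step[OF Q(2) A] by simp
    also have "quiet G k j \<inter> {\<omega> \<in> space \<Omega>. \<not> Z ?n \<omega> \<and> x (Suc ?n * m) \<omega> \<in> A}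
        = quiet G k (Suc j) \<inter> {\<omega> \<in> space \<Omega>. x (Suc ?n * m) \<omega> \<in> A}"
      by (auto simp: quiet_Suc)
    finally show "emeasure (law (quiet G k (Suc j)) ((k + Suc j) * m)) A
        + ennreal \<beta> * emeasure (law (quiet G k j) (?n * m)) C * emeasure \<nu> A
      = (\<integral>\<^sup>+u. emeasure (kp m u) A \<partial>law (quiet G k j) (?n * m))"
      using \<beta>_pos by (simp add: emeasure_law Q \<nu>.emeasure_eq_measure ennreal_mult)
  qed
qed

lemma measure_quiet_Z:
  assumes G: "G \<in> sets (before k)"
  shows "measure \<Omega> (quiet G k j \<inter> {\<omega> \<in> space \<Omega>. Z (k + j) \<omega>}) = \<beta> * measure (law (quiet G k j) ((k + j) * m)) C"
  using measure_Z[OF quiet_before[OF G]] by (simp add: measure_law quiet_\<Omega>[OF G])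

text \<open>Supplies the initial condition of \<open>flow_C_proportional\<close>: after a visit at
  block k the flow starts at block k + 1 from a multiple of \<nu>.\<close>

lemma regeneration_law:
  fixes f :: "'a \<Rightarrow> ennreal"
  assumes G: "G \<in> sets (after k)" and sub: "\<And>\<omega>. \<omega> \<in> G \<Longrightarrow> Z k \<omega>" and f: "f \<in> borel_measurable X"
  shows "(\<integral>\<^sup>+z. f z \<partial>law (quiet G (Suc k) 0) ((Suc k + 0) * m)) = ennreal (measure \<Omega> G) * (\<integral>\<^sup>+z. f z \<partial>\<nu>)"
proof -
  have "law G (Suc k * m) = scale_measure (ennreal (measure \<Omega> G)) \<nu>"
  proof (rule measure_eqI)
    fix A assume "A \<in> sets (law G (Suc k * m))"
    then have A: "A \<in> sets X" by (simp add: sets_law)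
    show "emeasure (law G (Suc k * m)) A = emeasure (scale_measure (ennreal (measure \<Omega> G)) \<nu>) A"
      using measure_regeneration[OF G sub A]
      by (simp add: emeasure_law[OF after_\<Omega>[OF G] A] \<nu>.emeasure_eq_measure ennreal_mult)
  qed (simp add: sets_law sets_\<nu>)
  then show ?thesis
    using f by (simp add: quiet_0[OF after_\<Omega>[OF G]] nn_integral_scale_measure)
qed

end

section \<open>Independence and tails of the cycle lengths\<close>

locale split_drift = drift_kernel X P C m \<beta> \<nu> \<psi> V lam b0 C0 + split_process X P C m \<beta> \<nu> \<Omega> x y
  for X :: "'a measure" and P C m \<beta> \<nu> \<psi> V lam b0 C0 and \<Omega> :: "'w measure" and x y +
  assumes V_init: "(\<integral>\<^sup>+\<omega>. ennreal (V (x 0 \<omega>)) \<partial>\<Omega>) < \<infinity>"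
begin

lemma quiet_initial_decay:
  "\<exists>b>0. \<exists>\<rho>. 0 < \<rho> \<and> \<rho> < 1 \<and> (\<forall>j. measure \<Omega> (quiet (space \<Omega>) 0 j) \<le> b * \<rho> ^ j)"
proof -
  have G: "space \<Omega> \<in> sets (before 0)"
    using sets.top[of "before 0"] by (simp add: space_before)
  have "(\<integral>\<^sup>+z. ennreal (V z) \<partial>law (quiet (space \<Omega>) 0 0) ((0 + 0) * m)) \<le> (\<integral>\<^sup>+\<omega>. ennreal (V (x 0 \<omega>)) \<partial>\<Omega>)"
    by (subst nn_integral_law[OF quiet_\<Omega>[OF G]])
       (auto intro!: nn_integral_mono split: split_indicator)
  also note V_init
  finally show ?thesis
    using flow_decay[OF quiet_flow[OF G]]
    by (simp add: measure_law_space quiet_\<Omega>[OF G])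
qed

text \<open>Here \<pi> j is the probability of a next cycle of length j + 1 given G. That one \<pi>
  works for all k and all past events G expresses both independence of the past and equality in law;
  the product form covers null G.\<close>

definition regenerates_with :: "(nat \<Rightarrow> real) \<Rightarrow> real \<Rightarrow> real \<Rightarrow> bool" where
  "regenerates_with \<pi> b \<rho> \<longleftrightarrow> 0 < b \<and> 0 < \<rho> \<and> \<rho> < 1 \<and>
    (\<forall>k G. G \<in> sets (after k) \<longrightarrow> (\<forall>\<omega>\<in>G. Z k \<omega>) \<longrightarrow> (\<forall>j.
      measure \<Omega> (quiet G (Suc k) j \<inter> {\<omega> \<in> space \<Omega>. Z (Suc k + j) \<omega>}) = measure \<Omega> G * \<pi> j \<and>
      measure \<Omega> (quiet G (Suc k) j) \<le> measure \<Omega> G * (b * \<rho> ^ j)))"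

text \<open>One reference event G' of positive probability determines \<pi>, b and \<rho>;
  proportionality of the flows carries them over to every other past event.\<close>

lemma regenerates_with_exists: "\<exists>\<pi> b \<rho>. regenerates_with \<pi> b \<rho>"
proof (cases "\<exists>k G. G \<in> sets (after k) \<and> (\<forall>\<omega>\<in>G. Z k \<omega>) \<and> measure \<Omega> G > 0")
  \<comment> \<open>If no visit has positive probability, all quantities in question vanish and any
    admissible constants serve.\<close>
  case False
  have zero: "measure \<Omega> (quiet G (Suc k) j \<inter> {\<omega> \<in> space \<Omega>. Z (Suc k + j) \<omega>}) = 0"
    "measure \<Omega> (quiet G (Suc k) j) = 0"
    if G: "G \<in> sets (after k)" "\<forall>\<omega>\<in>G. Z k \<omega>" for k G j
  proof -
    have "measure \<Omega> G = 0"
      using False G zero_less_measure_iff[of \<Omega> G] by blast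
    then have null: "measure \<Omega> E = 0" if "E \<subseteq> G" for E
      using \<Omega>.finite_measure_mono[OF that after_\<Omega>[OF G(1)]] by (simp add: measure_le_0_iff)
    show "measure \<Omega> (quiet G (Suc k) j \<inter> {\<omega> \<in> space \<Omega>. Z (Suc k + j) \<omega>}) = 0"
      "measure \<Omega> (quiet G (Suc k) j) = 0"
      by (rule null, use quiet_def in blast)+
  qed
  show ?thesis
    unfolding regenerates_with_def
    by (rule exI[of _ "\<lambda>_. 0"], rule exI[of _ 1], rule exI[of _ "1 / 2"]) (simp add: zero[unfolded add_Suc])
next
  case True
  then obtain k' G' where G': "G' \<in> sets (after k')" "\<And>\<omega>. \<omega> \<in> G' \<Longrightarrow> Z k' \<omega>" and pos: "measure \<Omega> G' > 0"
    by (elim exE conjE) blast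
  define \<mu> where "\<mu> G k j = law (quiet G (Suc k) j) ((Suc k + j) * m)" for G k j
  have in_before: "G \<in> sets (before (Suc k))" if "G \<in> sets (after k)" for G k
    using that after_subset_before_Suc[of k] by auto
  have flow: "killed_flow (\<mu> G k)" if "G \<in> sets (after k)" for G k
    unfolding \<mu>_def[abs_def] by (rule quiet_flow[OF in_before[OF that]])
  have init: "(\<integral>\<^sup>+z. f z \<partial>\<mu> G k 0) = ennreal (measure \<Omega> G) * (\<integral>\<^sup>+z. f z \<partial>\<nu>)"
    if "G \<in> sets (after k)" "\<And>\<omega>. \<omega> \<in> G \<Longrightarrow> Z k \<omega>" "f \<in> borel_measurable X" for G k and f :: "'a \<Rightarrow> ennreal"
    unfolding \<mu>_def by (rule regeneration_law[OF that])
  have mass: "measure (\<mu> G k j) (space X) = measure \<Omega> (quiet G (Suc k) j)" if "G \<in> sets (after k)" for G k j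
    unfolding \<mu>_def by (rule measure_law_space[OF quiet_\<Omega>[OF in_before[OF that]]])
  have ratio: "measure (\<mu> G k j) C * measure \<Omega> G' = measure (\<mu> G' k' j) C * measure \<Omega> G"
    if G: "G \<in> sets (after k)" "\<And>\<omega>. \<omega> \<in> G \<Longrightarrow> Z k \<omega>" for G k j
    by (rule flow_C_proportional[OF flow[OF G(1)] flow[OF G'(1)]]) (auto intro!: init G G')
  have "(\<integral>\<^sup>+z. ennreal (V z) \<partial>\<mu> G' k' 0) < \<infinity>"
    using nu_V_finite by (subst init[OF G']) (auto simp: ennreal_mult_less_top)
  from flow_decay[OF flow[OF G'(1)] this] obtain b \<rho> where b: "0 < b" and \<rho>: "0 < \<rho>" "\<rho> < 1"
    and decay: "\<And>j. measure (\<mu> G' k' j) (space X) \<le> b * \<rho> ^ j"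
    by (elim exE conjE) blast
  define p where "p = measure \<Omega> G'"
  define \<pi> where "\<pi> j = \<beta> * measure (\<mu> G' k' j) C / p" for j
  show ?thesis
    unfolding regenerates_with_def
  proof (rule exI[of _ \<pi>], rule exI[of _ "b / p"], rule exI[of _ \<rho>], intro conjI allI impI)
    fix k G j assume G: "G \<in> sets (after k)" and sub: "\<forall>\<omega>\<in>G. Z k \<omega>"
    have C_eq: "measure (\<mu> G k i) C = measure (\<mu> G' k' i) C * measure \<Omega> G / p" for i
      using ratio[OF G, of i] sub pos by (simp add: p_def field_simps)
    show "measure \<Omega> (quiet G (Suc k) j \<inter> {\<omega> \<in> space \<Omega>. Z (Suc k + j) \<omega>}) = measure \<Omega> G * \<pi> j"
      unfolding measure_quiet_Z[OF in_before[OF G]] \<mu>_def[symmetric] C_eq by (simp add: \<pi>_def)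
    \<comment> \<open>By \<open>flow_mass_sum\<close> the total mass is the initial mass minus
      \<beta> times the masses on C, so proportionality on C implies it for the whole space.\<close>
    have "measure (\<mu> G k j) (space X) = measure (\<mu> G' k' j) (space X) * measure \<Omega> G / p"
    proof -
      have "measure (\<mu> G k j) (space X) = measure \<Omega> G - \<beta> * (\<Sum>i<j. measure (\<mu> G k i) C)"
        using flow_mass_sum[OF flow[OF G], of 0 j] mass[OF G, of 0] quiet_0[OF after_\<Omega>[OF G]] by simp
      also have "\<dots> = (p - \<beta> * (\<Sum>i<j. measure (\<mu> G' k' i) C)) * (measure \<Omega> G / p)"
      proof -
        have "measure \<Omega> G = p * (measure \<Omega> G / p)" using pos by (simp add: p_def)
        moreover have "(\<Sum>i<j. measure (\<mu> G k i) C) = (\<Sum>i<j. measure (\<mu> G' k' i) C) * (measure \<Omega> G / p)"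
          unfolding C_eq sum_distrib_right by simp
        ultimately show ?thesis by (simp only: left_diff_distrib mult.assoc)
      qed
      also have "p - \<beta> * (\<Sum>i<j. measure (\<mu> G' k' i) C) = measure (\<mu> G' k' j) (space X)"
        using flow_mass_sum[OF flow[OF G'(1)], of 0 j] mass[OF G'(1), of 0] quiet_0[OF after_\<Omega>[OF G'(1)]]
        by (simp add: p_def)
      finally show ?thesis by simp
    qed
    also have "\<dots> \<le> b * \<rho> ^ j * measure \<Omega> G / p"
      using decay[of j] pos by (intro divide_right_mono mult_right_mono) (auto simp: p_def)
    finally show "measure \<Omega> (quiet G (Suc k) j) \<le> measure \<Omega> G * (b / p * \<rho> ^ j)"
      by (simp add: mass[OF G] ac_simps)
  qed (use b \<rho> pos in \<open>auto simp: p_def\<close>)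
qed

definition bits :: "'w \<Rightarrow> nat \<Rightarrow> bool" where
  "bits \<omega> k = Z k \<omega>"

text \<open>A property of the visits up to k is a finite union of cylinders, one for each subset s
  of {0, ..., k} of visited blocks.\<close>

lemma determined_after:
  assumes "\<And>z z'. (\<And>j. j \<le> k \<Longrightarrow> z j = z' j) \<Longrightarrow> Q z \<Longrightarrow> Q z'"
  shows "{\<omega> \<in> space \<Omega>. Q (bits \<omega>)} \<in> sets (after k)"
proof -
  let ?E = "\<lambda>s. {\<omega> \<in> space (after k). \<forall>j\<in>{..k}. Z j \<omega> \<longleftrightarrow> j \<in> s}"
  have E: "?E s \<in> sets (after k)" for s
  proof (rule sets.sets_Collect_finite_All)
    fix j assume "j \<in> {..k}"
    then have [measurable]: "Z j \<in> after k \<rightarrow>\<^sub>M count_space UNIV" by (intro Z_after) simp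
    show "{\<omega> \<in> space (after k). Z j \<omega> \<longleftrightarrow> j \<in> s} \<in> sets (after k)" by measurable
  qed simp
  have "{\<omega> \<in> space \<Omega>. Q (bits \<omega>)} = (\<Union>s\<in>{s \<in> Pow {..k}. Q (\<lambda>j. j \<in> s)}. ?E s)"
  proof (intro equalityI subsetI)
    fix \<omega> assume \<omega>: "\<omega> \<in> {\<omega> \<in> space \<Omega>. Q (bits \<omega>)}"
    let ?s = "{j \<in> {..k}. Z j \<omega>}"
    have "Q (\<lambda>j. j \<in> ?s)"
      by (rule assms[of "bits \<omega>", rotated]) (use \<omega> in \<open>auto simp: bits_def\<close>)
    with \<omega> show "\<omega> \<in> (\<Union>s\<in>{s \<in> Pow {..k}. Q (\<lambda>j. j \<in> s)}. ?E s)"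
      by (intro UN_I[of ?s]) (auto simp: space_after)
  next
    fix \<omega> assume "\<omega> \<in> (\<Union>s\<in>{s \<in> Pow {..k}. Q (\<lambda>j. j \<in> s)}. ?E s)"
    then obtain s where s: "Q (\<lambda>j. j \<in> s)" "\<omega> \<in> ?E s" by blast
    then have "Q (bits \<omega>)"
      by (intro assms[OF _ s(1)]) (auto simp: bits_def)
    with s show "\<omega> \<in> {\<omega> \<in> space \<Omega>. Q (bits \<omega>)}" by (simp add: space_after)
  qed
  also have "\<dots> \<in> sets (after k)"
    by (intro sets.finite_UN E) simp
  finally show ?thesis .
qed

text \<open>Fixing the value k of the hit time turns the past of a random time into an event of
  \<open>after k\<close>, to which \<open>regenerates_with\<close> applies.\<close>

definition cycles_until :: "nat \<Rightarrow> (nat \<Rightarrow> enat set) \<Rightarrow> nat \<Rightarrow> 'w set" where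
  "cycles_until n A k = {\<omega> \<in> space \<Omega>. (\<forall>i\<le>n. gap (bits \<omega>) i \<in> A i) \<and> hit_time (bits \<omega>) n = enat k}"

lemma cycles_until_after: "cycles_until n A k \<in> sets (after k)"
  unfolding cycles_until_def
proof (rule determined_after)
  fix z z' assume eq: "\<And>j. j \<le> k \<Longrightarrow> z j = z' j"
    and z: "(\<forall>i\<le>n. gap z i \<in> A i) \<and> hit_time z n = enat k"
  have hit: "hit_time z n = enat k" using z ..
  show "(\<forall>i\<le>n. gap z' i \<in> A i) \<and> hit_time z' n = enat k"
    using gap_cong[OF hit eq] hit_time_cong[OF hit eq order_refl] z by auto
qed

lemma cycles_until_Z: "\<omega> \<in> cycles_until n A k \<Longrightarrow> Z k \<omega>"
  using hit_time_imp[of "bits \<omega>" n k] by (auto simp: cycles_until_def bits_def)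

section \<open>Measurability of hit times and gaps\<close>

lemma hit_time_measurable[measurable]: "(\<lambda>\<omega>. hit_time (bits \<omega>) n) \<in> \<Omega> \<rightarrow>\<^sub>M count_space UNIV"
proof (rule measurable_count_space_eq2_countable[THEN iffD2], intro conjI ballI)
  have fin: "{\<omega> \<in> space \<Omega>. hit_time (bits \<omega>) n = enat k} \<in> sets \<Omega>" for k
    using after_\<Omega>[OF cycles_until_after[of n "\<lambda>_. UNIV" k]] by (simp add: cycles_until_def)
  fix e :: enat
  show "(\<lambda>\<omega>. hit_time (bits \<omega>) n) -` {e} \<inter> space \<Omega> \<in> sets \<Omega>"
  proof (cases e)
    case (enat k)
    then show ?thesis using fin[of k] by (simp add: vimage_def Int_def conj_commute)
  next
    case infinity
    have "(\<lambda>\<omega>. hit_time (bits \<omega>) n) -` {\<infinity>} \<inter> space \<Omega>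
        = space \<Omega> - (\<Union>k. {\<omega> \<in> space \<Omega>. hit_time (bits \<omega>) n = enat k})"
      by (auto simp del: not_infinity_eq simp: not_infinity_eq[symmetric])
    then show ?thesis using fin infinity by auto
  qed
qed auto

lemma gap_measurable[measurable]: "(\<lambda>\<omega>. gap (bits \<omega>) n) \<in> \<Omega> \<rightarrow>\<^sub>M count_space UNIV"
proof (cases n)
  case 0
  have "(\<lambda>\<omega>. hit_time (bits \<omega>) 0 + 1) \<in> \<Omega> \<rightarrow>\<^sub>M count_space UNIV"
    by (rule measurable_compose[OF hit_time_measurable]) simp
  then show ?thesis unfolding 0 gap.simps .
next
  case (Suc i)
  have "(\<lambda>\<omega>. (hit_time (bits \<omega>) (Suc i) + 1) - (hit_time (bits \<omega>) i + 1)) \<in> \<Omega> \<rightarrow>\<^sub>M count_space UNIV"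
    by (rule measurable_compose_countable[where f="\<lambda>a \<omega>. a + 1 - (hit_time (bits \<omega>) i + 1)", OF _ hit_time_measurable])
       (rule measurable_compose[OF hit_time_measurable], simp)
  then show ?thesis unfolding Suc gap.simps .
qed

lemma gap_event[measurable]: "{\<omega> \<in> space \<Omega>. gap (bits \<omega>) n \<in> A} \<in> sets \<Omega>"
  by measurable

lemma cycles_event[measurable]: "{\<omega> \<in> space \<Omega>. \<forall>i\<le>n. gap (bits \<omega>) i \<in> A i} \<in> sets \<Omega>"
  by measurable

lemma cycles_until_\<Omega>[measurable]: "cycles_until n A k \<in> sets \<Omega>"
  by (rule after_\<Omega>[OF cycles_until_after])

context
  fixes \<pi> :: "nat \<Rightarrow> real" and b \<rho> :: real
  assumes rates: "regenerates_with \<pi> b \<rho>"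
begin

lemma rates_bounds: "0 < b" "0 < \<rho>" "\<rho> < 1"
  using rates by (simp_all add: regenerates_with_def)

lemma cycles_until_quiet:
  "measure \<Omega> (quiet (cycles_until n A k) (Suc k) j \<inter> {\<omega> \<in> space \<Omega>. Z (Suc k + j) \<omega>})
    = measure \<Omega> (cycles_until n A k) * \<pi> j"
  "measure \<Omega> (quiet (cycles_until n A k) (Suc k) j) \<le> measure \<Omega> (cycles_until n A k) * (b * \<rho> ^ j)"
proof -
  have sub: "\<forall>\<omega>\<in>cycles_until n A k. Z k \<omega>"
    by (intro ballI) (rule cycles_until_Z)
  note R = rates[unfolded regenerates_with_def, THEN conjunct2, THEN conjunct2, THEN conjunct2,
      THEN spec, THEN spec, THEN mp, OF cycles_until_after, THEN mp, OF sub, THEN spec]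
  show "measure \<Omega> (quiet (cycles_until n A k) (Suc k) j \<inter> {\<omega> \<in> space \<Omega>. Z (Suc k + j) \<omega>})
      = measure \<Omega> (cycles_until n A k) * \<pi> j"
    by (rule R[THEN conjunct1])
  show "measure \<Omega> (quiet (cycles_until n A k) (Suc k) j) \<le> measure \<Omega> (cycles_until n A k) * (b * \<rho> ^ j)"
    by (rule R[THEN conjunct2])
qed

text \<open>If a visit never comes, all quiet events occur, and their probabilities tend to 0
  geometrically.\<close>

lemma hit_time_finite_AE: "AE \<omega> in \<Omega>. hit_time (bits \<omega>) n \<noteq> \<infinity>"
proof (induction n)
  case 0
  obtain c q where c: "c > 0" "0 < q" "q < 1" "\<forall>j. measure \<Omega> (quiet (space \<Omega>) 0 j) \<le> c * q ^ j"
    using quiet_initial_decay by (elim exE conjE) (rule that)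
  let ?E = "{\<omega> \<in> space \<Omega>. hit_time (bits \<omega>) 0 = \<infinity>}"
  have "measure \<Omega> ?E \<le> c * q ^ j" for j
  proof -
    have G: "space \<Omega> \<in> sets (before 0)"
      using sets.top[of "before 0"] by (simp add: space_before)
    have "measure \<Omega> ?E \<le> measure \<Omega> (quiet (space \<Omega>) 0 j)"
      by (intro \<Omega>.finite_measure_mono quiet_\<Omega>[OF G])
         (auto simp: quiet_def Inf_enat_eq_infinity_iff bits_def)
    with c(4)[rule_format, of j] show ?thesis by simp
  qed
  moreover have "(\<lambda>j. c * q ^ j) \<longlonglongrightarrow> c * 0"
    using c by (intro tendsto_intros LIMSEQ_power_zero) auto
  ultimately have "measure \<Omega> ?E \<le> c * 0"
    by (intro LIMSEQ_le_const[of "\<lambda>j. c * q ^ j"]) auto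
  then have "measure \<Omega> ?E = 0"
    by (simp add: measure_le_0_iff)
  then show ?case
    by (subst AE_iff_measurable[where N="?E"]) (simp_all add: \<Omega>.emeasure_eq_measure del: hit_time.simps)
next
  case (Suc n)
  have "AE \<omega> in \<Omega>. \<not> (hit_time (bits \<omega>) n = enat k \<and> hit_time (bits \<omega>) (Suc n) = \<infinity>)" for k
  proof -
    let ?E = "{\<omega> \<in> space \<Omega>. hit_time (bits \<omega>) n = enat k \<and> hit_time (bits \<omega>) (Suc n) = \<infinity>}"
    let ?G = "cycles_until n (\<lambda>_. UNIV) k"
    have [measurable]: "?E \<in> sets \<Omega>" by measurable
    have "measure \<Omega> ?E \<le> measure \<Omega> ?G * (b * \<rho> ^ j)" for j
    proof -
      have G: "?G \<in> sets (before (Suc k))"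
        using cycles_until_after after_subset_before_Suc by blast
      have "measure \<Omega> ?E \<le> measure \<Omega> (quiet ?G (Suc k) j)"
        by (intro \<Omega>.finite_measure_mono quiet_\<Omega>[OF G])
           (auto simp: quiet_def Inf_enat_eq_infinity_iff bits_def cycles_until_def)
      also note cycles_until_quiet(2)
      finally show ?thesis .
    qed
    moreover have "(\<lambda>j. measure \<Omega> ?G * (b * \<rho> ^ j)) \<longlonglongrightarrow> measure \<Omega> ?G * (b * 0)"
      using rates_bounds by (intro tendsto_intros LIMSEQ_power_zero) auto
    ultimately have "measure \<Omega> ?E \<le> measure \<Omega> ?G * (b * 0)"
      by (intro LIMSEQ_le_const[of "\<lambda>j. measure \<Omega> ?G * (b * \<rho> ^ j)"]) auto
    then have "measure \<Omega> ?E = 0"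
      by (simp add: measure_le_0_iff del: hit_time.simps)
    then show ?thesis
      by (subst AE_iff_measurable[where N="?E"]) (simp_all add: \<Omega>.emeasure_eq_measure del: hit_time.simps)
  qed
  then have "AE \<omega> in \<Omega>. \<forall>k. \<not> (hit_time (bits \<omega>) n = enat k \<and> hit_time (bits \<omega>) (Suc n) = \<infinity>)"
    unfolding AE_all_countable by blast
  with Suc show ?case
    by eventually_elim (auto simp del: hit_time.simps)
qed

lemma AE_hit_time_cases:
  "AE \<omega> in \<Omega>. \<exists>k. hit_time (bits \<omega>) n = enat k"
  using hit_time_finite_AE[of n] by eventually_elim (simp del: hit_time.simps)

lemma measure_split_hit_time:
  assumes [measurable]: "E \<in> sets \<Omega>"
  shows "(\<lambda>k. measure \<Omega> (E \<inter> {\<omega> \<in> space \<Omega>. hit_time (bits \<omega>) n = enat k})) sums measure \<Omega> E"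
proof -
  let ?F = "\<lambda>k. E \<inter> {\<omega> \<in> space \<Omega>. hit_time (bits \<omega>) n = enat k}"
  have "(\<lambda>k. measure \<Omega> (?F k)) sums measure \<Omega> (\<Union>k. ?F k)"
    by (rule \<Omega>.finite_measure_UNION) (auto simp: disjoint_family_on_def simp del: hit_time.simps)
  also have "measure \<Omega> (\<Union>k. ?F k) = measure \<Omega> E"
  proof (rule \<Omega>.finite_measure_eq_AE)
    show "AE \<omega> in \<Omega>. \<omega> \<in> (\<Union>k. ?F k) \<longleftrightarrow> \<omega> \<in> E"
      using AE_hit_time_cases[of n] AE_space by eventually_elim (auto simp del: hit_time.simps)
  qed measurable
  finally show ?thesis .
qed

text \<open>The common law of the cycle lengths after the first, with \<pi> j as the mass of j + 1
  and no mass at 0 or infinity.\<close>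

definition gap_prob :: "enat set \<Rightarrow> real" where
  "gap_prob B = (\<Sum>j. if enat (Suc j) \<in> B then \<pi> j else 0)"

text \<open>Sum over the values j + 1 of the gap, each handled by \<open>gap_Suc_eq_iff\<close>.
  Length 0 cannot occur and length infinity is null.\<close>

lemma measure_cycles_until_gap:
  "measure \<Omega> (cycles_until n A k \<inter> {\<omega> \<in> space \<Omega>. gap (bits \<omega>) (Suc n) \<in> B})
    = measure \<Omega> (cycles_until n A k) * gap_prob B"
proof -
  define f where "f j = (if enat (Suc j) \<in> B then \<pi> j else 0)" for j
  let ?G = "cycles_until n A k"
  let ?E = "?G \<inter> {\<omega> \<in> space \<Omega>. gap (bits \<omega>) (Suc n) \<in> B}"
  let ?F = "\<lambda>j. if enat (Suc j) \<in> B then ?G \<inter> {\<omega> \<in> space \<Omega>. gap (bits \<omega>) (Suc n) = enat (Suc j)} else {}"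
  have F_eq: "?G \<inter> {\<omega> \<in> space \<Omega>. gap (bits \<omega>) (Suc n) = enat (Suc j)}
      = quiet ?G (Suc k) j \<inter> {\<omega> \<in> space \<Omega>. Z (Suc k + j) \<omega>}" for j
    using gap_Suc_eq_iff[of "bits _" n k j]
    by (auto simp: quiet_def cycles_until_def bits_def simp del: hit_time.simps gap.simps)
  have F_meas: "?F j \<in> sets \<Omega>" for j
    by (cases "enat (Suc j) \<in> B") (simp_all del: gap.simps)
  have "measure \<Omega> (?F j) = measure \<Omega> ?G * f j" for j
    using cycles_until_quiet(1)[of n A k j] by (simp only: F_eq f_def split: if_split) simp
  moreover have "(\<lambda>j. measure \<Omega> (?F j)) sums measure \<Omega> (\<Union>j. ?F j)"
    using F_meas by (intro \<Omega>.finite_measure_UNION)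
      (auto simp: disjoint_family_on_def simp del: gap.simps split: if_splits)
  moreover have "measure \<Omega> (\<Union>j. ?F j) = measure \<Omega> ?E"
  proof (rule \<Omega>.finite_measure_eq_AE)
    show "AE \<omega> in \<Omega>. \<omega> \<in> (\<Union>j. ?F j) \<longleftrightarrow> \<omega> \<in> ?E"
      using hit_time_finite_AE[of "Suc n"]
    proof eventually_elim
      case (elim \<omega>)
      show ?case
      proof (cases "\<omega> \<in> ?G")
        case True
        then have hit: "hit_time (bits \<omega>) n = enat k" by (simp add: cycles_until_def)
        obtain l where l: "hit_time (bits \<omega>) (Suc n) = enat l"
          using elim by (cases "hit_time (bits \<omega>) (Suc n)") simp_all
        have "gap (bits \<omega>) (Suc n) = enat (l - k)"
          unfolding gap.simps hit l by (simp add: one_enat_def)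
        moreover have "l - k \<noteq> 0"
          using gap_Suc_pos[OF hit] unfolding calculation by (auto simp: zero_enat_def)
        ultimately obtain j where "gap (bits \<omega>) (Suc n) = enat (Suc j)"
          by (cases "l - k") auto
        then show ?thesis by (auto simp del: gap.simps split: if_splits)
      qed (auto simp del: gap.simps split: if_splits)
    qed
    show "(\<Union>j. ?F j) \<in> sets \<Omega>" using F_meas by (intro sets.countable_UN image_subsetI)
  qed measurable
  ultimately have sums: "(\<lambda>j. measure \<Omega> ?G * f j) sums measure \<Omega> ?E" by simp
  have "measure \<Omega> ?E = measure \<Omega> ?G * suminf f"
  \<comment> \<open>Convergence of the series for \<open>gap_prob B\<close> follows from
    \<open>sums\<close> only when the factor is nonzero; otherwise both sides are 0.\<close>
  proof (cases "measure \<Omega> ?G = 0")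
    case True
    with sums have "(\<lambda>_. 0) sums measure \<Omega> ?E" by simp
    with True show ?thesis using sums_unique2[OF sums_zero] by fastforce
  next
    case False
    with sums_mult_D[OF sums] have "suminf f = measure \<Omega> ?E / measure \<Omega> ?G"
      by (simp add: sums_iff)
    with False show ?thesis by simp
  qed
  then show ?thesis by (simp add: gap_prob_def f_def[abs_def])
qed

lemma measure_cycles_until_gap_gt:
  "measure \<Omega> (cycles_until n A k \<inter> {\<omega> \<in> space \<Omega>. gap (bits \<omega>) (Suc n) > enat l})
    \<le> measure \<Omega> (cycles_until n A k) * (b * \<rho> ^ l)"
proof -
  let ?G = "cycles_until n A k"
  have G: "?G \<in> sets (before (Suc k))"
    using cycles_until_after after_subset_before_Suc by blast
  have "measure \<Omega> (?G \<inter> {\<omega> \<in> space \<Omega>. gap (bits \<omega>) (Suc n) > enat l}) \<le> measure \<Omega> (quiet ?G (Suc k) l)"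
    using gap_Suc_gt_imp[of "bits _" n k l]
    by (intro \<Omega>.finite_measure_mono quiet_\<Omega>[OF G])
       (auto simp: quiet_def bits_def cycles_until_def simp del: hit_time.simps gap.simps)
  also note cycles_until_quiet(2)
  finally show ?thesis .
qed

text \<open>The factor \<open>gap_prob B\<close> is the same for every value k of the hit time, so
  it comes out of the sum over k.\<close>

lemma measure_cycles_gap:
  "measure \<Omega> ({\<omega> \<in> space \<Omega>. \<forall>i\<le>n. gap (bits \<omega>) i \<in> A i} \<inter> {\<omega> \<in> space \<Omega>. gap (bits \<omega>) (Suc n) \<in> B})
    = measure \<Omega> {\<omega> \<in> space \<Omega>. \<forall>i\<le>n. gap (bits \<omega>) i \<in> A i} * gap_prob B"
proof -
  let ?E = "{\<omega> \<in> space \<Omega>. \<forall>i\<le>n. gap (bits \<omega>) i \<in> A i}"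
  let ?B = "{\<omega> \<in> space \<Omega>. gap (bits \<omega>) (Suc n) \<in> B}"
  have eq: "?E \<inter> {\<omega> \<in> space \<Omega>. hit_time (bits \<omega>) n = enat k} = cycles_until n A k"
    "(?E \<inter> ?B) \<inter> {\<omega> \<in> space \<Omega>. hit_time (bits \<omega>) n = enat k} = cycles_until n A k \<inter> ?B" for k
    by (auto simp: cycles_until_def)
  have "(\<lambda>k. measure \<Omega> (cycles_until n A k)) sums measure \<Omega> ?E"
    using measure_split_hit_time[OF cycles_event, of n A n] unfolding eq .
  then have "(\<lambda>k. measure \<Omega> (cycles_until n A k) * gap_prob B) sums (measure \<Omega> ?E * gap_prob B)"
    by (rule sums_mult2)
  moreover have "(\<lambda>k. measure \<Omega> (cycles_until n A k) * gap_prob B) sums measure \<Omega> (?E \<inter> ?B)"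
    using measure_split_hit_time[OF sets.Int[OF cycles_event[of n A] gap_event[of "Suc n" B]], of n]
    unfolding eq measure_cycles_until_gap .
  ultimately show ?thesis
    by (rule sums_unique2[symmetric])
qed

lemma measure_gap_Suc: "measure \<Omega> {\<omega> \<in> space \<Omega>. gap (bits \<omega>) (Suc n) \<in> B} = gap_prob B"
  using measure_cycles_gap[of n "\<lambda>_. UNIV" B] by (simp add: \<Omega>.prob_space Int_absorb1 Collect_mono_iff del: gap.simps)

lemma measure_gap_Suc_gt: "measure \<Omega> {\<omega> \<in> space \<Omega>. gap (bits \<omega>) (Suc n) > enat l} \<le> b * \<rho> ^ l"
proof -
  let ?E = "{\<omega> \<in> space \<Omega>. gap (bits \<omega>) (Suc n) > enat l}"
  have eq: "?E \<inter> {\<omega> \<in> space \<Omega>. hit_time (bits \<omega>) n = enat k} = cycles_until n (\<lambda>_. UNIV) k \<inter> ?E"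
    "space \<Omega> \<inter> {\<omega> \<in> space \<Omega>. hit_time (bits \<omega>) n = enat k} = cycles_until n (\<lambda>_. UNIV) k" for k
    by (auto simp: cycles_until_def)
  have E: "?E \<in> sets \<Omega>"
    using gap_event[of "Suc n" "{enat l<..}"] by (simp del: gap.simps)
  have 1: "(\<lambda>k. measure \<Omega> (cycles_until n (\<lambda>_. UNIV) k \<inter> ?E)) sums measure \<Omega> ?E"
    using measure_split_hit_time[OF E, of n] unfolding eq .
  have "(\<lambda>k. measure \<Omega> (cycles_until n (\<lambda>_. UNIV) k)) sums 1"
    using measure_split_hit_time[OF sets.top, of n] unfolding eq by (simp only: \<Omega>.prob_space)
  then have 2: "(\<lambda>k. measure \<Omega> (cycles_until n (\<lambda>_. UNIV) k) * (b * \<rho> ^ l)) sums (1 * (b * \<rho> ^ l))"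
    by (rule sums_mult2)
  show "measure \<Omega> ?E \<le> b * \<rho> ^ l"
    using sums_le[OF measure_cycles_until_gap_gt 1 2] by simp
qed

lemma measure_gaps_prod:
  "measure \<Omega> {\<omega> \<in> space \<Omega>. \<forall>i\<le>n. gap (bits \<omega>) i \<in> A i}
    = (\<Prod>i\<le>n. measure \<Omega> {\<omega> \<in> space \<Omega>. gap (bits \<omega>) i \<in> A i})"
proof (induction n)
  case (Suc n)
  have "{\<omega> \<in> space \<Omega>. \<forall>i\<le>Suc n. gap (bits \<omega>) i \<in> A i}
      = {\<omega> \<in> space \<Omega>. \<forall>i\<le>n. gap (bits \<omega>) i \<in> A i} \<inter> {\<omega> \<in> space \<Omega>. gap (bits \<omega>) (Suc n) \<in> A (Suc n)}"
    by (auto simp: le_Suc_eq simp del: gap.simps)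
  then show ?case
    by (simp add: measure_cycles_gap measure_gap_Suc Suc del: gap.simps)
qed (simp del: gap.simps)

end

lemma gap_0_tail:
  "\<exists>b>0. \<exists>\<rho>. 0 < \<rho> \<and> \<rho> < 1 \<and> (\<forall>l. measure \<Omega> {\<omega> \<in> space \<Omega>. gap (bits \<omega>) 0 > enat l} \<le> b * \<rho> ^ l)"
proof -
  have G: "space \<Omega> \<in> sets (before 0)"
    using sets.top[of "before 0"] by (simp add: space_before)
  have le: "measure \<Omega> {\<omega> \<in> space \<Omega>. gap (bits \<omega>) 0 > enat l} \<le> measure \<Omega> (quiet (space \<Omega>) 0 l)" for l
    using gap_0_gt_imp[of l "bits _"]
    by (intro \<Omega>.finite_measure_mono quiet_\<Omega>[OF G]) (auto simp: quiet_def bits_def simp del: gap.simps)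
  obtain c q where c: "c > 0" "0 < q" "q < 1" "\<forall>j. measure \<Omega> (quiet (space \<Omega>) 0 j) \<le> c * q ^ j"
    using quiet_initial_decay by (elim exE conjE) (rule that)
  show ?thesis
  proof (rule exI[of _ c], intro conjI c, rule exI[of _ q], intro conjI c allI)
    show "measure \<Omega> {\<omega> \<in> space \<Omega>. gap (bits \<omega>) 0 > enat l} \<le> c * q ^ l" for l
      by (rule order_trans[OF le]) (rule c(4)[rule_format])
  qed
qed

section \<open>From gaps back to cycle lengths\<close>

lemma cycle_length_bits: "cycle_length C m x y (Suc i) \<omega> = gap (bits \<omega>) i"
  by (simp only: cycle_length_eq_gap bits_def[abs_def] Z_def)

lemma cycle_length_measurable: "cycle_length C m x y (Suc i) \<in> \<Omega> \<rightarrow>\<^sub>M count_space UNIV"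
  using gap_measurable[of i] by (simp only: cycle_length_bits[abs_def])

lemma cycle_lengths_indep:
  "\<Omega>.indep_vars (\<lambda>_. count_space UNIV) (cycle_length C m x y) {1..}"
proof -
  let ?L = "cycle_length C m x y"
  obtain \<pi> b \<rho> where rates: "regenerates_with \<pi> b \<rho>"
    using regenerates_with_exists by (elim exE)
  have rv: "?L i \<in> \<Omega> \<rightarrow>\<^sub>M count_space UNIV" if "i \<ge> 1" for i
    using cycle_length_measurable[of "i - 1"] that by simp
  have "\<Omega>.indep_sets (\<lambda>i. {?L i -` A \<inter> space \<Omega> | A. A \<in> sets (count_space UNIV)}) {1..}"
  proof (rule \<Omega>.indep_setsI)
    fix i :: nat assume "i \<in> {1..}"
    then show "{?L i -` A \<inter> space \<Omega> | A. A \<in> sets (count_space UNIV)} \<subseteq> \<Omega>.events"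
      using measurable_sets[OF rv] by auto
  next
    fix E J assume J: "J \<noteq> {}" "J \<subseteq> {1 :: nat..}" "finite J"
      and E: "\<forall>j\<in>J. E j \<in> {?L j -` A \<inter> space \<Omega> | A. A \<in> sets (count_space UNIV)}"
    then have "\<forall>j\<in>J. \<exists>A. E j = ?L j -` A \<inter> space \<Omega>" by blast
    then obtain S where S: "\<forall>j\<in>J. E j = ?L j -` S j \<inter> space \<Omega>"
      by (rule bchoice[THEN exE])
    \<comment> \<open>Padding with \<open>UNIV\<close> extends the finite index set J to an initial
      segment, the form in which the product formula was proved.\<close>
    define A where "A i = (if Suc i \<in> J then S (Suc i) else UNIV)" for i
    define n where "n = Max J"
    have E_eq: "E (Suc i) = {\<omega> \<in> space \<Omega>. gap (bits \<omega>) i \<in> A i}" if "Suc i \<in> J" for i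
      using S that by (auto simp: A_def cycle_length_bits)
    have J_Suc: "J = Suc ` {i. Suc i \<in> J}"
    proof (intro equalityI subsetI)
      fix j assume j: "j \<in> J"
      then have "Suc (j - 1) = j" using J(2) by auto
      with j show "j \<in> Suc ` {i. Suc i \<in> J}" by (intro image_eqI[of _ _ "j - 1"]) simp_all
    qed auto
    have bound: "i \<le> n" if "Suc i \<in> J" for i
      using Max_ge[OF J(3) that] by (simp add: n_def)
    have "(\<Inter>j\<in>J. E j) = {\<omega> \<in> space \<Omega>. \<forall>i\<le>n. gap (bits \<omega>) i \<in> A i}"
    proof -
      have "(\<Inter>j\<in>J. E j) = (\<Inter>i\<in>{i. Suc i \<in> J}. {\<omega> \<in> space \<Omega>. gap (bits \<omega>) i \<in> A i})"
        by (subst J_Suc) (simp add: image_image E_eq del: gap.simps)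
      also have "\<dots> = {\<omega> \<in> space \<Omega>. \<forall>i\<le>n. gap (bits \<omega>) i \<in> A i}"
      proof -
        have "{i. Suc i \<in> J} \<noteq> {}" using J(1) J_Suc by blast
        then show ?thesis using bound by (auto simp: A_def simp del: gap.simps)
      qed
      finally show ?thesis .
    qed
    then have "measure \<Omega> (\<Inter>j\<in>J. E j) = (\<Prod>i\<le>n. measure \<Omega> {\<omega> \<in> space \<Omega>. gap (bits \<omega>) i \<in> A i})"
      by (simp only: measure_gaps_prod[OF rates])
    also have "\<dots> = (\<Prod>i\<in>{i. Suc i \<in> J}. measure \<Omega> {\<omega> \<in> space \<Omega>. gap (bits \<omega>) i \<in> A i})"
      using bound by (intro prod.mono_neutral_right) (auto simp: A_def \<Omega>.prob_space)
    also have "\<dots> = (\<Prod>j\<in>J. measure \<Omega> (E j))"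
      by (subst (2) J_Suc) (simp add: prod.reindex E_eq del: gap.simps)
    finally show "measure \<Omega> (\<Inter>j\<in>J. E j) = (\<Prod>j\<in>J. measure \<Omega> (E j))" .
  qed
  then show ?thesis
    unfolding \<Omega>.indep_vars_def2 using rv by auto
qed

lemma cycle_lengths_identically_distributed:
  assumes "i \<ge> 2"
  shows "distr \<Omega> (count_space UNIV) (cycle_length C m x y i) = distr \<Omega> (count_space UNIV) (cycle_length C m x y 2)"
proof -
  obtain \<pi> b \<rho> where rates: "regenerates_with \<pi> b \<rho>"
    using regenerates_with_exists by (elim exE)
  have prob: "emeasure (distr \<Omega> (count_space UNIV) (cycle_length C m x y (Suc (Suc n)))) B
      = ennreal (gap_prob \<pi> B)" for n B
  proof -
    have "emeasure (distr \<Omega> (count_space UNIV) (cycle_length C m x y (Suc (Suc n)))) B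
        = ennreal (measure \<Omega> {\<omega> \<in> space \<Omega>. gap (bits \<omega>) (Suc n) \<in> B})"
      by (subst emeasure_distr[OF cycle_length_measurable])
         (auto simp: cycle_length_bits \<Omega>.emeasure_eq_measure vimage_def Int_def conj_commute simp del: gap.simps)
    then show ?thesis by (simp only: measure_gap_Suc[OF rates])
  qed
  have "i = Suc (Suc (i - 2))"
    using assms by simp
  then obtain n where "i = Suc (Suc n)" ..
  then show ?thesis
    by (intro measure_eqI) (simp_all add: prob numeral_2_eq_2)
qed

lemma cycle_length_tail:
  "\<exists>b>0. \<exists>\<rho>. 0 < \<rho> \<and> \<rho> < 1 \<and>
    (\<forall>i\<ge>1. \<forall>l::nat. measure \<Omega> {\<omega> \<in> space \<Omega>. cycle_length C m x y i \<omega> > enat l} \<le> b * \<rho> ^ l)"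
proof -
  obtain \<pi> b \<rho> where rates: "regenerates_with \<pi> b \<rho>"
    using regenerates_with_exists by (elim exE)
  obtain c q where c: "c > 0" "0 < q" "q < 1"
    "\<forall>l. measure \<Omega> {\<omega> \<in> space \<Omega>. gap (bits \<omega>) 0 > enat l} \<le> c * q ^ l"
    using gap_0_tail by (elim exE conjE) (rule that)
  note b = rates_bounds[OF rates]
  have le: "measure \<Omega> {\<omega> \<in> space \<Omega>. cycle_length C m x y i \<omega> > enat l} \<le> max b c * max \<rho> q ^ l"
    if "i \<ge> 1" for i l
  proof (cases "i = 1")
    case True
    have "measure \<Omega> {\<omega> \<in> space \<Omega>. cycle_length C m x y i \<omega> > enat l} \<le> c * q ^ l"
      using c(4) True by (simp add: cycle_length_bits del: gap.simps)
    also have "\<dots> \<le> max b c * max \<rho> q ^ l"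
      using b c by (intro mult_mono power_mono) auto
    finally show ?thesis .
  next
    case False
    define n where "n = i - 2"
    have n: "i = Suc (Suc n)"
      using False that by (simp add: n_def)
    have "measure \<Omega> {\<omega> \<in> space \<Omega>. cycle_length C m x y i \<omega> > enat l} \<le> b * \<rho> ^ l"
      using measure_gap_Suc_gt[OF rates, of l n] by (simp only: n cycle_length_bits)
    also have "\<dots> \<le> max b c * max \<rho> q ^ l"
      using b c by (intro mult_mono power_mono) auto
    finally show ?thesis .
  qed
  show ?thesis
    by (rule exI[of _ "max b c"], intro conjI, use b c in simp,
        rule exI[of _ "max \<rho> q"]) (use b c le in simp)
qed

end

theorem lemma6:
  fixes X :: "'a measure" and P :: "'a \<Rightarrow> 'a measure" and \<psi> :: "'a measure"
    and V :: "'a \<Rightarrow> real" and lam b0 :: real and C0 :: "'a set"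
    and C :: "'a set" and \<kappa> \<beta> :: real and m :: nat and \<nu> :: "'a measure"
    and M :: "'v measure" and \<xi> :: "nat \<Rightarrow> 'v \<Rightarrow> 'a"
    and \<Omega> :: "'w measure" and x :: "nat \<Rightarrow> 'w \<Rightarrow> 'a" and y :: "nat \<Rightarrow> 'w \<Rightarrow> bool"
  assumes "markov_kernel X P"
    and "psi_irreducible X P \<psi>" and "aperiodic X P \<psi>"
    and "petite X P C0" and "0 \<le> lam" and "lam < 1" and "drift_condition X P V lam b0 C0"
    and "markov_chain M X P \<xi>" and "(\<integral>\<^sup>+\<omega>. ennreal (V (\<xi> 0 \<omega>)) \<partial>M) < \<infinity>"
    and "accessible X P C"
    and "\<kappa> > 1" and "\<forall>a. 1 < a \<and> a \<le> \<kappa> \<longrightarrow> (SUP u\<in>C. return_moment X P C a u) < \<infinity>"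
    and "minorization X P C m \<beta> \<nu>"
    and "nummelin_splitting \<Omega> X P C m \<beta> \<nu> x y"
    and "distr \<Omega> (PiM UNIV (\<lambda>_. X)) (\<lambda>\<omega> n. x n \<omega>) = distr M (PiM UNIV (\<lambda>_. X)) (\<lambda>\<omega> n. \<xi> n \<omega>)"
  defines "L \<equiv> cycle_length C m x y"
  shows "prob_space.indep_vars \<Omega> (\<lambda>_. count_space UNIV) L {1..} \<and>
    (prob_space.indep_vars \<Omega> (\<lambda>_. count_space UNIV) L {2..} \<and>
      (\<forall>i\<ge>2. distr \<Omega> (count_space UNIV) (L i) = distr \<Omega> (count_space UNIV) (L 2))) \<and>
    (\<exists>b>0. \<exists>\<rho>. 0 < \<rho> \<and> \<rho> < 1 \<and>
      (\<forall>i\<ge>1. \<forall>l::nat. measure \<Omega> {\<omega> \<in> space \<Omega>. L i \<omega> > enat l} \<le> b * \<rho> ^ l))"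
proof -
  have \<xi>: "\<xi> n \<in> M \<rightarrow>\<^sub>M X" for n
    using \<open>markov_chain M X P \<xi>\<close> by (simp add: markov_chain_def)
  interpret split_process X P C m \<beta> \<nu> \<Omega> x y
    using assms by unfold_locales
  have V: "V \<in> borel_measurable X"
    using \<open>drift_condition X P V lam b0 C0\<close> by (simp add: drift_condition_def)
  have V_PiM: "(\<lambda>w. ennreal (V (w 0))) \<in> borel_measurable (PiM (UNIV :: nat set) (\<lambda>_. X))"
    using V by measurable
  have paths: "(\<lambda>\<omega> n. x n \<omega>) \<in> \<Omega> \<rightarrow>\<^sub>M PiM UNIV (\<lambda>_. X)" "(\<lambda>\<omega> n. \<xi> n \<omega>) \<in> M \<rightarrow>\<^sub>M PiM UNIV (\<lambda>_. X)"
    using x_space measurable_space[OF \<xi>] \<xi> by (auto intro!: measurable_PiM_single')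
  \<comment> \<open>The moment of V is given for the original chain; it passes to the split chain
    because their path laws agree.\<close>
  have "(\<integral>\<^sup>+\<omega>. ennreal (V (x 0 \<omega>)) \<partial>\<Omega>)
      = (\<integral>\<^sup>+w. ennreal (V (w 0)) \<partial>distr \<Omega> (PiM UNIV (\<lambda>_. X)) (\<lambda>\<omega> n. x n \<omega>))"
    using V_PiM by (simp add: nn_integral_distr[OF paths(1)])
  also have "\<dots> = (\<integral>\<^sup>+w. ennreal (V (w 0)) \<partial>distr M (PiM UNIV (\<lambda>_. X)) (\<lambda>\<omega> n. \<xi> n \<omega>))"
    using assms by simp
  also have "\<dots> = (\<integral>\<^sup>+\<omega>. ennreal (V (\<xi> 0 \<omega>)) \<partial>M)"
    using V_PiM by (simp add: nn_integral_distr[OF paths(2)])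
  also have "\<dots> < \<infinity>"
    by fact
  finally have V_init: "(\<integral>\<^sup>+\<omega>. ennreal (V (x 0 \<omega>)) \<partial>\<Omega>) < \<infinity>" .
  interpret split_drift X P C m \<beta> \<nu> \<psi> V lam b0 C0 \<Omega> x y
    using assms V_init by unfold_locales
  show ?thesis
    unfolding L_def
    by (intro conjI cycle_lengths_indep \<Omega>.indep_vars_subset[OF cycle_lengths_indep, of "{2..}"]
        allI impI cycle_lengths_identically_distributed cycle_length_tail) auto
qed

end
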